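(* Given two bounded-degree unrooted trees $T_A$ and $T_B$ (with $n$ nodes in total), whether $T_A$ is isomorphic to a subtree of $T_B$ can be decided in $\mathsf{NSPACE}[(\log n)^2]$.
   Context: Trees are unordered; a subtree of $T_B$ is a tree obtained from $T_B$ by removing some nodes and edges. *)

theory Defs
  imports Complex_Main "HOL-Library.Landau_Symbols"
begin

section \<open>Unrooted, unordered trees\<close>

record 'a ugraph =
  nodes :: "'a set"
  edges :: "'a set set"

definition simple_graph :: "'a ugraph \<Rightarrow> bool" where
  "simple_graph G \<longleftrightarrow> finite (nodes G) \<and> (\<forall>e \<in> edges G. e \<subseteq> nodes G \<and> card e = 2)"

definition walk :: "'a ugraph \<Rightarrow> 'a list \<Rightarrow> bool" where
  "walk G p \<longleftrightarrow> p \<noteq> [] \<and> set p \<subseteq> nodes G \<and> successively (\<lambda>u v. {u, v} \<in> edges G) p"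

definition connected_graph :: "'a ugraph \<Rightarrow> bool" where
  "connected_graph G \<longleftrightarrow>
     (\<forall>u \<in> nodes G. \<forall>v \<in> nodes G. \<exists>p. walk G p \<and> hd p = u \<and> last p = v)"

definition is_cycle :: "'a ugraph \<Rightarrow> 'a list \<Rightarrow> bool" where
  "is_cycle G p \<longleftrightarrow> walk G p \<and> distinct p \<and> length p \<ge> 3 \<and> {last p, hd p} \<in> edges G"

definition is_tree :: "'a ugraph \<Rightarrow> bool" where
  "is_tree G \<longleftrightarrow>
     simple_graph G \<and> nodes G \<noteq> {} \<and> connected_graph G \<and> (\<nexists>p. is_cycle G p)"

definition degree :: "'a ugraph \<Rightarrow> 'a \<Rightarrow> nat" where
  "degree G v = card {e \<in> edges G. v \<in> e}"

definition max_degree_le :: "nat \<Rightarrow> 'a ugraph \<Rightarrow> bool" where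
  "max_degree_le d G \<longleftrightarrow> (\<forall>v \<in> nodes G. degree G v \<le> d)"

definition subtree :: "'a ugraph \<Rightarrow> 'a ugraph \<Rightarrow> bool" where
  "subtree S T \<longleftrightarrow> is_tree S \<and> nodes S \<subseteq> nodes T \<and> edges S \<subseteq> edges T"

definition isomorphic :: "'a ugraph \<Rightarrow> 'b ugraph \<Rightarrow> bool" where
  "isomorphic G H \<longleftrightarrow> (\<exists>f. bij_betw f (nodes G) (nodes H) \<and>
     (\<forall>u \<in> nodes G. \<forall>v \<in> nodes G. {u, v} \<in> edges G \<longleftrightarrow> {f u, f v} \<in> edges H))"


section \<open>Nondeterministic space-bounded Turing machines\<close>

text \<open>
  A machine has a two-way read-only input tape, whose ends are marked, and a fixed number of
  read-write work tapes. States and work symbols are natural numbers, and 0 is the blank; as the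
  transition table is finite, only finitely many of them are used by a machine. A table entry
  \<open>(q, a, bs, q', d, acts)\<close> reads: in state \<open>q\<close>, scanning \<open>a\<close> on the input tape and the symbols
  \<open>bs\<close> on the work tapes, the machine may enter \<open>q'\<close>, move the input head by \<open>d\<close>, and write and
  move on the work tapes as prescribed by \<open>acts\<close>.
\<close>

datatype in_symbol = Left_End | Right_End | Bit bool

datatype dir = Go_Left | Stay | Go_Right

record ntm =
  work_tapes :: nat
  start_state :: nat
  accept_state :: nat
  transitions :: "(nat \<times> in_symbol \<times> nat list \<times> nat \<times> dir \<times> (nat \<times> dir) list) set"

definition wf_ntm :: "ntm \<Rightarrow> bool" where
  "wf_ntm M \<longleftrightarrow> finite (transitions M) \<and>
     (\<forall>(q, a, bs, q', d, acts) \<in> transitions M.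
        q \<noteq> accept_state M \<and> length bs = work_tapes M \<and> length acts = work_tapes M)"

text \<open>
  A work tape is its contents together with the head position. Work tapes are infinite to the
  right only; a head that tries to leave a tape at its left end stays where it is. The input
  head is confined to the input and its two end markers, at positions 0 and \<open>length w + 1\<close>.
\<close>

type_synonym tape = "(nat \<Rightarrow> nat) \<times> nat"
type_synonym config = "nat \<times> nat \<times> tape list"

fun move :: "dir \<Rightarrow> nat \<Rightarrow> nat" where
  "move Go_Left i = i - 1"
| "move Stay i = i"
| "move Go_Right i = i + 1"

definition read_input :: "bool list \<Rightarrow> nat \<Rightarrow> in_symbol" where
  "read_input w i =
     (if i = 0 then Left_End else if i \<le> length w then Bit (w ! (i - 1)) else Right_End)"

definition read_tape :: "tape \<Rightarrow> nat" where
  "read_tape = (\<lambda>(t, h). t h)"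

definition update_tape :: "tape \<Rightarrow> nat \<times> dir \<Rightarrow> tape" where
  "update_tape = (\<lambda>(t, h) (b, d). (t(h := b), move d h))"

definition initial_config :: "ntm \<Rightarrow> config" where
  "initial_config M = (start_state M, 0, replicate (work_tapes M) (\<lambda>_. 0, 0))"

inductive step :: "ntm \<Rightarrow> bool list \<Rightarrow> config \<Rightarrow> config \<Rightarrow> bool" for M w where
  "(q, read_input w i, map read_tape ts, q', d, acts) \<in> transitions M \<Longrightarrow>
   step M w (q, i, ts) (q', min (length w + 1) (move d i), map2 update_tape ts acts)"

definition reachable :: "ntm \<Rightarrow> bool list \<Rightarrow> config \<Rightarrow> bool" where
  "reachable M w c \<longleftrightarrow> (step M w)\<^sup>*\<^sup>* (initial_config M) c"

definition accepts :: "ntm \<Rightarrow> bool list \<Rightarrow> bool" where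
  "accepts M w \<longleftrightarrow> (\<exists>c. reachable M w c \<and> fst c = accept_state M)"

definition halts :: "ntm \<Rightarrow> bool list \<Rightarrow> bool" where
  "halts M w \<longleftrightarrow> (\<nexists>r. r 0 = initial_config M \<and> (\<forall>k::nat. step M w (r k) (r (Suc k))))"

text \<open>
  On every computation path at most the first \<open>s\<close> cells of each work tape are visited. The number
  of work tapes is fixed by the machine, so counting cells per tape rather than in total only
  changes constant factors.
\<close>

definition uses_space :: "ntm \<Rightarrow> bool list \<Rightarrow> nat \<Rightarrow> bool" where
  "uses_space M w s \<longleftrightarrow>
     (\<forall>q i ts. reachable M w (q, i, ts) \<longrightarrow> (\<forall>(t, h) \<in> set ts. h < s))"

definition NSPACE :: "(nat \<Rightarrow> real) \<Rightarrow> bool list set set" where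
  "NSPACE f = {L. \<exists>M s. wf_ntm M \<and> (\<lambda>n. real (s n)) \<in> O(f) \<and>
     (\<forall>w. halts M w \<and> uses_space M w (s (length w)) \<and> (accepts M w \<longleftrightarrow> w \<in> L))}"


section \<open>The subtree isomorphism problem\<close>

text \<open>
  A graph on the nodes \<open>{..<n}\<close> is presented as \<open>n\<close> in unary followed by its adjacency matrix in
  row-major order.
\<close>

definition encode_graph :: "nat ugraph \<Rightarrow> bool list" where
  "encode_graph G = (let n = card (nodes G) in
     replicate n True @ [False] @ concat (map (\<lambda>u. map (\<lambda>v. {u, v} \<in> edges G) [0..<n]) [0..<n]))"

definition tree_instance :: "nat \<Rightarrow> nat ugraph \<Rightarrow> bool" where
  "tree_instance d T \<longleftrightarrow> is_tree T \<and> max_degree_le d T \<and> nodes T = {..<card (nodes T)}"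

definition SUBTREE_ISO :: "nat \<Rightarrow> bool list set" where
  "SUBTREE_ISO d = {encode_graph T\<^sub>A @ encode_graph T\<^sub>B | T\<^sub>A T\<^sub>B.
     tree_instance d T\<^sub>A \<and> tree_instance d T\<^sub>B \<and> (\<exists>S. subtree S T\<^sub>B \<and> isomorphic T\<^sub>A S)}"

text \<open>
  The input length and the total number of nodes are polynomially related, so
  \<open>(log n)\<^sup>2\<close> has the same order of growth for either reading of \<open>n\<close>.
\<close>

lemma length_encode_graph:
  "length (encode_graph G) = (card (nodes G))\<^sup>2 + card (nodes G) + 1"
  by (simp add: encode_graph_def Let_def length_concat comp_def sum_list_triv power2_eq_square)

lemma length_encode_pair:
  fixes T\<^sub>A T\<^sub>B :: "nat ugraph"
  defines "n \<equiv> card (nodes T\<^sub>A) + card (nodes T\<^sub>B)"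
  shows "n \<le> length (encode_graph T\<^sub>A @ encode_graph T\<^sub>B)"
    and "length (encode_graph T\<^sub>A @ encode_graph T\<^sub>B) \<le> (n + 2)\<^sup>2"
  by (simp_all add: n_def length_encode_graph power2_eq_square algebra_simps)

end

theory Submission
  imports Defs "HOL-Library.Countable" "HOL-Library.Discrete_Functions"
begin

text \<open>
  Root both trees. An embedding maps the children of a node injectively to neighbours of its image
  other than the image of its parent, and conversely a map that does so at every node is injective,
  since the trees have no cycles. So it suffices to process a stack of tasks \<open>(v, p, x, y)\<close>, meaning
  that \<open>v\<close> with parent \<open>p\<close> is mapped to \<open>x\<close> and \<open>p\<close> to \<open>y\<close>: pop a task, guess the images of the at
  most \<open>d\<close> children, and push the tasks of the children in a guessed order. If a child with the
  largest subtree comes last, every other child has at most half of the nodes of its parent, so at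
  most \<open>d log n + 1\<close> tasks of \<open>O(log n)\<close> bits are stored at any time. The order is only guessed: a
  machine whose tapes are bounded in advance simply rejects when the stack does not fit.

  That the input encodes two trees is checked by guessing a walk from every node to node 0 and by
  counting edges. All this is a program over counters below \<open>2^O(log\<^sup>2 n)\<close>, whose loops are
  bounded, so that it halts on every path; a Turing machine stores each counter in binary on a tape
  of its own.
\<close>

text \<open>The definition of \<open>NSPACE\<close> asks for halting and for the space bound on
  every path, also after wrong guesses. So every loop has a count fixed on entry, and every guess is
  bounded and checked against the input. The tapes are cut to size before anything is guessed; as
  the logarithm of the input length is not given, the machine finds it by counting the input cells
  in binary and adding a cell to all tapes whenever the counter is full. Acceptance has two
  directions: no run accepts a wrong input, and some run accepts a correct one. Both follow the same
  program text, so there is one calculus with a mode flag. In the first mode an overflow is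
  harmless, as the run gets stuck; in the second it must be excluded, and only there the order of
  the children matters. The factor d comes from this order: passing to a child other than the last
  lowers the rounded logarithm of the subtree size by at least one, which pays for the siblings
  waiting below it on the stack, while the last child has no sibling below it. A run that follows an
  embedding processes each node of the first tree once, so as many rounds as it has nodes
  suffice.\<close>

section \<open>Nondeterministic counter programs\<close>

text \<open>
  Register 0 is the distance of the input head from the right end marker, register 1 the current
  length of the work tapes, and register \<open>r \<ge> 2\<close> is stored in binary on tape \<open>r - 2\<close>, so that its
  values are below two to the power of register 1. The instruction \<open>GrowT\<close> appends a cell to every
  tape; \<open>ZeroR\<close>, \<open>FullR\<close> and \<open>BitIs\<close> are tests that get stuck if they fail. \<open>Loop r c\<close> decrements
  \<open>r\<close> before each execution of \<open>c\<close>.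
\<close>

datatype prim = IncR nat | DecR nat | ZeroR nat | FullR nat | GrowT | BitIs bool | Nop

datatype com = Prim prim | Seq com com (infixr ";;" 60) | Choice com com (infixr "[+]" 58)
  | Loop nat com

text \<open>
  Control states of the machine. The remaining program is a list of commands; \<open>Scan\<close> sweeps the
  work heads, which always move together, to the right, and \<open>Ret\<close> brings them back.
\<close>

datatype ctl = Start com | Run "com list" | Scan "com list" | Ret "com list"

instance prim :: countable by countable_datatype
instance com :: countable by countable_datatype
instance ctl :: countable by countable_datatype

section \<open>Semantics of programs\<close>

definition room :: "bool list \<Rightarrow> (nat \<Rightarrow> nat) \<Rightarrow> nat \<Rightarrow> nat" where
  "room w s r = (if r = 0 then length w + 1 else 2 ^ s 1 - 1)"

fun pexec :: "bool list \<Rightarrow> prim \<Rightarrow> (nat \<Rightarrow> nat) \<Rightarrow> (nat \<Rightarrow> nat) option" where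
  "pexec w (IncR r) s = (if s r < room w s r then Some (s(r := Suc (s r))) else None)"
| "pexec w (DecR r) s = (if 0 < s r then Some (s(r := s r - 1)) else None)"
| "pexec w (ZeroR r) s = (if s r = 0 then Some s else None)"
| "pexec w (FullR r) s = (if s r = room w s r then Some s else None)"
| "pexec w GrowT s = Some (s(1 := Suc (s 1)))"
| "pexec w (BitIs b) s =
     (if read_input w (length w + 1 - s 0) = Bit b then Some s else None)"
| "pexec w Nop s = Some s"

text \<open>
  \<open>wp w B m c Q s\<close> says for \<open>m = True\<close> that every run of \<open>c\<close> from \<open>s\<close> that does not get stuck ends
  in \<open>Q\<close>, and for \<open>m = False\<close> that some run does; in both cases the tapes must stay within \<open>B\<close>
  cells. The body of a loop is required to preserve the loop register.
\<close>

primrec loop_wp :: "nat \<Rightarrow> (((nat \<Rightarrow> nat) \<Rightarrow> bool) \<Rightarrow> (nat \<Rightarrow> nat) \<Rightarrow> bool) \<Rightarrow>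
    ((nat \<Rightarrow> nat) \<Rightarrow> bool) \<Rightarrow> nat \<Rightarrow> (nat \<Rightarrow> nat) \<Rightarrow> bool" where
  "loop_wp r F Q 0 = Q"
| "loop_wp r F Q (Suc i) = (\<lambda>s. F (\<lambda>t. t r = i \<and> loop_wp r F Q i t) (s(r := i)))"

primrec wp :: "bool list \<Rightarrow> nat \<Rightarrow> bool \<Rightarrow> com \<Rightarrow> ((nat \<Rightarrow> nat) \<Rightarrow> bool) \<Rightarrow> (nat \<Rightarrow> nat) \<Rightarrow> bool"
where
  "wp w B m (Prim p) = (\<lambda>Q s. (p = GrowT \<longrightarrow> s 1 < B) \<and>
     (case pexec w p s of None \<Rightarrow> m | Some t \<Rightarrow> Q t))"
| "wp w B m (c ;; d) = (\<lambda>Q. wp w B m c (wp w B m d Q))"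
| "wp w B m (c [+] d) = (\<lambda>Q s. if m then wp w B m c Q s \<and> wp w B m d Q s
     else wp w B m c Q s \<or> wp w B m d Q s)"
| "wp w B m (Loop r c) = (\<lambda>Q s. loop_wp r (wp w B m c) Q (s r) s)"

section \<open>Compilation to a Turing machine\<close>

fun wf_prim :: "nat \<Rightarrow> prim \<Rightarrow> bool" where
  "wf_prim k (IncR r) \<longleftrightarrow> r \<noteq> 1 \<and> r < k + 2"
| "wf_prim k (DecR r) \<longleftrightarrow> r \<noteq> 1 \<and> r < k + 2"
| "wf_prim k (ZeroR r) \<longleftrightarrow> r \<noteq> 1 \<and> r < k + 2"
| "wf_prim k (FullR r) \<longleftrightarrow> r \<noteq> 1 \<and> r < k + 2"
| "wf_prim k _ \<longleftrightarrow> True"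

primrec wf_com :: "nat \<Rightarrow> com \<Rightarrow> bool" where
  "wf_com k (Prim p) \<longleftrightarrow> wf_prim k p"
| "wf_com k (c ;; d) \<longleftrightarrow> wf_com k c \<and> wf_com k d"
| "wf_com k (c [+] d) \<longleftrightarrow> wf_com k c \<and> wf_com k d"
| "wf_com k (Loop r c) \<longleftrightarrow> r \<noteq> 1 \<and> r < k + 2 \<and> wf_com k c"

text \<open>Register 0 measures the distance to the right end, so incrementing it moves the head to
  the left, and the tests for zero and for fullness look for the end markers. \<open>None\<close>
  means that the machine gets stuck.\<close>

fun head_act :: "prim \<Rightarrow> in_symbol \<Rightarrow> dir option" where
  "head_act (IncR r) a = (if a \<noteq> Left_End then Some Go_Left else None)"
| "head_act (DecR r) a = (if a \<noteq> Right_End then Some Go_Right else None)"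
| "head_act (ZeroR r) a = (if a = Right_End then Some Stay else None)"
| "head_act (FullR r) a = (if a = Left_End then Some Stay else None)"
| "head_act (BitIs b) a = (if a = Bit b then Some Stay else None)"
| "head_act Nop a = Some Stay"
| "head_act GrowT a = None"

fun on_head :: "prim \<Rightarrow> bool" where
  "on_head (IncR r) \<longleftrightarrow> r = 0"
| "on_head (DecR r) \<longleftrightarrow> r = 0"
| "on_head (ZeroR r) \<longleftrightarrow> r = 0"
| "on_head (FullR r) \<longleftrightarrow> r = 0"
| "on_head GrowT \<longleftrightarrow> False"
| "on_head _ \<longleftrightarrow> True"

text \<open>
  How a primitive sweeps over a binary counter, least significant bit first: the value on a bit is
  \<open>None\<close> if the machine gets stuck, and otherwise says whether the sweep goes on and what is
  written.
\<close>

fun sweep :: "prim \<Rightarrow> bool \<Rightarrow> (bool \<times> bool) option" where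
  "sweep (IncR r) b = Some (b, \<not> b)"
| "sweep (DecR r) b = Some (\<not> b, \<not> b)"
| "sweep (ZeroR r) b = (if b then None else Some (True, b))"
| "sweep (FullR r) b = (if b then Some (True, b) else None)"
| "sweep _ b = None"

text \<open>What it means that a sweep runs past the last bit. A test has met only the bits it wants
  and succeeds; a carry has no cell to go to and a borrow has found the value 0, so
  \<open>IncR\<close> and \<open>DecR\<close> get stuck there, as in \<open>pexec\<close>.\<close>

fun end_ok :: "prim \<Rightarrow> bool" where
  "end_ok (ZeroR r) \<longleftrightarrow> True"
| "end_ok (FullR r) \<longleftrightarrow> True"
| "end_ok _ \<longleftrightarrow> False"

fun reg :: "prim \<Rightarrow> nat" where
  "reg (IncR r) = r" | "reg (DecR r) = r" | "reg (ZeroR r) = r" | "reg (FullR r) = r" | "reg _ = 0"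

definition bit_sym :: "bool \<Rightarrow> nat" where "bit_sym b = (if b then 2 else 1)"

text \<open>All tapes have the same length and their heads stand on the same cell, so a blank on
  tape 0 is a blank everywhere, and \<open>GrowT\<close> appends the bit 0, symbol 1, to all tapes
  in a single step. Being most significant, the new bit leaves the values as they are.\<close>

definition scan_delta :: "prim \<Rightarrow> com list \<Rightarrow> (nat \<Rightarrow> nat) \<Rightarrow> (ctl \<times> dir \<times> (nat \<Rightarrow> nat) \<times> dir) set"
where
  "scan_delta p K v = (let j = reg p - 2 in
     if p = GrowT then
       (if v 0 = 0 then {(Ret K, Stay, \<lambda>_. 1, Stay)} else {(Scan (Prim p # K), Stay, v, Go_Right)})
     else if v j = 0 then (if end_ok p then {(Ret K, Stay, v, Stay)} else {})
     else if v j = 3 then {}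
     else (case sweep p (v j = 2) of None \<Rightarrow> {} | Some (cont, b) \<Rightarrow>
       {(if cont then Scan (Prim p # K) else Ret K, Stay, v(j := bit_sym b),
         if cont then Go_Right else Stay)}))"

text \<open>Whether a loop register is zero is guessed: both branches begin with an assertion, and
  exactly one of \<open>DecR r\<close> and \<open>ZeroR r\<close> can be passed.\<close>

fun delta :: "ctl \<Rightarrow> in_symbol \<Rightarrow> (nat \<Rightarrow> nat) \<Rightarrow> (ctl \<times> dir \<times> (nat \<Rightarrow> nat) \<times> dir) set" where
  "delta (Start c) a v = {(Run [c], Stay, \<lambda>_. 3, Stay)}"
| "delta (Run []) a v = {}"
| "delta (Run (Prim p # K)) a v =
     (if on_head p then (case head_act p a of None \<Rightarrow> {} | Some d \<Rightarrow> {(Run K, d, v, Stay)})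
      else {(Scan (Prim p # K), Stay, v, Go_Right)})"
| "delta (Run ((c ;; d) # K)) a v = {(Run (c # d # K), Stay, v, Stay)}"
| "delta (Run ((c [+] d) # K)) a v = {(Run (c # K), Stay, v, Stay), (Run (d # K), Stay, v, Stay)}"
| "delta (Run (Loop r c # K)) a v =
     {(Run (Prim (DecR r) # c # Loop r c # K), Stay, v, Stay), (Run (Prim (ZeroR r) # K), Stay, v, Stay)}"
| "delta (Scan (Prim p # K)) a v = scan_delta p K v"
| "delta (Scan _) a v = {}"
| "delta (Ret K) a v = (if v 0 = 3 then {(Run K, Stay, v, Stay)} else {(Ret K, Stay, v, Go_Left)})"

lemma finite_delta: "finite (delta q a v)"
  by (cases "(q, a, v)" rule: delta.cases)
     (auto simp: scan_delta_def Let_def split: option.splits)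

text \<open>The command lists that can remain while \<open>c\<close> runs in front of
  \<open>K\<close>. There are finitely many since the body of a loop returns to the very list from
  which the loop started, so they can serve as control states.\<close>

primrec conts :: "com \<Rightarrow> com list \<Rightarrow> com list set" where
  "conts (Prim p) K = {Prim p # K}"
| "conts (c ;; d) K = insert ((c ;; d) # K) (conts c (d # K) \<union> conts d K)"
| "conts (c [+] d) K = insert ((c [+] d) # K) (conts c K \<union> conts d K)"
| "conts (Loop r c) K = {Loop r c # K, Prim (DecR r) # c # Loop r c # K, Prim (ZeroR r) # K}
     \<union> conts c (Loop r c # K)"

lemma finite_conts: "finite (conts c K)"
  by (induction c arbitrary: K) auto

lemma conts_self: "c # K \<in> conts c K"
  by (cases c) auto

definition all_conts :: "com \<Rightarrow> com list set" where
  "all_conts p = insert [] (conts p [])"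

definition ctls :: "com \<Rightarrow> ctl set" where
  "ctls p = insert (Start p) (Run ` all_conts p \<union> Scan ` all_conts p \<union> Ret ` all_conts p)"

text \<open>Entries beyond \<open>k\<close> are fixed to 0, so that a vector is determined by the
  symbols that the machine reads and there are only finitely many.\<close>

definition vecs :: "nat \<Rightarrow> (nat \<Rightarrow> nat) set" where
  "vecs k = {v. (\<forall>j<k. v j \<le> 3) \<and> (\<forall>j\<ge>k. v j = 0)}"

lemma finite_vecs: "finite (vecs k)"
proof -
  have "vecs k \<subseteq> {f. \<forall>x. (x \<in> {..<k} \<longrightarrow> f x \<in> {..3}) \<and> (x \<notin> {..<k} \<longrightarrow> f x = 0)}"
    by (auto simp: vecs_def)
  then show ?thesis
    by (rule finite_subset) (rule finite_set_of_finite_funs; simp)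
qed

text \<open>Symbol 0 is the blank, 1 and 2 are the bits, and 3 marks the left end of a work tape.\<close>

definition mach :: "nat \<Rightarrow> com \<Rightarrow> ntm" where
  "mach k p = \<lparr>work_tapes = k, start_state = to_nat (Start p), accept_state = to_nat (Run []),
     transitions = {(to_nat q, a, map v [0..<k], to_nat q', di, map (\<lambda>j. (g j, dw)) [0..<k]) |
       q a v q' di g dw. q \<in> ctls p \<and> v \<in> vecs k \<and> (q', di, g, dw) \<in> delta q a v}\<rparr>"

lemma mach_simps [simp]: "work_tapes (mach k p) = k" "start_state (mach k p) = to_nat (Start p)"
  "accept_state (mach k p) = to_nat (Run [])"
  by (simp_all add: mach_def)

lemma wf_mach: "wf_ntm (mach k p)"
proof -
  let ?A = "UNIV :: in_symbol set"
  have A: "?A = {Left_End, Right_End, Bit True, Bit False}"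
    by (auto, metis (full_types) in_symbol.exhaust)
  have "transitions (mach k p) \<subseteq>
     (\<lambda>((q, a, v), (q', di, g, dw)).
        (to_nat q, a, map v [0..<k], to_nat q', di, map (\<lambda>j. (g j, dw)) [0..<k])) `
     (SIGMA x:ctls p \<times> ?A \<times> vecs k. delta (fst x) (fst (snd x)) (snd (snd x)))"
    unfolding mach_def by force
  moreover have "finite ..."
    by (intro finite_imageI finite_SigmaI finite_cartesian_product finite_vecs finite_delta)
       (simp_all add: ctls_def all_conts_def finite_conts A)
  ultimately have "finite (transitions (mach k p))"
    by (rule finite_subset)
  then show ?thesis
    unfolding wf_ntm_def by (auto simp: mach_def)
qed

definition cfg :: "nat \<Rightarrow> ctl \<Rightarrow> nat \<Rightarrow> (nat \<Rightarrow> nat \<Rightarrow> nat) \<Rightarrow> nat \<Rightarrow> config" where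
  "cfg k q i C h = (to_nat q, i, map (\<lambda>j. (C j, h)) [0..<k])"

definition vec :: "nat \<Rightarrow> (nat \<Rightarrow> nat \<Rightarrow> nat) \<Rightarrow> nat \<Rightarrow> nat \<Rightarrow> nat" where
  "vec k C h = (\<lambda>j. if j < k then C j h else 0)"

lemma cfg_cong: "(\<And>j. j < k \<Longrightarrow> C j = C' j) \<Longrightarrow> cfg k q i C h = cfg k q i C' h"
  by (simp add: cfg_def)

text \<open>Reads the transition table back as \<open>delta\<close>. The table stores codes and
  lists, but \<open>to_nat\<close> is injective and a vector in \<open>vecs k\<close> is determined
  by its first \<open>k\<close> entries, so an entry reveals the control state and the vector it was
  made from.\<close>

lemma step_mach:
  assumes "q \<in> ctls p" "\<And>j. j < k \<Longrightarrow> C j h \<le> 3"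
  shows "step (mach k p) w (cfg k q i C h) z \<longleftrightarrow>
    (\<exists>(q', di, g, dw) \<in> delta q (read_input w i) (vec k C h).
       z = cfg k q' (min (length w + 1) (move di i)) (\<lambda>j. (C j)(h := g j)) (move dw h))"
proof -
  have rd: "map read_tape (map (\<lambda>j. (C j, h)) [0..<k]) = map (vec k C h) [0..<k]"
    by (auto simp: read_tape_def vec_def)
  have inV: "vec k C h \<in> vecs k"
    using assms(2) by (auto simp: vec_def vecs_def)
  have uniq: "v = vec k C h" if "v \<in> vecs k" "map (vec k C h) [0..<k] = map v [0..<k]" for v
  proof
    fix j show "v j = vec k C h j"
      using that by (cases "j < k") (auto simp: vecs_def vec_def)
  qed
  have up: "map2 update_tape (map (\<lambda>j. (C j, h)) [0..<k]) (map (\<lambda>j. (g j, dw)) [0..<k]) =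
      map (\<lambda>j. ((C j)(h := g j), move dw h)) [0..<k]" for g dw
    by (rule nth_equalityI) (auto simp: update_tape_def)
  have tr: "(to_nat q, a, map (vec k C h) [0..<k], q2, di, acts) \<in> transitions (mach k p) \<longleftrightarrow>
    (\<exists>q' g dw. (q', di, g, dw) \<in> delta q a (vec k C h) \<and> q2 = to_nat q' \<and>
       acts = map (\<lambda>j. (g j, dw)) [0..<k])" for a q2 di acts
    using inV uniq assms(1) unfolding mach_def by auto
  have "step (mach k p) w (cfg k q i C h) z \<longleftrightarrow>
    (\<exists>q2 di acts. (to_nat q, read_input w i, map (vec k C h) [0..<k], q2, di, acts)
         \<in> transitions (mach k p) \<and>
       z = (q2, min (length w + 1) (move di i), map2 update_tape (map (\<lambda>j. (C j, h)) [0..<k]) acts))"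
    unfolding cfg_def step.simps rd[symmetric] by auto
  also have "\<dots> \<longleftrightarrow> (\<exists>di q' g dw. (q', di, g, dw) \<in> delta q (read_input w i) (vec k C h) \<and>
       z = cfg k q' (min (length w + 1) (move di i)) (\<lambda>j. (C j)(h := g j)) (move dw h))"
    (is "?L \<longleftrightarrow> ?R")
  proof
    assume ?L
    then obtain q2 di acts where a: "(to_nat q, read_input w i, map (vec k C h) [0..<k], q2, di, acts)
         \<in> transitions (mach k p)"
       "z = (q2, min (length w + 1) (move di i), map2 update_tape (map (\<lambda>j. (C j, h)) [0..<k]) acts)"
      by blast
    from a(1)[unfolded tr] obtain q' g dw where b: "(q', di, g, dw) \<in> delta q (read_input w i) (vec k C h)"
      "q2 = to_nat q'" "acts = map (\<lambda>j. (g j, dw)) [0..<k]" by blast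
    have "z = cfg k q' (min (length w + 1) (move di i)) (\<lambda>j. (C j)(h := g j)) (move dw h)"
      unfolding a(2) b(2,3) up cfg_def ..
    with b(1) show ?R by blast
  next
    assume ?R
    then obtain di q' g dw where b: "(q', di, g, dw) \<in> delta q (read_input w i) (vec k C h)"
       "z = cfg k q' (min (length w + 1) (move di i)) (\<lambda>j. (C j)(h := g j)) (move dw h)" by blast
    have "z = (to_nat q', min (length w + 1) (move di i),
        map2 update_tape (map (\<lambda>j. (C j, h)) [0..<k]) (map (\<lambda>j. (g j, dw)) [0..<k]))"
      unfolding b(2) up cfg_def ..
    with b(1) tr show ?L by blast
  qed
  finally show ?thesis by (simp add: Bex_def split_paired_Ex) blast
qed

section \<open>Computations that halt, stay within the space bound and accept only if allowed
  to\<close>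

text \<open>
  Every computation from the configuration halts, keeps the work heads below \<open>b\<close>, and accepts only
  if \<open>\<phi>\<close> holds.
\<close>

inductive safe :: "ntm \<Rightarrow> bool list \<Rightarrow> nat \<Rightarrow> bool \<Rightarrow> config \<Rightarrow> bool" for M w b \<phi> where
  "(\<And>t h. (t, h) \<in> set (snd (snd c)) \<Longrightarrow> h < b) \<Longrightarrow> (fst c = accept_state M \<Longrightarrow> \<phi>) \<Longrightarrow>
   (\<And>c'. step M w c c' \<Longrightarrow> safe M w b \<phi> c') \<Longrightarrow> safe M w b \<phi> c"

lemma safe_reach: "(step M w)\<^sup>*\<^sup>* c c' \<Longrightarrow> safe M w b \<phi> c \<Longrightarrow> safe M w b \<phi> c'"
  by (induction rule: rtranclp_induct) (auto elim: safe.cases)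

text \<open>\<open>safe\<close> is a least fixed point, so an infinite run would descend forever in
  a well-founded derivation. This is how halting is obtained along with the other two
  properties.\<close>

lemma safe_no_run: "safe M w b \<phi> c \<Longrightarrow> r 0 = c \<Longrightarrow> \<exists>i. \<not> step M w (r i) (r (Suc i))"
proof (induction arbitrary: r rule: safe.induct)
  case (1 c)
  show ?case
  proof (rule ccontr)
    assume a: "\<not> ?thesis"
    then have "step M w c (r 1)" using 1(5) by (metis One_nat_def)
    from 1(4)[OF this, of "\<lambda>i. r (Suc i)"] a show False by auto
  qed
qed

lemma safe_initial:
  assumes "safe M w b \<phi> (initial_config M)"
  shows "halts M w" "uses_space M w b" "accepts M w \<Longrightarrow> \<phi>"
proof -
  show "halts M w" using safe_no_run[OF assms] unfolding halts_def by blast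
  show "uses_space M w b" unfolding uses_space_def
  proof (intro allI impI)
    fix q i ts assume "reachable M w (q, i, ts)"
    then have "safe M w b \<phi> (q, i, ts)"
      unfolding reachable_def using safe_reach assms by blast
    then show "\<forall>(t, h)\<in>set ts. h < b" by (auto elim: safe.cases)
  qed
  show \<phi> if "accepts M w"
  proof -
    obtain c where c: "reachable M w c" "fst c = accept_state M"
      using \<open>accepts M w\<close> unfolding accepts_def by blast
    then have "safe M w b \<phi> c" unfolding reachable_def using safe_reach assms by blast
    then show \<phi> using c(2) by (auto elim: safe.cases)
  qed
qed

text \<open>Forced steps serve both the statements about all computations and those about one.\<close>

definition det :: "ntm \<Rightarrow> bool list \<Rightarrow> nat \<Rightarrow> config \<Rightarrow> config \<Rightarrow> bool" where
  "det M w b c c' \<longleftrightarrow> (\<forall>(t, h) \<in> set (snd (snd c)). h < b) \<and> fst c \<noteq> accept_state M \<and>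
     (\<forall>z. step M w c z \<longleftrightarrow> z = c')"

lemma det_safe: "(det M w b)\<^sup>*\<^sup>* c c' \<Longrightarrow> safe M w b \<phi> c' \<Longrightarrow> safe M w b \<phi> c"
  by (induction rule: converse_rtranclp_induct) (auto simp: det_def intro: safe.intros)

lemma det_steps: "(det M w b)\<^sup>*\<^sup>* c c' \<Longrightarrow> (step M w)\<^sup>*\<^sup>* c c'"
  by (induction rule: rtranclp_induct) (auto simp: det_def intro: rtranclp.rtrancl_into_rtrancl)

section \<open>Binary counters on tapes\<close>

primrec bval :: "bool list \<Rightarrow> nat" where
  "bval [] = 0"
| "bval (b # bs) = of_bool b + 2 * bval bs"

lemma bval_less: "bval bs < 2 ^ length bs"
  by (induction bs) auto

lemma bval_append_False [simp]: "bval (bs @ [False]) = bval bs"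
  by (induction bs) auto

primrec scanl :: "prim \<Rightarrow> bool list \<Rightarrow> bool list option" where
  "scanl p [] = (if end_ok p then Some [] else None)"
| "scanl p (b # bs) = (case sweep p b of None \<Rightarrow> None
     | Some (cont, b') \<Rightarrow> if cont then map_option ((#) b') (scanl p bs) else Some (b' # bs))"

lemma length_scanl: "scanl p bs = Some bs' \<Longrightarrow> length bs' = length bs"
  by (induction bs arbitrary: bs') (auto split: if_splits option.splits)

lemma scanl_IncR: "case scanl (IncR r) bs of None \<Rightarrow> Suc (bval bs) = 2 ^ length bs
    | Some bs' \<Rightarrow> bval bs' = Suc (bval bs)"
  by (induction bs) (auto split: option.splits)

lemma scanl_DecR: "case scanl (DecR r) bs of None \<Rightarrow> bval bs = 0
    | Some bs' \<Rightarrow> Suc (bval bs') = bval bs"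
  by (induction bs) (auto split: option.splits)

lemma scanl_ZeroR: "scanl (ZeroR r) bs = (if bval bs = 0 then Some bs else None)"
  by (induction bs) auto

lemma scanl_FullR: "scanl (FullR r) bs = (if Suc (bval bs) = 2 ^ length bs then Some bs else None)"
  by (induction bs) (auto, presburger)

definition cells :: "bool list \<Rightarrow> nat \<Rightarrow> nat" where
  "cells bs i = (if i = 0 then 3 else if i \<le> length bs then bit_sym (bs ! (i - 1)) else 0)"

lemma cells_le: "cells bs i \<le> 3"
  by (simp add: cells_def bit_sym_def)

lemma cells_eq_3: "cells bs i = 3 \<longleftrightarrow> i = 0"
  by (simp add: cells_def bit_sym_def)

lemma cells_0 [simp]: "cells bs 0 = 3"
  by (simp add: cells_def)

lemma cells_mid [simp]: "cells (pre @ b # bs) (Suc (length pre)) = bit_sym b"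
  by (simp add: cells_def)

lemma cells_end [simp]: "cells bs (Suc (length bs)) = 0"
  by (simp add: cells_def)

lemma cells_upd: "(cells (pre @ b # bs))(Suc (length pre) := bit_sym b') = cells (pre @ b' # bs)"
  by (rule ext) (auto simp: cells_def nth_append nth_Cons')

lemma cells_grow: "(cells bs)(Suc (length bs) := 1) = cells (bs @ [False])"
  by (rule ext) (auto simp: cells_def nth_append bit_sym_def)

section \<open>Simulation of programs by the machine\<close>

definition rep :: "nat \<Rightarrow> (nat \<Rightarrow> nat) \<Rightarrow> (nat \<Rightarrow> bool list) \<Rightarrow> bool" where
  "rep k s D \<longleftrightarrow> (\<forall>j<k. length (D j) = s 1 \<and> bval (D j) = s (j + 2))"

abbreviation dcfg :: "nat \<Rightarrow> ctl \<Rightarrow> nat \<Rightarrow> (nat \<Rightarrow> bool list) \<Rightarrow> nat \<Rightarrow> config" where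
  "dcfg k q i D h \<equiv> cfg k q i (\<lambda>j. cells (D j)) h"

text \<open>At least one tape is required because the return of the heads and the growth of the
  tapes are steered by what tape 0 shows.\<close>

locale counter_program =
  fixes k :: nat and prog :: com and w :: "bool list" and B :: nat
  assumes k: "0 < k"
begin

abbreviation "n \<equiv> length w"
abbreviation "M \<equiv> mach k prog"
abbreviation "dett \<equiv> det M w (B + 2)"
abbreviation "ok \<equiv> safe M w (B + 2)"
abbreviation "steps \<equiv> (step M w)\<^sup>*\<^sup>*"

lemma in_ctls: "x \<in> all_conts prog \<Longrightarrow> Run x \<in> ctls prog" "x \<in> all_conts prog \<Longrightarrow> Scan x \<in> ctls prog"
   "x \<in> all_conts prog \<Longrightarrow> Ret x \<in> ctls prog"
  by (auto simp: ctls_def)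

lemma step_dcfg:
  assumes "q \<in> ctls prog"
  shows "step M w (dcfg k q i D h) z \<longleftrightarrow>
    (\<exists>(q', di, g, dw) \<in> delta q (read_input w i) (vec k (\<lambda>j. cells (D j)) h).
       z = cfg k q' (min (n + 1) (move di i)) (\<lambda>j. (cells (D j))(h := g j)) (move dw h))"
  using assms by (intro step_mach) (auto simp: cells_le)

lemma det_dcfgI:
  assumes "q \<in> ctls prog" "q \<noteq> Run []" "h < B + 2"
    "delta q (read_input w i) (vec k (\<lambda>j. cells (D j)) h) = {(q', di, g, dw)}"
    "\<And>j. j < k \<Longrightarrow> (cells (D j))(h := g j) = cells (D' j)"
    "i' = min (n + 1) (move di i)" "h' = move dw h"
  shows "dett (dcfg k q i D h) (dcfg k q' i' D' h')"
proof -
  have "cfg k q' i' (\<lambda>j. (cells (D j))(h := g j)) h' = dcfg k q' i' D' h'"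
    by (rule cfg_cong) (rule assms(5))
  then show ?thesis
    unfolding det_def step_dcfg[OF assms(1)] assms(4)
    using assms(2,3,6,7) by (auto simp: cfg_def)
qed

lemma stuck_safe:
  assumes "q \<in> ctls prog" "q \<noteq> Run []" "h < B + 2"
    "delta q (read_input w i) (vec k (\<lambda>j. cells (D j)) h) = {}"
  shows "ok \<phi> (dcfg k q i D h)"
  apply (rule safe.intros)
  using assms(2,3) apply (auto simp: cfg_def)[2]
  using step_dcfg[OF assms(1)] assms(4) by auto

lemma upd_vec_same: "j < k \<Longrightarrow> (cells (D j))(h := vec k (\<lambda>j. cells (D j)) h j) = cells (D j)"
  by (simp add: vec_def)

lemma ret:
  assumes "K \<in> all_conts prog" "i \<le> n + 1"
  shows "h \<le> B + 1 \<Longrightarrow> dett\<^sup>*\<^sup>* (dcfg k (Ret K) i D h) (dcfg k (Run K) i D 0)"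
proof (induction h)
  case 0
  have "dett (dcfg k (Ret K) i D 0) (dcfg k (Run K) i D 0)"
    by (rule det_dcfgI[OF in_ctls(3)[OF assms(1)]])
       (use k assms in \<open>auto simp: vec_def\<close>)
  then show ?case by blast
next
  case (Suc h)
  have "dett (dcfg k (Ret K) i D (Suc h)) (dcfg k (Ret K) i D h)"
    by (rule det_dcfgI[OF in_ctls(3)[OF assms(1)]])
       (use k assms Suc.prems in \<open>auto simp: vec_def cells_eq_3\<close>)
  with Suc show ?case by (meson converse_rtranclp_into_rtranclp Suc_leD)
qed

text \<open>Induction over the unread bits \<open>bs\<close>, with the bits already passed in
  \<open>pre\<close>; cell 0 holds the end marker, so the head is at
  \<open>Suc (length pre)\<close>. A failing sweep leaves the machine stuck, which is safe whatever
  \<open>\<phi>\<close> is.\<close>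

lemma scan:
  assumes x: "Prim p # K \<in> all_conts prog" and i: "i \<le> n + 1"
    and p: "p \<noteq> GrowT" and j: "j = reg p - 2" "j < k"
  shows "D j = pre @ bs \<Longrightarrow> length (D j) \<le> B \<Longrightarrow>
    (case scanl p bs of
      Some bs' \<Rightarrow> \<exists>h \<le> B + 1. dett\<^sup>*\<^sup>* (dcfg k (Scan (Prim p # K)) i D (Suc (length pre)))
         (dcfg k (Ret K) i (D(j := pre @ bs')) h)
    | None \<Rightarrow> ok \<phi> (dcfg k (Scan (Prim p # K)) i D (Suc (length pre))))"
proof (induction bs arbitrary: D pre)
  case Nil
  have v: "vec k (\<lambda>j. cells (D j)) (Suc (length pre)) j = 0"
    using Nil j by (simp add: vec_def)
  show ?case
  proof (cases "end_ok p")
    case True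
    have "dett (dcfg k (Scan (Prim p # K)) i D (Suc (length pre)))
         (dcfg k (Ret K) i D (Suc (length pre)))"
      by (rule det_dcfgI[OF in_ctls(2)[OF x]])
         (use True v p j Nil i in \<open>auto simp: scan_delta_def Let_def vec_def\<close>)
    moreover have "D(j := pre) = D" using Nil by auto
    moreover have "Suc (length pre) \<le> B + 1" using Nil by auto
    ultimately show ?thesis using True by auto
  next
    case False
    have "ok \<phi> (dcfg k (Scan (Prim p # K)) i D (Suc (length pre)))"
      by (rule stuck_safe[OF in_ctls(2)[OF x]])
         (use False v p j Nil in \<open>auto simp: scan_delta_def Let_def\<close>)
    then show ?thesis using False by simp
  qed
next
  case (Cons b bs)
  let ?V = "vec k (\<lambda>j. cells (D j)) (Suc (length pre))"
  have v: "?V j = bit_sym b"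
    using Cons.prems(1) j by (simp add: vec_def)
  have v2: "bit_sym b \<noteq> 0" "bit_sym b \<noteq> 3" "bit_sym b = 2 \<longleftrightarrow> b" by (auto simp: bit_sym_def)
  show ?case
  proof (cases "sweep p b")
    case None
    have "ok \<phi> (dcfg k (Scan (Prim p # K)) i D (Suc (length pre)))"
      by (rule stuck_safe[OF in_ctls(2)[OF x]])
         (use None v v2 p j Cons in \<open>auto simp: scan_delta_def Let_def\<close>)
    then show ?thesis using None by simp
  next
    case (Some cb)
    obtain cont b' where cb: "cb = (cont, b')" by force
    have upd: "(cells (D j'))(Suc (length pre) := (?V(j := bit_sym b')) j') =
      cells ((D(j := pre @ b' # bs)) j')" if "j' < k" for j'
      using that Cons.prems(1) by (auto simp: vec_def cells_upd)
    have 1: "dett (dcfg k (Scan (Prim p # K)) i D (Suc (length pre)))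
         (dcfg k (if cont then Scan (Prim p # K) else Ret K) i (D(j := pre @ b' # bs))
            (if cont then Suc (Suc (length pre)) else Suc (length pre)))"
      by (rule det_dcfgI[OF in_ctls(2)[OF x] _ _ _ upd, where di = Stay
            and dw = "if cont then Go_Right else Stay"])
         (use Some cb v v2 p j Cons.prems i in \<open>auto simp: scan_delta_def Let_def\<close>)
    show ?thesis
    proof (cases cont)
      case False
      then show ?thesis using 1 Some cb Cons.prems
        by (auto intro!: exI[of _ "Suc (length pre)"])
    next
      case True
      have IH: "case scanl p bs of
        Some bs' \<Rightarrow> \<exists>h \<le> B + 1. dett\<^sup>*\<^sup>* (dcfg k (Scan (Prim p # K)) i (D(j := pre @ b' # bs)) (Suc (length (pre @ [b']))))
         (dcfg k (Ret K) i ((D(j := pre @ b' # bs))(j := (pre @ [b']) @ bs')) h)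
        | None \<Rightarrow> ok \<phi> (dcfg k (Scan (Prim p # K)) i (D(j := pre @ b' # bs)) (Suc (length (pre @ [b']))))"
        by (rule Cons.IH) (use Cons.prems in auto)
      show ?thesis
        using IH 1 True Some cb
        by (auto split: option.splits intro: det_safe converse_rtranclp_into_rtranclp)
    qed
  qed
qed

text \<open>\<open>h\<close> is the distance left to go to the first blank, which is cell
  \<open>Suc L\<close> as cell 0 holds the marker.\<close>

lemma scan_grow:
  assumes x: "Prim GrowT # K \<in> all_conts prog" and i: "i \<le> n + 1" and L: "L < B"
    and D: "\<And>j. j < k \<Longrightarrow> length (D j) = L"
  shows "h \<le> L \<Longrightarrow> dett\<^sup>*\<^sup>* (dcfg k (Scan (Prim GrowT # K)) i D (Suc (L - h)))
         (dcfg k (Ret K) i (\<lambda>j. D j @ [False]) (Suc L))"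
proof (induction h)
  case 0
  have "dett (dcfg k (Scan (Prim GrowT # K)) i D (Suc L))
         (dcfg k (Ret K) i (\<lambda>j. D j @ [False]) (Suc L))"
    by (rule det_dcfgI[OF in_ctls(2)[OF x]])
       (use D k i L in \<open>auto simp: scan_delta_def Let_def vec_def cells_grow[symmetric]\<close>,
        metis cells_end)
  then show ?case by simp
next
  case (Suc h)
  have "cells (D 0) (Suc (L - Suc h)) \<noteq> 0"
    using Suc.prems D[OF k] by (auto simp: cells_def bit_sym_def)
  then have "dett (dcfg k (Scan (Prim GrowT # K)) i D (Suc (L - Suc h)))
         (dcfg k (Scan (Prim GrowT # K)) i D (Suc (L - h)))"
    by (intro det_dcfgI[OF in_ctls(2)[OF x]])
       (use D k i L Suc.prems in \<open>auto simp: scan_delta_def Let_def vec_def\<close>)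
  with Suc show ?case by (meson converse_rtranclp_into_rtranclp Suc_leD)
qed

abbreviation point :: "com list \<Rightarrow> (nat \<Rightarrow> nat) \<Rightarrow> (nat \<Rightarrow> bool list) \<Rightarrow> config" where
  "point K s D \<equiv> dcfg k (Run K) (n + 1 - s 0) D 0"

text \<open>Primitives run deterministically, so one statement serves both modes: along forced steps
  safety is inherited backwards, and the end is reached forwards.\<close>

lemma prim_sim:
  assumes x: "Prim p # K \<in> all_conts prog" and K: "K \<in> all_conts prog"
    and wf: "wf_prim k p" and s: "rep k s D" "s 0 \<le> n + 1" "s 1 \<le> B" "p = GrowT \<Longrightarrow> s 1 < B"
  shows "case pexec w p s of
      Some t \<Rightarrow> t 0 \<le> n + 1 \<and> (\<exists>D'. rep k t D' \<and> dett\<^sup>*\<^sup>* (point (Prim p # K) s D)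
        (point K t D'))
    | None \<Rightarrow> ok \<phi> (point (Prim p # K) s D)"
proof (cases "on_head p")
  case True
  let ?a = "read_input w (n + 1 - s 0)"
  have ends: "?a = Left_End \<longleftrightarrow> s 0 = n + 1" "?a = Right_End \<longleftrightarrow> s 0 = 0"
    using s(2) by (auto simp: read_input_def split: if_splits)
  show ?thesis
  proof (cases "head_act p ?a")
    case None
    then have "pexec w p s = None"
      using True ends s(2) by (cases p) (auto simp: room_def split: if_splits)
    moreover have "ok \<phi> (point (Prim p # K) s D)"
      by (rule stuck_safe[OF in_ctls(1)[OF x]]) (use True None in auto)
    ultimately show ?thesis by simp
  next
    case (Some d)
    then obtain t where t: "pexec w p s = Some t" "t 0 \<le> n + 1" "\<And>r. r > 0 \<Longrightarrow> t r = s r"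
      "n + 1 - t 0 = min (n + 1) (move d (n + 1 - s 0))"
      using True ends s(2) by (cases p) (auto simp: room_def split: if_splits)
    have "dett (point (Prim p # K) s D) (point K t D)"
      by (rule det_dcfgI[OF in_ctls(1)[OF x]])
         (use True Some t(4) in \<open>auto simp: vec_def\<close>)
    moreover have "rep k t D" using s(1) t(3) by (auto simp: rep_def)
    ultimately show ?thesis using t by auto
  qed
next
  case False
  have go: "dett (point (Prim p # K) s D)
      (dcfg k (Scan (Prim p # K)) (n + 1 - s 0) D 1)"
    by (rule det_dcfgI[OF in_ctls(1)[OF x]]) (use False in \<open>auto simp: vec_def\<close>)
  show ?thesis
  proof (cases "p = GrowT")
    case True
    let ?t = "s(1 := Suc (s 1))"
    have L: "length (D j) = s 1" if "j < k" for j using that s(1) by (auto simp: rep_def)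
    have "dett\<^sup>*\<^sup>* (dcfg k (Scan (Prim p # K)) (n + 1 - s 0) D 1)
         (dcfg k (Ret K) (n + 1 - s 0) (\<lambda>j. D j @ [False]) (Suc (s 1)))"
      using scan_grow[of K "n + 1 - s 0" "s 1" D "s 1"] x s L True by auto
    moreover have "dett\<^sup>*\<^sup>* (dcfg k (Ret K) (n + 1 - s 0) (\<lambda>j. D j @ [False]) (Suc (s 1)))
        (point K s (\<lambda>j. D j @ [False]))"
      by (rule ret) (use K s in auto)
    moreover have "rep k ?t (\<lambda>j. D j @ [False])" using s(1) by (auto simp: rep_def)
    ultimately show ?thesis using True go s(2)
      by (auto intro!: exI[of _ "\<lambda>j. D j @ [False]"] intro: rtranclp_trans converse_rtranclp_into_rtranclp)
  next
    case ng: False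
    define j where "j = reg p - 2"
    have j: "j < k" "reg p = j + 2" using wf False ng by (cases p; force simp: j_def)+
    have Dj: "length (D j) = s 1" "bval (D j) = s (j + 2)" using s(1) j by (auto simp: rep_def)
    note sc = scan[OF x _ ng j_def j(1), where pre = "[]" and bs = "D j" and D = D
        and i = "n + 1 - s 0" and \<phi> = \<phi>]
    show ?thesis
    proof (cases "scanl p (D j)")
      case None
      have ok: "ok \<phi> (point (Prim p # K) s D)"
        using sc None go s(3) Dj by (auto intro: det_safe)
      have "pexec w p s = None"
        using None False ng j(2) Dj scanl_IncR[of "D j" "j+2"] scanl_DecR[of "D j" "j+2"]
        by (cases p) (auto simp: room_def scanl_ZeroR scanl_FullR split: if_splits)
      then show ?thesis using ok by simp
    next
      case (Some bs)
      let ?D = "D(j := bs)"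
      obtain h where h: "h \<le> B + 1" "dett\<^sup>*\<^sup>* (dcfg k (Scan (Prim p # K)) (n + 1 - s 0) D 1)
         (dcfg k (Ret K) (n + 1 - s 0) ?D h)"
        using sc Some s(3) Dj by auto
      have r: "dett\<^sup>*\<^sup>* (dcfg k (Ret K) (n + 1 - s 0) ?D h) (dcfg k (Run K) (n + 1 - s 0) ?D 0)"
        by (rule ret) (use K h in auto)
      have lenb: "length bs = s 1" using length_scanl[OF Some] Dj by simp
      have less: "bval bs < 2 ^ s 1" "s (j + 2) < 2 ^ s 1"
        using bval_less[of bs] bval_less[of "D j"] lenb Dj by auto
      have ex: "pexec w p s = Some (s(j + 2 := bval bs))"
        using Some False ng j(2) Dj scanl_IncR[of "D j" "j+2"] scanl_DecR[of "D j" "j+2"] less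
        by (cases p) (auto simp: room_def scanl_ZeroR scanl_FullR split: if_splits,
          metis diff_Suc_1')
      have "rep k (s(j + 2 := bval bs)) ?D"
        using s(1) lenb by (auto simp: rep_def)
      then show ?thesis using ex go h r s(2)
        by (auto intro!: exI[of _ "D(j := bs)"] intro: rtranclp_trans converse_rtranclp_into_rtranclp)
    qed
  qed
qed

lemma steps_cont:
  assumes "Run x \<in> ctls prog" "x \<noteq> []"
    and "\<And>a v. delta (Run x) a v = (\<lambda>y. (Run y, Stay, v, Stay)) ` Y" and "i \<le> n + 1"
  shows "step M w (dcfg k (Run x) i D 0) z \<longleftrightarrow> (\<exists>y\<in>Y. z = dcfg k (Run y) i D 0)"
proof -
  have "cfg k q i (\<lambda>j. (cells (D j))(0 := vec k (\<lambda>j. cells (D j)) 0 j)) 0 = dcfg k q i D 0" for q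
    by (rule cfg_cong) (rule upd_vec_same)
  then show ?thesis
    unfolding step_dcfg[OF assms(1)] assms(3) using assms(4) by (simp add: min_absorb2)
qed

lemma safe_cont:
  assumes "x \<in> all_conts prog" "x \<noteq> []"
    and "\<And>a v. delta (Run x) a v = (\<lambda>y. (Run y, Stay, v, Stay)) ` Y" and "i \<le> n + 1"
    and "\<And>y. y \<in> Y \<Longrightarrow> ok \<phi> (dcfg k (Run y) i D 0)"
  shows "ok \<phi> (dcfg k (Run x) i D 0)"
  apply (rule safe.intros)
  using assms(2) apply (auto simp: cfg_def)[2]
  using steps_cont[OF in_ctls(1)[OF assms(1)] assms(2-4)] assms(5) by auto

abbreviation good :: "(nat \<Rightarrow> nat) \<Rightarrow> (nat \<Rightarrow> bool list) \<Rightarrow> bool" where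
  "good s D \<equiv> rep k s D \<and> s 0 \<le> n + 1 \<and> s 1 \<le> B"

lemma prim_safe:
  assumes "Prim p # K \<in> all_conts prog" "K \<in> all_conts prog" "wf_prim k p" "good s D"
    "p = GrowT \<Longrightarrow> s 1 < B"
    and "\<And>t D'. pexec w p s = Some t \<Longrightarrow> good t D' \<Longrightarrow> ok \<phi> (point K t D')"
  shows "ok \<phi> (point (Prim p # K) s D)"
proof -
  have sim: "case pexec w p s of
      Some t \<Rightarrow> t 0 \<le> n + 1 \<and> (\<exists>D'. rep k t D' \<and> dett\<^sup>*\<^sup>* (point (Prim p # K) s D)
        (point K t D'))
    | None \<Rightarrow> ok \<phi> (point (Prim p # K) s D)"
    by (rule prim_sim) (use assms(1-5) in auto)
  show ?thesis
  proof (cases "pexec w p s")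
    case (Some t)
    have "t 1 \<le> B"
      using assms(3-5) Some by (cases p) (auto split: if_splits)
    with sim obtain D' where "good t D'" "dett\<^sup>*\<^sup>* (point (Prim p # K) s D)
        (point K t D')"
      unfolding Some option.case by blast
    then show ?thesis using assms(6)[OF Some] det_safe by blast
  qed (use sim in simp)
qed

lemma must_sim:
  "conts c K \<subseteq> all_conts prog \<Longrightarrow> K \<in> all_conts prog \<Longrightarrow> wf_com k c \<Longrightarrow> wp w B True c Q s \<Longrightarrow>
   (\<And>t D. Q t \<Longrightarrow> good t D \<Longrightarrow> ok \<phi> (point K t D)) \<Longrightarrow>
   good s D \<Longrightarrow> ok \<phi> (point (c # K) s D)"
proof (induction c arbitrary: K Q s D)
  case (Prim p)
  show ?case
  proof (rule prim_safe)
    fix t D' assume "pexec w p s = Some t" "good t D'"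
    then show "ok \<phi> (point K t D')"
      using Prim.prems(4) by (intro Prim.prems(5)) auto
  qed (use Prim.prems(1-4,6) in auto)
next
  case (Seq c d)
  have dK: "d # K \<in> all_conts prog" using Seq.prems(1) conts_self[of d K] by auto
  have 1: "ok \<phi> (point (c # d # K) s D)"
  proof (rule Seq.IH(1)[where Q = "wp w B True d Q"])
    fix t D assume "wp w B True d Q t" "good t D"
    then show "ok \<phi> (point (d # K) t D)"
      by (intro Seq.IH(2)[where Q = Q] Seq.prems(5)) (use Seq.prems(1-4) in auto)
  qed (use Seq.prems(1-4,6) dK in auto)
  show ?case
    by (rule safe_cont[where Y = "{c # d # K}"]) (use 1 Seq.prems(1,2) in auto)
next
  case (Choice c d)
  have 1: "ok \<phi> (point (c # K) s D)"
  proof (rule Choice.IH(1)[where Q = Q])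
    fix t D assume "Q t" "good t D"
    then show "ok \<phi> (point K t D)" by (rule Choice.prems(5))
  qed (use Choice.prems(1-4,6) in auto)
  have 2: "ok \<phi> (point (d # K) s D)"
  proof (rule Choice.IH(2)[where Q = Q])
    fix t D assume "Q t" "good t D"
    then show "ok \<phi> (point K t D)" by (rule Choice.prems(5))
  qed (use Choice.prems(1-4,6) in auto)
  show ?case
    by (rule safe_cont[where Y = "{c # K, d # K}"]) (use 1 2 Choice.prems(1,2) in auto)
next
  case (Loop r c)
  let ?K = "Loop r c # K"
  have mem: "?K \<in> all_conts prog" "Prim (DecR r) # c # ?K \<in> all_conts prog"
    "Prim (ZeroR r) # K \<in> all_conts prog" "conts c ?K \<subseteq> all_conts prog" "c # ?K \<in> all_conts prog"
    using Loop.prems(1) conts_self[of c ?K] by auto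
  \<comment> \<open>A loop returns to its own command list, so structural induction alone does not
    end. The value of the register decreases with each round, because \<open>wp\<close> demands that
    the body hands it back unchanged.\<close>
  have "ok \<phi> (point ?K s D)"
    if "loop_wp r (wp w B True c) Q i s" "good s D" "s r = i" for i s D
    using that
  proof (induction i arbitrary: s D)
    case 0
    have 1: "ok \<phi> (point (Prim (ZeroR r) # K) s D)"
    proof (rule prim_safe)
      fix t D' assume "pexec w (ZeroR r) s = Some t" "good t D'"
      then show "ok \<phi> (point K t D')"
        using 0(1,3) by (intro Loop.prems(5)) auto
    qed (use mem 0 Loop.prems(2,3) in auto)
    \<comment> \<open>The wrong guess about the register gets stuck at once.\<close>
    have 2: "ok \<phi> (point (Prim (DecR r) # c # ?K) s D)"
      by (rule prim_safe) (use mem 0 Loop.prems(2,3) in auto)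
    show ?case
      by (rule safe_cont[where Y = "{Prim (DecR r) # c # ?K, Prim (ZeroR r) # K}"])
         (use mem 1 2 in auto)
  next
    case (Suc i)
    have 1: "ok \<phi> (point (Prim (ZeroR r) # K) s D)"
      by (rule prim_safe) (use mem Suc.prems(2,3) Loop.prems(2,3) in auto)
    have 2: "ok \<phi> (point (Prim (DecR r) # c # ?K) s D)"
    proof (rule prim_safe)
      fix t D' assume t: "pexec w (DecR r) s = Some t" "good t D'"
      then have "wp w B True c (\<lambda>t. t r = i \<and> loop_wp r (wp w B True c) Q i t) t"
        using Suc.prems(1,3) by auto
      then show "ok \<phi> (point (c # ?K) t D')"
      proof (rule Loop.IH[OF mem(4,1), rotated])
        fix t D assume "t r = i \<and> loop_wp r (wp w B True c) Q i t" "good t D"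
        then show "ok \<phi> (point ?K t D)" using Suc.IH by blast
      qed (use t(2) Loop.prems(3) in auto)
    qed (use mem Suc.prems(2,3) Loop.prems(2,3) in auto)
    show ?case
      by (rule safe_cont[where Y = "{Prim (DecR r) # c # ?K, Prim (ZeroR r) # K}"])
         (use mem 1 2 in auto)
  qed
  then show ?case using Loop.prems(4,6) by auto
qed

lemma prim_reach:
  assumes "Prim p # K \<in> all_conts prog" "K \<in> all_conts prog" "wf_prim k p" "good s D"
    "p = GrowT \<Longrightarrow> s 1 < B" "pexec w p s = Some t"
  shows "\<exists>D'. good t D' \<and>
     steps (point (Prim p # K) s D) (point K t D')"
proof -
  have "t 1 \<le> B"
    using assms(3-6) by (cases p) (auto split: if_splits)
  moreover have "case pexec w p s of
      Some t \<Rightarrow> t 0 \<le> n + 1 \<and> (\<exists>D'. rep k t D' \<and> dett\<^sup>*\<^sup>* (point (Prim p # K) s D)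
        (point K t D'))
    | None \<Rightarrow> ok False (point (Prim p # K) s D)"
    by (rule prim_sim) (use assms in auto)
  ultimately obtain D' where "good t D'" "dett\<^sup>*\<^sup>* (point (Prim p # K) s D)
        (point K t D')"
    unfolding assms(6) option.case by blast
  then show ?thesis
    using det_steps by blast
qed

lemma may_sim:
  "conts c K \<subseteq> all_conts prog \<Longrightarrow> K \<in> all_conts prog \<Longrightarrow> wf_com k c \<Longrightarrow> wp w B False c Q s \<Longrightarrow>
   good s D \<Longrightarrow> \<exists>t D'. Q t \<and> good t D' \<and>
     steps (point (c # K) s D) (point K t D')"
proof (induction c arbitrary: K Q s D)
  case (Prim p)
  then show ?case
    using prim_reach[of p K s D] by (auto split: option.splits)
next
  case (Seq c d)
  have dK: "d # K \<in> all_conts prog" using Seq.prems(1) conts_self[of d K] by auto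
  have "step M w (point ((c ;; d) # K) s D)
      (point (c # d # K) s D)"
    by (subst steps_cont[where Y = "{c # d # K}"]) (use Seq.prems(1) in \<open>auto intro: in_ctls\<close>)
  moreover obtain t D' where t: "wp w B False d Q t" "good t D'"
     "steps (point (c # d # K) s D) (point (d # K) t D')"
    using Seq.IH(1)[of "d # K" "wp w B False d Q" s D] Seq.prems dK by auto
  moreover obtain t' D'' where "Q t'" "good t' D''"
     "steps (point (d # K) t D') (dcfg k (Run K) (n + 1 - t' 0) D'' 0)"
    using Seq.IH(2)[of K Q t D'] Seq.prems t by auto
  ultimately show ?case
    by (meson converse_rtranclp_into_rtranclp rtranclp_trans)
next
  case (Choice c d)
  have st: "step M w (point ((c [+] d) # K) s D) (point (e # K) s D)"
    if "e \<in> {c, d}" for e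
    by (subst steps_cont[where Y = "{c # K, d # K}"])
       (use Choice.prems(1) that in \<open>auto intro: in_ctls\<close>)
  consider "wp w B False c Q s" | "wp w B False d Q s" using Choice.prems(4) by auto
  then show ?case
  proof cases
    case 1
    then have "\<exists>t D'. Q t \<and> good t D' \<and>
      steps (point (c # K) s D) (point K t D')"
      by (intro Choice.IH(1)) (use Choice.prems in auto)
    then show ?thesis using converse_rtranclp_into_rtranclp[of "step M w", OF st[of c]] by blast
  next
    case 2
    then have "\<exists>t D'. Q t \<and> good t D' \<and>
      steps (point (d # K) s D) (point K t D')"
      by (intro Choice.IH(2)) (use Choice.prems in auto)
    then show ?thesis using converse_rtranclp_into_rtranclp[of "step M w", OF st[of d]] by blast
  qed
next
  case (Loop r c)
  let ?K = "Loop r c # K"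
  have mem: "?K \<in> all_conts prog" "Prim (DecR r) # c # ?K \<in> all_conts prog"
    "Prim (ZeroR r) # K \<in> all_conts prog" "conts c ?K \<subseteq> all_conts prog" "c # ?K \<in> all_conts prog"
    using Loop.prems(1) conts_self[of c ?K] by auto
  have st: "step M w (point ?K s D) (point x s D)"
    if "x \<in> {Prim (DecR r) # c # ?K, Prim (ZeroR r) # K}" for x s D
    by (subst steps_cont[where Y = "{Prim (DecR r) # c # ?K, Prim (ZeroR r) # K}"])
       (use mem that in \<open>auto intro: in_ctls\<close>)
  have "\<exists>t D'. Q t \<and> good t D' \<and>
      steps (point ?K s D) (point K t D')"
    if "loop_wp r (wp w B False c) Q i s" "good s D" "s r = i" for i s D
    using that
  proof (induction i arbitrary: s D)
    case 0
    have "\<exists>D'. good s D' \<and> steps (point (Prim (ZeroR r) # K) s D)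
        (point K s D')"
      by (rule prim_reach) (use mem 0 Loop.prems(1-3) in auto)
    moreover have "Q s" using 0(1) by simp
    ultimately show ?case using st[of "Prim (ZeroR r) # K" s D]
      by (meson converse_rtranclp_into_rtranclp insertI1 insertI2)
  next
    case (Suc i)
    define t where "t = s(r := i)"
    have t: "pexec w (DecR r) s = Some t" using Suc.prems(3) by (simp add: t_def)
    have wp: "wp w B False c (\<lambda>u. u r = i \<and> loop_wp r (wp w B False c) Q i u) t"
      using Suc.prems(1) by (simp add: t_def)
    obtain D' where D': "good t D'" "steps (point (Prim (DecR r) # c # ?K) s D)
        (point (c # ?K) t D')"
      using prim_reach[OF mem(2,5) _ Suc.prems(2) _ t] Loop.prems(3) by auto
    have "\<exists>u E. (u r = i \<and> loop_wp r (wp w B False c) Q i u) \<and> good u E \<and>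
        steps (point (c # ?K) t D') (point ?K u E)"
      by (rule Loop.IH[of ?K "\<lambda>u. u r = i \<and> loop_wp r (wp w B False c) Q i u" t D']) (use mem wp Loop.prems(1-3) D' in auto)
    then obtain u E where u: "u r = i" "loop_wp r (wp w B False c) Q i u" "good u E"
        "steps (point (c # ?K) t D') (point ?K u E)"
      by blast
    obtain v F where "Q v" "good v F"
      "steps (point ?K u E) (point K v F)"
      using Suc.IH[OF u(2,3,1)] by blast
    moreover have "step M w (point ?K s D)
        (point (Prim (DecR r) # c # ?K) s D)"
      by (rule st) simp
    ultimately show ?case using u(4) D'(2)
      by (meson converse_rtranclp_into_rtranclp rtranclp_trans)
  qed
  then show ?case using Loop.prems(4,5) by auto
qed

text \<open>The head starts on the left end marker, at distance \<open>n + 1\<close> from the right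
  one, and the tapes have no cells yet, so that all other registers are 0.\<close>

definition init :: "nat \<Rightarrow> nat" where
  "init = (\<lambda>_. 0)(0 := n + 1)"

lemma start: "dett (initial_config M) (point [prog] init (\<lambda>_. []))"
proof -
  have i: "initial_config M = cfg k (Start prog) 0 (\<lambda>_ _. 0) 0"
    by (simp add: initial_config_def cfg_def map_replicate_const)
  have c: "cfg k (Run [prog]) 0 (\<lambda>j. (\<lambda>_. 0)(0 := 3)) 0 = point [prog] init (\<lambda>_. [])"
    by (auto simp: init_def cfg_def cells_def)
  show ?thesis
    unfolding i c[symmetric] det_def
    by (subst step_mach) (auto simp: ctls_def, auto simp: cfg_def)
qed

lemma good_init: "good init (\<lambda>_. [])"
  by (auto simp: rep_def init_def)

theorem must_safe:
  assumes "wf_com k prog" "wp w B True prog (\<lambda>_. \<phi>) init"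
  shows "ok \<phi> (initial_config M)"
proof -
  have "ok \<phi> (point [prog] init (\<lambda>_. []))"
  proof (rule must_sim[OF _ _ assms _ good_init])
    fix t D assume "\<phi>"
    have no: "\<not> step M w (point [] t D) z" for z
      by (simp add: step_dcfg[OF in_ctls(1)] all_conts_def)
    show "ok \<phi> (point [] t D)"
      by (rule safe.intros) (use no \<open>\<phi>\<close> in \<open>auto simp: cfg_def\<close>)
  qed (auto simp: all_conts_def)
  then show ?thesis using start det_safe[OF r_into_rtranclp] by blast
qed

theorem may_accepts:
  assumes "wf_com k prog" "wp w B False prog (\<lambda>_. True) init"
  shows "accepts M w"
proof -
  obtain t D where "steps (point [prog] init (\<lambda>_. [])) (point [] t D)"
    using may_sim[OF _ _ assms good_init, of "[]"] unfolding all_conts_def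
    by (metis insertI1 subset_insertI)
  moreover have "step M w (initial_config M) (point [prog] init (\<lambda>_. []))"
    using start unfolding det_def by blast
  ultimately have "reachable M w (point [] t D)"
    unfolding reachable_def by (rule converse_rtranclp_into_rtranclp[rotated])
  moreover have "fst (point [] t D) = accept_state M"
    by (simp add: cfg_def)
  ultimately show ?thesis
    unfolding accepts_def by blast
qed

end

text \<open>The two cells beyond \<open>B\<close> are the one with the end marker and the blank on
  which a sweep over a full-length counter turns.\<close>

theorem NSPACE_program:
  assumes "0 < k" "wf_com k prog" "(\<lambda>n. real (B n + 2)) \<in> O(f)"
    and "\<And>w. wp w (B (length w)) True prog (\<lambda>_. w \<in> X) ((\<lambda>_. 0)(0 := length w + 1))"
    and "\<And>w. w \<in> X \<Longrightarrow> wp w (B (length w)) False prog (\<lambda>_. True) ((\<lambda>_. 0)(0 := length w + 1))"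
  shows "X \<in> NSPACE f"
proof -
  have "halts (mach k prog) w \<and> uses_space (mach k prog) w (B (length w) + 2) \<and>
      (accepts (mach k prog) w \<longleftrightarrow> w \<in> X)" for w
  proof -
    interpret counter_program k prog w "B (length w)"
      by unfold_locales (rule assms(1))
    have "ok (w \<in> X) (initial_config M)"
      by (rule must_safe[OF assms(2)]) (unfold init_def, rule assms(4))
    moreover have "accepts M w" if "w \<in> X"
      by (rule may_accepts[OF assms(2)]) (unfold init_def, rule assms(5)[OF that])
    ultimately show ?thesis using safe_initial by blast
  qed
  then show ?thesis
    unfolding NSPACE_def
    using wf_mach[of k prog] assms(3)
    by (intro CollectI exI[of _ "mach k prog"] exI[of _ "\<lambda>n. B n + 2"]) auto
qed

section \<open>Rooted trees and embeddings\<close>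

lemma walk_nth: "walk G p \<longleftrightarrow> p \<noteq> [] \<and> set p \<subseteq> nodes G \<and>
    (\<forall>i. Suc i < length p \<longrightarrow> {p ! i, p ! Suc i} \<in> edges G)"
  by (simp add: walk_def successively_conv_nth)

definition spanning :: "'a ugraph \<Rightarrow> 'a \<Rightarrow> ('a \<Rightarrow> 'a) \<Rightarrow> ('a \<Rightarrow> nat) \<Rightarrow> bool" where
  "spanning T r par dep \<longleftrightarrow> r \<in> nodes T \<and> dep r = 0 \<and>
     (\<forall>v \<in> nodes T - {r}. par v \<in> nodes T \<and> {v, par v} \<in> edges T \<and> dep v = Suc (dep (par v)))"

definition rooted :: "'a ugraph \<Rightarrow> 'a \<Rightarrow> ('a \<Rightarrow> 'a) \<Rightarrow> ('a \<Rightarrow> nat) \<Rightarrow> bool" where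
  "rooted T r par dep \<longleftrightarrow> simple_graph T \<and> spanning T r par dep \<and>
     edges T = (\<lambda>v. {v, par v}) ` (nodes T - {r})"

text \<open>Let \<open>dep\<close> be the distance to \<open>r\<close>; the parent of a node is the
  second node on a shortest walk from it to \<open>r\<close>.\<close>

lemma spanning_exists:
  assumes "connected_graph T" "r \<in> nodes T"
  shows "\<exists>par dep. spanning T r par dep"
proof -
  define W where "W v l \<longleftrightarrow> (\<exists>p. walk T p \<and> hd p = v \<and> last p = r \<and> length p = Suc l)" for v l
  define dep where "dep v = (LEAST l. W v l)" for v
  have W: "\<exists>l. W v l" if v: "v \<in> nodes T" for v
  proof -
    obtain p where "walk T p" "hd p = v" "last p = r"
      using assms v unfolding connected_graph_def by blast
    moreover from this have "length p = Suc (length p - 1)" by (cases p) (auto simp: walk_def)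
    ultimately show ?thesis unfolding W_def by blast
  qed
  have Wdep: "W v (dep v)" if "v \<in> nodes T" for v
    using W[OF that] unfolding dep_def by (rule LeastI_ex)
  have Wle: "dep v \<le> l" if "W v l" for v l
    using that unfolding dep_def by (rule Least_le)
  have step: "\<exists>u. u \<in> nodes T \<and> {v, u} \<in> edges T \<and> dep v = Suc (dep u)"
    if v: "v \<in> nodes T" "v \<noteq> r" for v
  proof -
    have "\<exists>p. walk T p \<and> hd p = v \<and> last p = r \<and> length p = Suc (dep v)"
      using Wdep[OF v(1)] by (simp only: W_def)
    then obtain p where p: "walk T p" "hd p = v" "last p = r" "length p = Suc (dep v)"
      by blast
    obtain p' where p': "p = v # p'" using p(2,4) by (cases p) auto
    obtain u q where "p' = u # q" using p(3) p' v(2) by (cases p') auto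
    with p' have q: "p = v # u # q" by simp
    have "walk T (u # q)" and e: "{v, u} \<in> edges T" and "u \<in> nodes T"
      using p(1) unfolding q by (simp_all add: walk_def)
    then have "W u (dep v - 1)"
      using p(3,4) unfolding W_def q by (intro exI[of _ "u # q"]) simp
    then have "dep u \<le> dep v - 1" by (rule Wle)
    moreover have "dep v \<le> Suc (dep u)"
    proof -
      have "\<exists>p. walk T p \<and> hd p = u \<and> last p = r \<and> length p = Suc (dep u)"
        using Wdep[OF \<open>u \<in> nodes T\<close>] by (simp only: W_def)
      then obtain q' where q': "walk T q'" "hd q' = u" "last q' = r" "length q' = Suc (dep u)"
        by blast
      then have "walk T (v # q')"
        using v(1) \<open>{v, u} \<in> edges T\<close> by (cases q') (auto simp: walk_def)
      then have "W v (Suc (dep u))"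
        using q' unfolding W_def by (intro exI[of _ "v # q'"]) (auto simp: walk_def)
      then show ?thesis by (rule Wle)
    qed
    moreover have "dep v > 0" using p(4) q by simp
    ultimately have "dep v = Suc (dep u)" by linarith
    with e \<open>u \<in> nodes T\<close> show ?thesis by (intro exI[of _ u] conjI)
  qed
  have "\<forall>v \<in> nodes T - {r}. \<exists>u. u \<in> nodes T \<and> {v, u} \<in> edges T \<and> dep v = Suc (dep u)"
    by (rule ballI, rule step) simp_all
  from bchoice[OF this] obtain par where "\<forall>v \<in> nodes T - {r}.
      par v \<in> nodes T \<and> {v, par v} \<in> edges T \<and> dep v = Suc (dep (par v))" ..
  moreover have "W r 0"
    unfolding W_def by (rule exI[of _ "[r]"]) (simp add: walk_def assms(2))
  then have "dep r = 0" using Wle by blast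
  ultimately have "spanning T r par dep"
    using assms(2) by (simp add: spanning_def)
  then show ?thesis by blast
qed

text \<open>The first return of a walk that never turns back is a cycle.\<close>

lemma nonbacktracking_cycle:
  assumes G: "simple_graph G" "walk G p" "\<not> distinct p"
    and nb: "\<And>i. Suc (Suc i) < length p \<Longrightarrow> p ! i \<noteq> p ! Suc (Suc i)"
  shows "\<exists>c. is_cycle G c"
proof -
  define R where "R l \<longleftrightarrow> (\<exists>i. l > 0 \<and> i + l < length p \<and> p ! i = p ! (i + l))" for l
  have "\<exists>l. R l"
  proof -
    obtain i j where "i < length p" "j < length p" "i \<noteq> j" "p ! i = p ! j"
      using G(3) by (auto simp: distinct_conv_nth)
    then obtain i j where "i < j" "j < length p" "p ! i = p ! j" by (metis nat_neq_iff)
    then show ?thesis unfolding R_def by (intro exI[of _ "j - i"] exI[of _ i]) auto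
  qed
  then obtain l where l: "R l" "\<And>m. m < l \<Longrightarrow> \<not> R m"
    using exists_least_iff[of R] by blast
  obtain i where i: "l > 0" "i + l < length p" "p ! i = p ! (i + l)" using l(1) unfolding R_def by blast
  have e: "{p ! j, p ! Suc j} \<in> edges G" if "Suc j < length p" for j
    using G(2) that by (simp add: walk_nth)
  have "l \<noteq> 1"
  proof
    assume "l = 1"
    then have "{p ! Suc i} \<in> edges G" using e[of i] i by simp
    then show False using G(1) unfolding simple_graph_def by fastforce
  qed
  moreover have "l \<noteq> 2" using nb i by auto
  ultimately have l3: "l \<ge> 3" using i(1) by linarith
  define c where "c = take l (drop i p)"
  have len: "length c = l" using i by (simp add: c_def)
  have nth: "c ! j = p ! (i + j)" if "j < l" for j
    using that i by (simp add: c_def)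
  have "distinct c"
  proof (rule ccontr)
    assume "\<not> distinct c"
    then obtain a b where "a < l" "b < l" "a \<noteq> b" "c ! a = c ! b"
      using len by (auto simp: distinct_conv_nth)
    then obtain a b where "a < b" "b < l" "c ! a = c ! b" by (metis nat_neq_iff)
    then have "R (b - a)" unfolding R_def using i nth by (intro exI[of _ "i + a"]) auto
    then show False using l(2)[of "b - a"] \<open>a < b\<close> \<open>b < l\<close> by auto
  qed
  moreover have "walk G c"
    unfolding walk_nth
  proof (intro conjI allI impI)
    show "c \<noteq> []" using len i by auto
    show "set c \<subseteq> nodes G"
      using G(2) unfolding c_def walk_def by (meson order_trans set_drop_subset set_take_subset)
    show "{c ! j, c ! Suc j} \<in> edges G" if "Suc j < length c" for j
      using that len nth e[of "i + j"] i by auto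
  qed
  moreover have "{last c, hd c} \<in> edges G"
  proof -
    have "c \<noteq> []" using len l3 by auto
    then have "last c = p ! (i + l - 1)" "hd c = p ! (i + l)"
      using len l3 nth[of "l - 1"] nth[of 0] i(3) by (simp_all add: last_conv_nth hd_conv_nth)
    then show ?thesis using e[of "i + l - 1"] i by auto
  qed
  ultimately show ?thesis using len l3 unfolding is_cycle_def by blast
qed

section \<open>Parent pointers and acyclicity\<close>

locale spanned =
  fixes T :: "'a ugraph" and r :: 'a and par :: "'a \<Rightarrow> 'a" and dep :: "'a \<Rightarrow> nat"
  assumes sp: "spanning T r par dep"
begin

lemma root: "r \<in> nodes T" "dep r = 0"
  using sp by (auto simp: spanning_def)

lemma par: "v \<in> nodes T \<Longrightarrow> v \<noteq> r \<Longrightarrow> par v \<in> nodes T"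
  "v \<in> nodes T \<Longrightarrow> v \<noteq> r \<Longrightarrow> {v, par v} \<in> edges T"
  "v \<in> nodes T \<Longrightarrow> v \<noteq> r \<Longrightarrow> dep v = Suc (dep (par v))"
  using sp by (auto simp: spanning_def)

lemma dep_0: "v \<in> nodes T \<Longrightarrow> dep v = 0 \<longleftrightarrow> v = r"
  using par(3) root(2) by fastforce

lemma par_pow: "v \<in> nodes T \<Longrightarrow> i \<le> dep v \<Longrightarrow> (par ^^ i) v \<in> nodes T \<and> dep ((par ^^ i) v) = dep v - i"
proof (induction i)
  case (Suc i)
  then have IH: "(par ^^ i) v \<in> nodes T" "dep ((par ^^ i) v) = dep v - i" by auto
  then have "(par ^^ i) v \<noteq> r" using Suc.prems root(2) by auto
  then show ?case using par[OF IH(1)] IH(2) by auto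
qed auto

lemma par_pow_edge:
  assumes "v \<in> nodes T" "i < dep v"
  shows "{(par ^^ i) v, (par ^^ Suc i) v} \<in> edges T" "(par ^^ i) v \<noteq> r"
proof -
  have 1: "(par ^^ i) v \<in> nodes T" "dep ((par ^^ i) v) = dep v - i"
    using par_pow[of v i] assms by auto
  then show "(par ^^ i) v \<noteq> r" using assms root(2) by auto
  then show "{(par ^^ i) v, (par ^^ Suc i) v} \<in> edges T" using par(2)[OF 1(1)] by simp
qed

lemma par_edges_subset: "(\<lambda>v. {v, par v}) ` (nodes T - {r}) \<subseteq> edges T"
  using par(2) by auto

lemma inj_par_edges: "inj_on (\<lambda>v. {v, par v}) (nodes T - {r})"
proof (rule inj_onI)
  fix u v assume "u \<in> nodes T - {r}" "v \<in> nodes T - {r}" "{u, par u} = {v, par v}"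
  then show "u = v" using par(3)[of u] par(3)[of v] by (auto simp: doubleton_eq_iff)
qed

text \<open>Suppose an edge joins \<open>u\<close> and \<open>v\<close> and neither is the parent of
  the other. The walk from \<open>r\<close> down to \<open>u\<close>, over the edge to
  \<open>v\<close> and back up to \<open>r\<close> returns to its start. Depth is strictly monotone
  on both halves, so it could turn back only at that edge, and there only if the edge were a parent
  edge.\<close>

lemma acyclic_edges:
  assumes "simple_graph T" "\<nexists>p. is_cycle T p"
  shows "edges T \<subseteq> (\<lambda>v. {v, par v}) ` (nodes T - {r})"
proof
  fix e assume e: "e \<in> edges T"
  then have ce: "card e = 2" "e \<subseteq> nodes T" using assms(1) unfolding simple_graph_def by blast+
  obtain u v where uv': "e = {u, v}" "u \<noteq> v" using ce(1) card_2_iff[of e] by blast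
  then have uv: "e = {u, v}" "u \<noteq> v" "u \<in> nodes T" "v \<in> nodes T" using ce(2) by blast+
  show "e \<in> (\<lambda>v. {v, par v}) ` (nodes T - {r})"
  proof (rule ccontr)
    assume no: "\<not> ?thesis"
    have nu: "par u \<noteq> v" if "u \<noteq> r" using no uv(1,3) that by blast
    have nv: "par v \<noteq> u" if "v \<noteq> r"
    proof
      assume "par v = u"
      then have "e = {v, par v}" using uv(1) by (simp add: insert_commute)
      then show False using no uv(4) that by blast
    qed
    \<comment> \<open>Indices up to \<open>dep u\<close> list the tree path from \<open>r\<close> to
      \<open>u\<close>, later ones the path from \<open>v\<close> to \<open>r\<close>.\<close>
    define f where "f i = (if i \<le> dep u then (par ^^ (dep u - i)) u else (par ^^ (i - Suc (dep u))) v)" for i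
    define p where "p = map f [0..<dep u + dep v + 2]"
    have len: "length p = dep u + dep v + 2" and nth: "\<And>i. i < dep u + dep v + 2 \<Longrightarrow> p ! i = f i"
      by (auto simp: p_def simp del: upt_Suc)
    have fn: "f i \<in> nodes T" if "i < dep u + dep v + 2" for i
      using par_pow[OF uv(3), of "dep u - i"] par_pow[OF uv(4), of "i - Suc (dep u)"] that
      by (auto simp: f_def)
    have ends: "f 0 = r" "f (dep u + dep v + 1) = r"
      using par_pow[OF uv(3), of "dep u"] par_pow[OF uv(4), of "dep v"] dep_0
      by (auto simp: f_def)
    have fe: "{f i, f (Suc i)} \<in> edges T" if "Suc i < dep u + dep v + 2" for i
    proof -
      consider "i < dep u" | "i = dep u" | "i > dep u" by linarith
      then show ?thesis
      proof cases
        case 1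
        then have "{(par ^^ (dep u - Suc i)) u, (par ^^ Suc (dep u - Suc i)) u} \<in> edges T"
          by (intro par_pow_edge uv) auto
        moreover have "Suc (dep u - Suc i) = dep u - i" using 1 by simp
        ultimately show ?thesis using 1 by (simp add: f_def insert_commute)
      next
        case 2
        then show ?thesis using e uv(1) by (simp add: f_def)
      next
        case 3
        then have "{(par ^^ (i - Suc (dep u))) v, (par ^^ Suc (i - Suc (dep u))) v} \<in> edges T"
          using that by (intro par_pow_edge uv) auto
        moreover have "Suc (i - Suc (dep u)) = i - dep u" using 3 by simp
        ultimately show ?thesis using 3 by (simp add: f_def)
      qed
    qed
    have fdep: "dep (f i) = (if i \<le> dep u then i else dep v - (i - Suc (dep u)))"
      if "i < dep u + dep v + 2" for i
      using par_pow[OF uv(3), of "dep u - i"] par_pow[OF uv(4), of "i - Suc (dep u)"] that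
      by (auto simp: f_def)
    have nb: "f i \<noteq> f (Suc (Suc i))" if "Suc (Suc i) < dep u + dep v + 2" for i
    proof -
      consider "Suc (Suc i) \<le> dep u" | "Suc i = dep u" | "i = dep u" | "i > dep u" by linarith
      then show ?thesis
      proof cases
        case 2
        then have "dep u - i = Suc 0" by arith
        then have "f i = par u" "f (Suc (Suc i)) = v" "dep u \<noteq> 0" using 2 by (auto simp: f_def)
        then show ?thesis using nu dep_0[OF uv(3)] by auto
      next
        case 3
        then have "f i = u" "f (Suc (Suc i)) = par v" "dep v \<noteq> 0" using that by (auto simp: f_def)
        then show ?thesis using nv dep_0[OF uv(4)] by auto
      qed (use fdep[of i] fdep[of "Suc (Suc i)"] that in auto)
    qed
    have "walk T p"
      unfolding walk_nth using len nth fn fe by (auto simp: in_set_conv_nth)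
    moreover have "\<not> distinct p"
    proof
      assume "distinct p"
      then have "p ! 0 \<noteq> p ! (dep u + dep v + 1)" using len by (simp add: nth_eq_iff_index_eq)
      then show False using nth ends by simp
    qed
    ultimately show False
      using nonbacktracking_cycle[OF assms(1), of p] assms(2) nb len nth by simp
  qed
qed

text \<open>On a cycle, both neighbours of a deepest node would have to be its parent, so they
  coincide, which is impossible at length 3 or more.\<close>

lemma parent_edges_acyclic:
  assumes "edges T \<subseteq> (\<lambda>v. {v, par v}) ` (nodes T - {r})"
  shows "\<not> is_cycle T p"
proof
  assume c: "is_cycle T p"
  then have len: "length p \<ge> 3" and d: "distinct p" and ne: "p \<noteq> []"
    and e: "\<And>i. Suc i < length p \<Longrightarrow> {p ! i, p ! Suc i} \<in> edges T"
    by (auto simp: is_cycle_def walk_nth)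
  have e0: "{p ! (length p - 1), p ! 0} \<in> edges T"
    using c ne by (simp add: is_cycle_def last_conv_nth hd_conv_nth)
  have up: "y = par x" if xy: "{x, y} \<in> edges T" "dep y \<le> dep x" for x y
  proof -
    obtain v where "v \<in> nodes T - {r}" "{x, y} = {v, par v}" using xy(1) assms by blast
    then show ?thesis using par(3)[of v] xy(2) by (auto simp: doubleton_eq_iff)
  qed
  have "Max (dep ` set p) \<in> dep ` set p" using ne by (intro Max_in) auto
  then obtain x where "x \<in> set p" "dep x = Max (dep ` set p)" by auto
  then have x: "x \<in> set p" "\<And>y. y \<in> set p \<Longrightarrow> dep y \<le> dep x" by auto
  then obtain i where i: "i < length p" "x = p ! i" by (auto simp: in_set_conv_nth)
  let ?n = "if Suc i = length p then 0 else Suc i" and ?m = "if i = 0 then length p - 1 else i - 1"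
  have "{p ! i, p ! ?n} \<in> edges T"
    using e[of i] e0 i by (metis (full_types) Suc_lessI diff_Suc_1)
  moreover have "{p ! i, p ! ?m} \<in> edges T"
    using e[of "i - 1"] e0 i by (auto simp: insert_commute)
  moreover have "p ! ?n \<in> set p" "p ! ?m \<in> set p" using i(1) ne by (auto intro!: nth_mem)
  ultimately have "p ! ?n = p ! ?m"
    using up[of "p ! i" "p ! ?n"] up[of "p ! i" "p ! ?m"] x(2) i(2) by metis
  then have "?n = ?m" using d i len by (subst (asm) nth_eq_iff_index_eq) auto
  then show False using len i by (auto split: if_splits)
qed

end

text \<open>The parent edges number one less than the nodes and are all edges of \<open>T\<close>,
  so the count decides whether there are others; by \<open>acyclic_edges\<close> and
  \<open>parent_edges_acyclic\<close> that is the same as having a cycle. It turns a statement about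
  all walks into one that can be checked by counting.\<close>

lemma acyclic_iff_card_edges:
  assumes "simple_graph T" "connected_graph T" "nodes T \<noteq> {}"
  shows "(\<nexists>p. is_cycle T p) \<longleftrightarrow> Suc (card (edges T)) = card (nodes T)"
proof -
  obtain r where r: "r \<in> nodes T" using assms(3) by blast
  obtain par dep where "spanning T r par dep" using spanning_exists[OF assms(2) r] by blast
  then interpret spanned T r par dep by unfold_locales
  let ?E = "(\<lambda>v. {v, par v}) ` (nodes T - {r})"
  have fin: "finite (nodes T)" "finite (edges T)"
    using assms(1) finite_subset[of "edges T" "Pow (nodes T)"] by (auto simp: simple_graph_def)
  have 1: "card (nodes T) = Suc (card ?E)"
    using card_Suc_Diff1[OF fin(1) r] by (simp only: card_image[OF inj_par_edges])
  have 2: "card (edges T) = card ?E \<longleftrightarrow> edges T \<subseteq> ?E"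
    using card_subset_eq[OF fin(2) par_edges_subset] subset_antisym[OF par_edges_subset] by auto
  have "(\<nexists>p. is_cycle T p) \<longleftrightarrow> edges T \<subseteq> ?E"
    using acyclic_edges[OF assms(1)] parent_edges_acyclic by blast
  then show ?thesis
    unfolding 1 nat.inject 2 .
qed

lemma tree_rooted:
  assumes "is_tree T" "r \<in> nodes T"
  shows "\<exists>par dep. rooted T r par dep"
proof -
  obtain par dep where "spanning T r par dep"
    using spanning_exists assms unfolding is_tree_def by metis
  then interpret spanned T r par dep by unfold_locales
  have "rooted T r par dep"
    using acyclic_edges par_edges_subset sp assms(1) unfolding rooted_def is_tree_def by blast
  then show ?thesis by blast
qed

section \<open>Children, descendants and local embeddings\<close>

definition ch :: "'a ugraph \<Rightarrow> 'a \<Rightarrow> 'a \<Rightarrow> 'a set" where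
  "ch T v p = {c. {v, c} \<in> edges T \<and> c \<noteq> p}"

locale rooted_tree = fixes T :: "'a ugraph" and r par dep
  assumes rooted: "rooted T r par dep"

sublocale rooted_tree \<subseteq> spanned
  using rooted by unfold_locales (simp add: rooted_def)

context rooted_tree
begin

lemma finite_nodes: "finite (nodes T)"
  using rooted by (simp add: rooted_def simple_graph_def)

text \<open>The root is its own parent: as there are no loops, \<open>ch T r r\<close> is the set of
  all neighbours of the root, so the task of the root needs no special form.\<close>

definition pa :: "'a \<Rightarrow> 'a" where "pa v = (if v = r then r else par v)"

definition children :: "'a \<Rightarrow> 'a set" where "children v = {c \<in> nodes T - {r}. par c = v}"

lemma edges_eq: "edges T = (\<lambda>v. {v, par v}) ` (nodes T - {r})"
  using rooted by (simp add: rooted_def)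

lemma ch_pa:
  assumes "v \<in> nodes T"
  shows "ch T v (pa v) = children v"
proof -
  have "c \<in> children v" if "{v, c} \<in> edges T" "c \<noteq> pa v" for c
    using that unfolding edges_eq by (auto simp: pa_def children_def doubleton_eq_iff)
  moreover have "{v, c} \<in> edges T \<and> c \<noteq> pa v" if "c \<in> children v" for c
    using that par(2,3)[of c] par(3)[OF assms] by (auto simp: pa_def children_def insert_commute)
  ultimately show ?thesis unfolding ch_def by blast
qed

lemma children_nodes: "c \<in> children v \<Longrightarrow> c \<in> nodes T" "c \<in> children v \<Longrightarrow> pa c = v"
   "c \<in> children v \<Longrightarrow> dep c = Suc (dep v)"
  using par(3) by (auto simp: children_def pa_def)

lemma finite_children: "finite (children v)"
  using finite_nodes by (simp add: children_def)

definition sub :: "'a \<Rightarrow> 'a set" where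
  "sub v = {u \<in> nodes T. \<exists>i\<le>dep u. (par ^^ i) u = v}"

lemma sub_root: "sub r = nodes T"
proof -
  have "(par ^^ dep u) u = r" if "u \<in> nodes T" for u
    using par_pow[OF that, of "dep u"] dep_0 by auto
  then show ?thesis by (auto simp: sub_def)
qed

lemma sub_anc: "u \<in> sub v \<Longrightarrow> dep v \<le> dep u \<and> (par ^^ (dep u - dep v)) u = v"
  using par_pow[of u] by (auto simp: sub_def)

lemma sub_eq:
  assumes "v \<in> nodes T"
  shows "sub v = insert v (\<Union>c\<in>children v. sub c)"
proof (intro equalityI subsetI)
  fix u assume "u \<in> sub v"
  then obtain i where i: "u \<in> nodes T" "i \<le> dep u" "(par ^^ i) u = v" by (auto simp: sub_def)
  show "u \<in> insert v (\<Union>c\<in>children v. sub c)"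
  proof (cases i)
    case (Suc j)
    let ?c = "(par ^^ j) u"
    have "?c \<in> nodes T" "?c \<noteq> r" using par_pow[OF i(1), of j] par_pow_edge[OF i(1), of j] Suc i(2) by auto
    moreover have "par ?c = v" using i(3) Suc by simp
    moreover have "u \<in> sub ?c" using i Suc by (auto simp: sub_def intro!: exI[of _ j])
    ultimately show ?thesis by (auto simp: children_def)
  qed (use i in simp)
next
  fix u assume "u \<in> insert v (\<Union>c\<in>children v. sub c)"
  then consider "u = v" | c where "c \<in> children v" "u \<in> sub c" by blast
  then show "u \<in> sub v"
  proof cases
    case 1 then show ?thesis using assms by (auto simp: sub_def intro!: exI[of _ 0])
  next
    case 2
    then have "dep c = Suc (dep v)" "par c = v"
      using children_nodes(3) by (auto simp: children_def)
    moreover note sub_anc[OF 2(2)]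
    ultimately have "(par ^^ Suc (dep u - dep c)) u = v" "Suc (dep u - dep c) \<le> dep u" by auto
    then show ?thesis using 2(2) unfolding sub_def by blast
  qed
qed

lemma sub_disjoint: "c \<in> children v \<Longrightarrow> c' \<in> children v \<Longrightarrow> c \<noteq> c' \<Longrightarrow> sub c \<inter> sub c' = {}"
  using sub_anc children_nodes(3) by (metis disjoint_iff)

lemma not_sub_child: "c \<in> children v \<Longrightarrow> v \<notin> sub c"
  using sub_anc children_nodes(3) by fastforce

lemma finite_sub: "finite (sub v)"
  using finite_nodes by (simp add: sub_def)

lemma card_sub:
  assumes "v \<in> nodes T"
  shows "card (sub v) = Suc (\<Sum>c\<in>children v. card (sub c))"
proof -
  have "card (\<Union>c\<in>children v. sub c) = (\<Sum>c\<in>children v. card (sub c))"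
    by (rule card_UN_disjoint) (auto simp: finite_children finite_sub dest: sub_disjoint)
  then show ?thesis
    using sub_eq[OF assms] not_sub_child finite_children finite_sub by (simp add: card_insert_if)
qed

lemma sub_par: "u \<in> sub v \<Longrightarrow> u \<noteq> v \<Longrightarrow> par u \<in> sub v \<and> u \<noteq> r"
proof -
  assume u: "u \<in> sub v" "u \<noteq> v"
  obtain i where i: "u \<in> nodes T" "i \<le> dep u" "(par ^^ i) u = v" using u(1) by (auto simp: sub_def)
  then obtain j where j: "i = Suc j" using u(2) by (cases i) auto
  have "u \<noteq> r" using i j root(2) by auto
  moreover have "(par ^^ j) (par u) = v" using i(3) j by (simp add: funpow_swap1)
  moreover have "dep u = Suc (dep (par u))" "par u \<in> nodes T" using par i(1) \<open>u \<noteq> r\<close> by auto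
  ultimately show ?thesis using i(2) j by (auto simp: sub_def)
qed

end

text \<open>That the task \<open>(v, p, x, y)\<close> can be carried out. Only local injectivity is
  asked for, and choices at different nodes are independent of each other, which is why a stack
  without memory of past choices suffices.\<close>

inductive emb :: "'a ugraph \<Rightarrow> 'b ugraph \<Rightarrow> 'a \<Rightarrow> 'a \<Rightarrow> 'b \<Rightarrow> 'b \<Rightarrow> bool" for A B where
  "inj_on g (ch A v p) \<Longrightarrow> (\<And>c. c \<in> ch A v p \<Longrightarrow> g c \<in> ch B x y) \<Longrightarrow>
   (\<And>c. c \<in> ch A v p \<Longrightarrow> emb A B c v (g c) x) \<Longrightarrow> emb A B v p x y"

text \<open>Distinct children of \<open>v\<close> go to distinct children of \<open>x\<close>, whose
  subtrees are disjoint and do not contain \<open>x\<close>. So the maps on the subtrees have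
  disjoint images, and gluing them together keeps injectivity.\<close>

lemma emb_map:
  assumes "rooted_tree A r par dep" "rooted_tree B q par' dep'"
  shows "emb A B v p x y \<Longrightarrow> v \<in> nodes A \<Longrightarrow> x \<in> nodes B \<Longrightarrow> p = rooted_tree.pa r par v \<Longrightarrow>
    y = rooted_tree.pa q par' x \<Longrightarrow> \<exists>f. f v = x \<and> inj_on f (rooted_tree.sub A par dep v) \<and>
      f ` rooted_tree.sub A par dep v \<subseteq> rooted_tree.sub B par' dep' x \<and>
      (\<forall>u \<in> rooted_tree.sub A par dep v - {v}. {f (par u), f u} \<in> edges B)"
proof (induction rule: emb.induct)
  case (1 g v p x y)
  interpret A: rooted_tree A r par dep by fact
  interpret B: rooted_tree B q par' dep' by fact
  have C: "ch A v p = A.children v" "ch B x y = B.children x"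
    using 1 A.ch_pa B.ch_pa by auto
  have "\<exists>f. f c = g c \<and> inj_on f (A.sub c) \<and> f ` A.sub c \<subseteq> B.sub (g c) \<and>
      (\<forall>u \<in> A.sub c - {c}. {f (par u), f u} \<in> edges B)" if "c \<in> A.children v" for c
    using 1(4)[of c] 1(2)[of c] that A.children_nodes B.children_nodes unfolding C by metis
  then obtain F where F: "\<And>c. c \<in> A.children v \<Longrightarrow> F c c = g c"
    "\<And>c. c \<in> A.children v \<Longrightarrow> inj_on (F c) (A.sub c)"
    "\<And>c. c \<in> A.children v \<Longrightarrow> F c ` A.sub c \<subseteq> B.sub (g c)"
    "\<And>c u. c \<in> A.children v \<Longrightarrow> u \<in> A.sub c \<Longrightarrow> u \<noteq> c \<Longrightarrow> {F c (par u), F c u} \<in> edges B"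
    by (metis Diff_iff singletonD)
  have gc: "g c \<in> B.children x" if "c \<in> A.children v" for c using 1(2) that C by auto
  \<comment> \<open>For \<open>u\<close> below \<open>v\<close> the iterate of \<open>par\<close> is
    the child of \<open>v\<close> that lies above \<open>u\<close>; it selects the map to
    use.\<close>
  define f where "f u = (if u = v then x else F ((par ^^ (dep u - Suc (dep v))) u) u)" for u
  have fc: "f u = F c u" if "c \<in> A.children v" "u \<in> A.sub c" for c u
    using A.sub_anc[OF that(2)] A.children_nodes(3)[OF that(1)] A.not_sub_child[OF that(1)] that(2)
    by (auto simp: f_def)
  have fsub: "f u \<in> B.sub (g c)" if "c \<in> A.children v" "u \<in> A.sub c" for c u
    using fc[OF that] F(3)[OF that(1)] that(2) by auto
  note Aeq = A.sub_eq[OF 1(5)] and Beq = B.sub_eq[OF 1(6)]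
  have "inj_on f (A.sub v)"
  proof (rule inj_onI)
    fix u u' assume u: "u \<in> A.sub v" "u' \<in> A.sub v" "f u = f u'"
    have ne: "f z \<noteq> x" if "z \<in> A.sub v" "z \<noteq> v" for z
      using that fsub gc B.not_sub_child unfolding Aeq by auto metis
    show "u = u'"
    proof (cases "u = v \<or> u' = v")
      case True
      moreover have "f v = x" by (simp add: f_def)
      ultimately show ?thesis using ne u by metis
    next
      case False
      then obtain c c' where c: "c \<in> A.children v" "u \<in> A.sub c" "c' \<in> A.children v" "u' \<in> A.sub c'"
        using u unfolding Aeq by auto
      have "g c = g c'"
        using B.sub_disjoint[OF gc[OF c(1)] gc[OF c(3)]] fsub[OF c(1,2)] fsub[OF c(3,4)] u(3) by auto
      then have "c = c'" using 1(1) c C by (auto dest: inj_onD)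
      then show ?thesis using c u(3) fc F(2)[OF c(1)] by (auto dest: inj_onD)
    qed
  qed
  moreover have "f ` A.sub v \<subseteq> B.sub x"
    unfolding Aeq Beq using fsub gc by (auto simp: f_def[of v])
  moreover have "{f (par u), f u} \<in> edges B" if u: "u \<in> A.sub v - {v}" for u
  proof -
    obtain c where c: "c \<in> A.children v" "u \<in> A.sub c" using u unfolding Aeq by auto
    show ?thesis
    proof (cases "u = c")
      case True
      then have "f (par u) = x" "f u = g c" using c fc F(1) by (auto simp: A.children_def f_def)
      moreover have "{x, g c} \<in> edges B" using 1(2) c C unfolding ch_def by blast
      ultimately show ?thesis by simp
    next
      case False
      then show ?thesis using A.sub_par[OF c(2) False] c fc F(4) by metis
    qed
  qed
  moreover have "f v = x" by (simp add: f_def)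
  ultimately show ?case by blast
qed

lemma emb_imp_subtree:
  assumes A: "is_tree A" and B: "is_tree B" and "r \<in> nodes A" "q \<in> nodes B" and emb: "emb A B r r q q"
  shows "\<exists>S. subtree S B \<and> isomorphic A S"
proof -
  obtain par dep where a: "rooted A r par dep" using tree_rooted[OF A assms(3)] by blast
  obtain par' dep' where b: "rooted B q par' dep'" using tree_rooted[OF B assms(4)] by blast
  interpret A: rooted_tree A r par dep by unfold_locales (rule a)
  interpret B: rooted_tree B q par' dep' by unfold_locales (rule b)
  obtain f where f: "inj_on f (nodes A)" "f ` nodes A \<subseteq> nodes B"
     "\<And>u. u \<in> nodes A \<Longrightarrow> u \<noteq> r \<Longrightarrow> {f (par u), f u} \<in> edges B"
    using emb_map[OF A.rooted_tree_axioms B.rooted_tree_axioms emb assms(3,4)]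
    by (auto simp: A.pa_def B.pa_def A.sub_root B.sub_root)
  \<comment> \<open>The image of \<open>A\<close>, rather than the subgraph of \<open>B\<close>
    induced on its nodes: then isomorphism reduces to injectivity of \<open>f\<close>.\<close>
  define S where "S = \<lparr>nodes = f ` nodes A, edges = (\<lambda>e. f ` e) ` edges A\<rparr>"
  have sA: "simple_graph A" using A by (simp add: is_tree_def)
  have "\<forall>v \<in> nodes A - {r}. {f v, f (par v)} \<in> edges B"
    using f(3) by (metis DiffE insert_commute singletonI)
  then have eS: "edges S \<subseteq> edges B"
    unfolding S_def A.edges_eq by (simp add: image_subset_iff)
  have nS: "nodes S \<subseteq> nodes B" using f(2) by (simp add: S_def)
  have "connected_graph S" unfolding connected_graph_def
  proof (intro ballI)
    fix u v assume "u \<in> nodes S" "v \<in> nodes S"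
    then obtain a b where ab: "a \<in> nodes A" "u = f a" "b \<in> nodes A" "v = f b" by (auto simp: S_def)
    then obtain p where p: "walk A p" "hd p = a" "last p = b"
      using A unfolding is_tree_def connected_graph_def by blast
    have "{f (p ! i), f (p ! Suc i)} \<in> edges S" if "Suc i < length p" for i
      using imageI[of "{p ! i, p ! Suc i}" "edges A" "image f"] that p(1) by (simp add: walk_nth S_def)
    then have "walk S (map f p)" using p(1) by (auto simp: walk_nth S_def)
    then show "\<exists>p. walk S p \<and> hd p = u \<and> last p = v"
      using p ab by (intro exI[of _ "map f p"]) (auto simp: hd_map last_map walk_def)
  qed
  moreover have "\<not> is_cycle S p" for p
  proof
    assume "is_cycle S p"
    then have "is_cycle B p" using eS nS by (auto simp: is_cycle_def walk_nth)
    then show False using B by (auto simp: is_tree_def)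
  qed
  moreover have "simple_graph S"
  proof -
    have "card (f ` e) = 2" if "e \<in> edges A" for e
      using sA that inj_on_subset[OF f(1), of e] by (auto simp: simple_graph_def card_image)
    then show ?thesis using sA by (auto simp: simple_graph_def S_def)
  qed
  ultimately have "is_tree S" using assms(3) by (auto simp: is_tree_def S_def)
  moreover have "isomorphic A S" unfolding isomorphic_def
  proof (intro exI[of _ f] conjI ballI)
    show "bij_betw f (nodes A) (nodes S)" using f(1) by (simp add: S_def bij_betw_def)
    fix u v assume uv: "u \<in> nodes A" "v \<in> nodes A"
    show "{u, v} \<in> edges A \<longleftrightarrow> {f u, f v} \<in> edges S"
    proof
      assume "{u, v} \<in> edges A"
      from imageI[OF this, of "image f"] show "{f u, f v} \<in> edges S" by (simp add: S_def)
    next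
      assume "{f u, f v} \<in> edges S"
      then obtain e where e: "e \<in> edges A" "f ` {u, v} = f ` e" by (auto simp: S_def)
      moreover have "e \<subseteq> nodes A" using sA e(1) by (simp add: simple_graph_def)
      ultimately have "{u, v} = e" using uv inj_on_image_eq_iff[OF f(1), of "{u, v}" e] by blast
      then show "{u, v} \<in> edges A" using e by simp
    qed
  qed
  ultimately show ?thesis using eS nS unfolding subtree_def by blast
qed

lemma subtree_iso_map:
  assumes "subtree S B" "isomorphic A S"
  shows "\<exists>f. inj_on f (nodes A) \<and> f ` nodes A \<subseteq> nodes B \<and>
    (\<forall>u \<in> nodes A. \<forall>v \<in> nodes A. {u, v} \<in> edges A \<longrightarrow> {f u, f v} \<in> edges B)"
proof -
  obtain f where f: "bij_betw f (nodes A) (nodes S)"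
     "\<And>u v. u \<in> nodes A \<Longrightarrow> v \<in> nodes A \<Longrightarrow> {u, v} \<in> edges A \<Longrightarrow> {f u, f v} \<in> edges S"
    using assms(2) unfolding isomorphic_def by metis
  then have "inj_on f (nodes A)" "f ` nodes A \<subseteq> nodes B"
    using assms(1) by (auto simp: bij_betw_def subtree_def)
  moreover have "edges S \<subseteq> edges B" using assms(1) by (simp add: subtree_def)
  ultimately show ?thesis using f(2) by (intro exI[of _ f]) auto
qed

section \<open>Arithmetic on registers\<close>

text \<open>
  Registers 2 to 6 are scratch registers, which are 0 between the macros below, and register 7
  holds the input length plus 1. Tests are assertions; branching is a choice between branches
  that start with complementary assertions.
\<close>

definition clear :: "nat \<Rightarrow> com" where
  "clear r = Loop r (Prim Nop)"

text \<open>A loop uses up its register, so \<open>r\<close> is rebuilt from a second copy collected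
  in register 2.\<close>

definition add :: "nat \<Rightarrow> nat \<Rightarrow> com" where
  "add r q = Loop r (Prim (IncR q) ;; Prim (IncR 2)) ;; Loop 2 (Prim (IncR r))"

definition copy :: "nat \<Rightarrow> nat \<Rightarrow> com" where
  "copy r q = clear q ;; add r q"

definition lt :: "nat \<Rightarrow> nat \<Rightarrow> com" where
  "lt r q = copy r 3 ;; copy q 4 ;; Loop 3 (Prim (DecR 4)) ;; Prim (DecR 4) ;; clear 4"

definition eq :: "nat \<Rightarrow> nat \<Rightarrow> com" where
  "eq r q = copy r 3 ;; copy q 4 ;; Loop 3 (Prim (DecR 4)) ;; Prim (ZeroR 4)"

definition neq :: "nat \<Rightarrow> nat \<Rightarrow> com" where
  "neq r q = lt r q [+] lt q r"

definition addmul :: "nat \<Rightarrow> nat \<Rightarrow> nat \<Rightarrow> com" where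
  "addmul r r' q = copy r 6 ;; Loop 6 (add r' q)"

text \<open>Bit \<open>r\<close> of the input is at head position \<open>r + 1\<close>, hence at
  distance \<open>n - r\<close> from the right end marker; this is the \<open>n + 1\<close> of
  register 7 less \<open>r\<close> and 1. The head rests on the right end between the macros, so the
  distance only has to be added to register 0.\<close>

definition bit :: "bool \<Rightarrow> nat \<Rightarrow> com" where
  "bit b r = copy 7 3 ;; copy r 4 ;; Loop 4 (Prim (DecR 3)) ;; Prim (DecR 3) ;;
     Loop 3 (Prim (IncR 0)) ;; Prim (BitIs b) ;; clear 0"

definition guess :: "nat \<Rightarrow> nat \<Rightarrow> com" where
  "guess x r = clear x ;; copy r 3 ;; Loop 3 (Prim (IncR x) [+] Prim Nop)"

definition foreach :: "nat \<Rightarrow> nat \<Rightarrow> nat \<Rightarrow> com \<Rightarrow> com" where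
  "foreach i r t c = clear i ;; copy r t ;; Loop t (c ;; Prim (IncR i)) ;; clear i"

definition bitat :: "bool \<Rightarrow> nat \<Rightarrow> nat \<Rightarrow> com" where
  "bitat b r q = add r 5 ;; add q 5 ;; bit b 5 ;; clear 5"

definition adj :: "bool \<Rightarrow> nat \<Rightarrow> nat \<Rightarrow> nat \<Rightarrow> nat \<Rightarrow> com" where
  "adj b f r u v = add f 5 ;; add r 5 ;; Prim (IncR 5) ;; addmul u r 5 ;; add v 5 ;; bit b 5 ;; clear 5"

definition push :: "nat \<Rightarrow> nat \<Rightarrow> com" where
  "push S e = addmul S 7 5 ;; add e 5 ;; copy 5 S ;; clear 5"

text \<open>Division by guessing: quotient in register 37, remainder in \<open>e\<close>, then
  multiplication as a check. The pair of \<open>DecR\<close> and \<open>IncR\<close> asserts a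
  nonzero quotient; otherwise the empty stack, which is 1, would pass for the digit 1 on top of
  0.\<close>

definition pop :: "nat \<Rightarrow> nat \<Rightarrow> com" where
  "pop S e = guess 37 S ;; guess e 7 ;; lt e 7 ;; Prim (DecR 37) ;; Prim (IncR 37) ;;
     addmul 37 7 5 ;; add e 5 ;; eq 5 S ;; copy 37 S ;; clear 5 ;; clear 37"

definition fits :: "(nat \<Rightarrow> nat) \<Rightarrow> bool" where
  "fits s \<longleftrightarrow> (\<forall>r\<ge>2. s r < 2 ^ s 1)"

lemma fits_upd: "fits s \<Longrightarrow> r \<noteq> 1 \<Longrightarrow> x < 2 ^ s 1 \<Longrightarrow> fits (s(r := x))"
  by (simp add: fits_def)

lemma fitsD: "fits s \<Longrightarrow> 2 \<le> r \<Longrightarrow> s r < 2 ^ s 1"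
  by (simp add: fits_def)

text \<open>
  Stacks are numbers in base \<open>N\<close>. The empty stack is 1 and not 0, so that the leading digit of a
  stack is never lost.
\<close>

primrec enc :: "nat \<Rightarrow> nat list \<Rightarrow> nat" where
  "enc N [] = 1"
| "enc N (e # l) = enc N l * N + e"

lemma enc_pos: "0 < N \<Longrightarrow> 0 < enc N l"
  by (induction l) auto

lemma enc_less: "\<forall>e\<in>set l. e < N \<Longrightarrow> 1 < N \<Longrightarrow> enc N l < N ^ (length l + 1)"
proof (induction l)
  case (Cons e l)
  then have "Suc (enc N l) * N \<le> N ^ (length l + 1) * N"
    by (intro mult_right_mono) auto
  then show ?case using Cons.prems by (auto simp: algebra_simps intro: less_le_trans)
qed auto

section \<open>Proof rules for the macros\<close>

locale input =
  fixes w :: "bool list" and B :: nat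
begin

abbreviation "n \<equiv> length w"
abbreviation W where "W \<equiv> wp w B"

lemma loop_mono:
  assumes "\<And>Q Q' s. F Q s \<Longrightarrow> (\<And>t. Q t \<Longrightarrow> Q' t) \<Longrightarrow> F Q' s"
  shows "loop_wp r F Q k s \<Longrightarrow> (\<And>t. Q t \<Longrightarrow> Q' t) \<Longrightarrow> loop_wp r F Q' k s"
proof (induction k arbitrary: s)
  case (Suc k)
  then show ?case using assms[of "\<lambda>t. t r = k \<and> loop_wp r F Q k t" "s(r := k)"] by auto
qed auto

lemma wp_mono: "W m c Q s \<Longrightarrow> (\<And>t. Q t \<Longrightarrow> Q' t) \<Longrightarrow> W m c Q' s"
proof (induction c arbitrary: Q Q' s)
  case (Prim p)
  then show ?case by (auto split: option.splits)
next
  case (Seq c d)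
  have "W m c (W m d Q') s"
    by (rule Seq.IH(1)[where Q = "W m d Q"]) (use Seq.prems Seq.IH(2) in auto)
  then show ?case by simp
next
  case (Choice c d)
  then show ?case by (auto split: if_splits)
next
  case (Loop r c)
  have "loop_wp r (W m c) Q' (s r) s"
    by (rule loop_mono[where Q = Q]) (use Loop in auto)
  then show ?case by simp
qed

lemma wp_seq: "W m c (W m d Q) s \<Longrightarrow> W m (c ;; d) Q s"
  by simp

lemma wp_loop:
  assumes "I (s r) s"
    and "\<And>k t. I (Suc k) t \<Longrightarrow> t r = Suc k \<Longrightarrow> W m c (\<lambda>u. u r = k \<and> I k u) (t(r := k))"
    and "\<And>t. I 0 t \<Longrightarrow> t r = 0 \<Longrightarrow> Q t"
  shows "W m (Loop r c) Q s"
proof -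
  have "loop_wp r (W m c) Q k t" if "I k t" "t r = k" for k t
    using that
  proof (induction k arbitrary: t)
    case 0
    then show ?case using assms(3) by simp
  next
    case (Suc k)
    have "W m c (\<lambda>u. u r = k \<and> I k u) (t(r := k))" using assms(2) Suc.prems by blast
    then show ?case using Suc.IH by (auto elim!: wp_mono)
  qed
  then show ?thesis using assms(1) by simp
qed

lemma wp_nop: "Q s \<Longrightarrow> W m (Prim Nop) Q s"
  by simp

text \<open>In mode False the caller has to exclude an overflow, whereas in mode True an overflow
  merely blocks the run and its absence may be assumed afterwards. The later rules about arithmetic
  have the same form.\<close>

lemma wp_inc:
  "(\<not> m \<Longrightarrow> Suc (s r) < 2 ^ s 1) \<Longrightarrow> 2 \<le> r \<Longrightarrow>
   (Suc (s r) < 2 ^ s 1 \<Longrightarrow> Q (s(r := Suc (s r)))) \<Longrightarrow> W m (Prim (IncR r)) Q s"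
  by (auto simp: room_def less_diff_conv)

lemma wp_dec: "(0 < s r \<Longrightarrow> Q (s(r := s r - 1))) \<Longrightarrow> (s r = 0 \<Longrightarrow> m) \<Longrightarrow> W m (Prim (DecR r)) Q s"
  by auto

lemma wp_zero: "(s r = 0 \<Longrightarrow> Q s) \<Longrightarrow> (s r \<noteq> 0 \<Longrightarrow> m) \<Longrightarrow> W m (Prim (ZeroR r)) Q s"
  by auto

lemma wp_choice: "W m c Q s \<Longrightarrow> W m d Q s \<Longrightarrow> W m (c [+] d) Q s"
  "\<not> m \<Longrightarrow> W m c Q s \<Longrightarrow> W m (c [+] d) Q s" "\<not> m \<Longrightarrow> W m d Q s \<Longrightarrow> W m (c [+] d) Q s"
  by (cases m; simp)+

lemma wp_inc_head: "s 0 \<le> n \<Longrightarrow> Q (s(0 := Suc (s 0))) \<Longrightarrow> W m (Prim (IncR 0)) Q s"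
  by (simp add: room_def)

lemma wp_bit_is: "(read_input w (n + 1 - s 0) = Bit b \<Longrightarrow> Q s) \<Longrightarrow>
    (read_input w (n + 1 - s 0) \<noteq> Bit b \<Longrightarrow> m) \<Longrightarrow> W m (Prim (BitIs b)) Q s"
  by simp

declare wp.simps [simp del]

lemma wp_clear: "Q (s(r := 0)) \<Longrightarrow> W m (clear r) Q s"
  unfolding clear_def
  by (rule wp_loop[where I = "\<lambda>k t. t = s(r := k)"]) (auto intro!: wp_nop)

lemma wp_add:
  assumes f: "fits s" and r: "s 2 = 0" "2 < r" "2 < q" "r \<noteq> q"
    and b: "\<not> m \<Longrightarrow> s q + s r < 2 ^ s 1" and Q: "s q + s r < 2 ^ s 1 \<Longrightarrow> Q (s(q := s q + s r))"
  shows "W m (add r q) Q s"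
  unfolding add_def
proof (rule wp_seq, rule wp_loop[where I = "\<lambda>k t. k \<le> s r \<and> t = s(r := k, q := s q + (s r - k), 2 := s r - k)
    \<and> s q + (s r - k) < 2 ^ s 1"])
  show "s r \<le> s r \<and> s = s(r := s r, q := s q + (s r - s r), 2 := s r - s r)
    \<and> s q + (s r - s r) < 2 ^ s 1"
    using r fitsD[OF f] by auto
next
  fix k t
  assume a: "Suc k \<le> s r \<and> t = s(r := Suc k, q := s q + (s r - Suc k), 2 := s r - Suc k)
    \<and> s q + (s r - Suc k) < 2 ^ s 1" and "t r = Suc k"
  have "s r < 2 ^ s 1" using fitsD[OF f] r by auto
  then show "W m (Prim (IncR q) ;; Prim (IncR 2)) (\<lambda>u. u r = k \<and> k \<le> s r \<and>
      u = s(r := k, q := s q + (s r - k), 2 := s r - k) \<and> s q + (s r - k) < 2 ^ s 1) (t(r := k))"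
    using a b r by (intro wp_seq wp_inc) (auto simp: fun_eq_iff)
next
  fix t assume a: "0 \<le> s r \<and> t = s(r := 0, q := s q + (s r - 0), 2 := s r - 0)
     \<and> s q + (s r - 0) < 2 ^ s 1"
  have sr: "s r < 2 ^ s 1" using fitsD[OF f] r by auto
  show "W m (Loop 2 (Prim (IncR r))) Q t"
  proof (rule wp_loop[where I = "\<lambda>k t. k \<le> s r \<and> t = s(q := s q + s r, r := s r - k, 2 := k)"])
    show "t 2 \<le> s r \<and> t = s(q := s q + s r, r := s r - t 2, 2 := t 2)"
      using a r by (auto simp: fun_eq_iff)
  next
    fix k t assume "Suc k \<le> s r \<and> t = s(q := s q + s r, r := s r - Suc k, 2 := Suc k)" "t 2 = Suc k"
    then show "W m (Prim (IncR r)) (\<lambda>u. u 2 = k \<and> k \<le> s r \<and> u = s(q := s q + s r, r := s r - k, 2 := k)) (t(2 := k))"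
      using sr r by (intro wp_inc) (auto simp: fun_eq_iff)
  next
    fix t assume t: "0 \<le> s r \<and> t = s(q := s q + s r, r := s r - 0, 2 := 0)"
    then have "t = s(q := s q + s r)" using r by (auto simp: fun_eq_iff)
    then show "Q t" using Q a by auto
  qed
qed

lemma wp_copy:
  assumes "fits s" "s 2 = 0" "2 < r" "2 < q" "r \<noteq> q" "Q (s(q := s r))"
  shows "W m (copy r q) Q s"
  unfolding copy_def
proof (rule wp_seq, rule wp_clear, rule wp_add)
  show "fits (s(q := 0))" using assms by (intro fits_upd) auto
qed (use assms fitsD[OF assms(1), of r] in auto)

lemma wp_monus:
  assumes "r \<noteq> q" "s r \<le> s q \<Longrightarrow> Q (s(r := 0, q := s q - s r))" "\<not> s r \<le> s q \<Longrightarrow> m"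
  shows "W m (Loop r (Prim (DecR q))) Q s"
proof (rule wp_loop[where I = "\<lambda>k t. (s r - k \<le> s q \<and> t = s(r := k, q := s q - (s r - k)) \<and> k \<le> s r)"])
  fix k t assume a: "s r - Suc k \<le> s q \<and> t = s(r := Suc k, q := s q - (s r - Suc k)) \<and> Suc k \<le> s r"
  show "W m (Prim (DecR q)) (\<lambda>u. u r = k \<and> s r - k \<le> s q \<and> u = s(r := k, q := s q - (s r - k)) \<and> k \<le> s r) (t(r := k))"
    by (rule wp_dec) (use a assms in \<open>auto simp: fun_eq_iff\<close>)
qed (use assms in auto)

lemma wp_lt:
  assumes "fits s" "s 2 = 0" "s 3 = 0" "s 4 = 0" "4 < r" "4 < q"
    and "s r < s q \<Longrightarrow> Q s" "\<not> s r < s q \<Longrightarrow> m"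
  shows "W m (lt r q) Q s"
proof -
  have 1: "fits (s(3 := s r))" "fits (s(3 := s r, 4 := s q))"
    using assms fitsD[OF assms(1)] by (auto intro!: fits_upd)
  have 2: "s(3 := 0, 4 := 0) = s" using assms by (auto simp: fun_eq_iff)
  show ?thesis
    unfolding lt_def
    using assms 1 2 by (intro wp_seq wp_copy wp_monus wp_dec wp_clear) (auto simp: fun_upd_twist)
qed

lemma wp_eq:
  assumes "fits s" "s 2 = 0" "s 3 = 0" "s 4 = 0" "4 < r" "4 < q"
    and "s r = s q \<Longrightarrow> Q s" "s r \<noteq> s q \<Longrightarrow> m"
  shows "W m (eq r q) Q s"
proof -
  have 1: "fits (s(3 := s r))" "fits (s(3 := s r, 4 := s q))"
    using assms fitsD[OF assms(1)] by (auto intro!: fits_upd)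
  have 2: "s(3 := 0, 4 := 0) = s" using assms by (auto simp: fun_eq_iff)
  show ?thesis
    unfolding eq_def
    using assms 1 2 by (intro wp_seq wp_copy wp_monus wp_zero) (auto simp: fun_upd_twist)
qed

lemma wp_neq:
  assumes "fits s" "s 2 = 0" "s 3 = 0" "s 4 = 0" "4 < r" "4 < q"
    and Q: "s r \<noteq> s q \<Longrightarrow> Q s" "s r = s q \<Longrightarrow> m"
  shows "W m (neq r q) Q s"
proof -
  have "W m (lt r q) Q s" if "m \<or> s r < s q"
    by (rule wp_lt[OF assms(1-6)]) (use Q that in auto)
  moreover have "W m (lt q r) Q s" if "m \<or> s q < s r"
    by (rule wp_lt[OF assms(1-4) assms(6,5)]) (use Q that in auto)
  ultimately show ?thesis unfolding neq_def using Q
    by (cases m; cases "s r < s q"; cases "s q < s r") (auto intro: wp_choice)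
qed

lemma wp_addmul:
  assumes f: "fits s" and r: "s 2 = 0" "s 6 = 0" "2 < r" "2 < r'" "2 < q" "r \<noteq> 6" "r' \<noteq> 6" "q \<noteq> 6" "r' \<noteq> q"
    and b: "\<not> m \<Longrightarrow> s q + s r * s r' < 2 ^ s 1"
    and Q: "s q + s r * s r' < 2 ^ s 1 \<Longrightarrow> Q (s(q := s q + s r * s r'))"
  shows "W m (addmul r r' q) Q s"
  unfolding addmul_def
proof (rule wp_seq, rule wp_copy)
  have sr: "s r < 2 ^ s 1" using fitsD[OF f] r by auto
  show "W m (Loop 6 (add r' q)) Q (s(6 := s r))"
  proof (rule wp_loop[where I = "\<lambda>k t. k \<le> s r \<and> t = s(6 := k, q := s q + (s r - k) * s r') \<and>
        s q + (s r - k) * s r' < 2 ^ s 1"])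
    show "(s(6 := s r)) 6 \<le> s r \<and> s(6 := s r) = s(6 := (s(6 := s r)) 6, q := s q + (s r - (s(6 := s r)) 6) * s r')
       \<and> s q + (s r - (s(6 := s r)) 6) * s r' < 2 ^ s 1"
      using r fitsD[OF f, of q] by auto
  next
    fix k t
    assume a: "Suc k \<le> s r \<and> t = s(6 := Suc k, q := s q + (s r - Suc k) * s r') \<and>
        s q + (s r - Suc k) * s r' < 2 ^ s 1"
    have e: "s q + (s r - Suc k) * s r' + s r' = s q + (s r - k) * s r'"
    proof -
      have "s r - k = Suc (s r - Suc k)" using a by auto
      then show ?thesis by simp
    qed
    have "(s r - k) * s r' \<le> s r * s r'" by (intro mult_right_mono) auto
    then have bb: "\<not> m \<Longrightarrow> s q + (s r - Suc k) * s r' + s r' < 2 ^ s 1"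
      unfolding e using b by linarith
    show "W m (add r' q) (\<lambda>u. u 6 = k \<and> k \<le> s r \<and> u = s(6 := k, q := s q + (s r - k) * s r') \<and>
        s q + (s r - k) * s r' < 2 ^ s 1) (t(6 := k))"
    proof (rule wp_add)
      show "fits (t(6 := k))" using a f r sr by (auto intro!: fits_upd)
    qed (use a r e bb in \<open>auto simp: fun_eq_iff\<close>)
  next
    fix t assume "0 \<le> s r \<and> t = s(6 := 0, q := s q + (s r - 0) * s r') \<and> s q + (s r - 0) * s r' < 2 ^ s 1"
    moreover from this have "t = s(q := s q + s r * s r')" using r by (auto simp: fun_eq_iff)
    ultimately show "Q t" using Q by auto
  qed
qed (use f r in auto)

lemma wp_bit:
  assumes f: "fits s" and r: "s 0 = 0" "s 2 = 0" "s 3 = 0" "s 4 = 0" "s 7 = Suc n" "4 < r" "r \<noteq> 7"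
    and Q: "s r < n \<Longrightarrow> w ! s r = b \<Longrightarrow> Q s" "\<not> (s r < n \<and> w ! s r = b) \<Longrightarrow> m"
  shows "W m (bit b r) Q s"
proof -
  have 1: "fits (s(3 := Suc n))" "fits (s(3 := Suc n, 4 := s r))"
    using r fitsD[OF f] fitsD[OF f, of 7] f by (auto intro!: fits_upd)
  have loop: "W m (Loop 3 (Prim (IncR 0))) Q' t" if "t 0 = 0" "t 3 \<le> n" "Q' (t(3 := 0, 0 := t 3))" for Q' t
  proof (rule wp_loop[where I = "\<lambda>k u. k \<le> t 3 \<and> u = t(3 := k, 0 := t 3 - k)"])
    fix k u assume "Suc k \<le> t 3 \<and> u = t(3 := Suc k, 0 := t 3 - Suc k)"
    then show "W m (Prim (IncR 0)) (\<lambda>u. u 3 = k \<and> k \<le> t 3 \<and> u = t(3 := k, 0 := t 3 - k)) (u(3 := k))"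
      using that by (intro wp_inc_head) (auto simp: fun_eq_iff)
  qed (use that in \<open>auto simp: fun_upd_idem\<close>)
  have rd: "read_input w (n + 1 - (n - s r)) = Bit b \<longleftrightarrow> s r < n \<and> w ! s r = b" if "s r \<le> n"
    using that by (auto simp: read_input_def)
  have res: "s(3 := 0, 4 := 0, 0 := 0) = s" using r by (auto simp: fun_eq_iff)
  have fin: "W m (Prim (BitIs b) ;; clear 0) Q (s(3 := 0, 4 := 0, 0 := n - s r))" if "s r \<le> n"
    by (intro wp_seq wp_bit_is wp_clear) (use that rd res Q in auto)
  have 2: "W m (Loop 4 (Prim (DecR 3)) ;; Prim (DecR 3) ;; Loop 3 (Prim (IncR 0)) ;; Prim (BitIs b) ;; clear 0) Q
      (s(3 := Suc n, 4 := s r))"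
    using fin r Q by (intro wp_seq wp_monus wp_dec loop) (auto simp: fun_upd_twist wp.simps(2))
  show ?thesis
    unfolding bit_def
    using f 1 2 r by (intro wp_seq wp_copy) (auto simp: wp.simps(2))
qed

lemma wp_guess:
  assumes f: "fits s" and r: "s 2 = 0" "s 3 = 0" "4 < r" "4 < x" "r \<noteq> x"
    and Q: "if m then \<forall>e\<le>s r. Q (s(x := e)) else \<exists>e\<le>s r. Q (s(x := e))"
  shows "W m (guess x r) Q s"
  unfolding guess_def
proof (rule wp_seq, rule wp_clear, rule wp_seq, rule wp_copy)
  show "fits (s(x := 0))" using f r by (auto intro!: fits_upd)
  let ?s = "s(x := 0, 3 := (s(x := 0)) r)"
  have sr: "s r < 2 ^ s 1" using fitsD[OF f] r by auto
  show "W m (Loop 3 (Prim (IncR x) [+] Prim Nop)) Q ?s"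
  proof (cases m)
    case True
    \<comment> \<open>Whatever was chosen so far, the value and the rounds left add up to at most
      \<open>s r\<close>.\<close>
    show ?thesis
    proof (rule wp_loop[where I = "\<lambda>k t. \<exists>e\<le>s r. t = s(3 := k, x := e) \<and> e + k \<le> s r"])
      fix k t assume "\<exists>e\<le>s r. t = s(3 := Suc k, x := e) \<and> e + Suc k \<le> s r"
      then obtain e where e: "t(3 := k) = s(3 := k, x := e)" "e + Suc k \<le> s r"
        using r by (auto simp: fun_eq_iff)
      let ?Q = "\<lambda>u. u 3 = k \<and> (\<exists>e\<le>s r. u = s(3 := k, x := e) \<and> e + k \<le> s r)"
      have "W m (Prim (IncR x)) ?Q (t(3 := k))"
        unfolding e(1) by (rule wp_inc) (use True e r in \<open>auto intro!: exI[of _ "Suc e"]\<close>)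
      moreover have "W m (Prim Nop) ?Q (t(3 := k))"
        unfolding e(1) by (rule wp_nop) (use e r in \<open>auto intro!: exI[of _ e]\<close>)
      ultimately show "W m (Prim (IncR x) [+] Prim Nop) ?Q (t(3 := k))"
        by (rule wp_choice(1))
    next
      fix t assume "\<exists>e\<le>s r. t = s(3 := 0, x := e) \<and> e + 0 \<le> s r"
      then obtain e where "e \<le> s r" "t = s(x := e)" using r by (auto simp: fun_eq_iff)
      then show "Q t" using Q True by auto
    qed (use r in \<open>auto simp: fun_eq_iff\<close>)
  next
    case False
    then obtain e where e: "e \<le> s r" "Q (s(x := e))" using Q by auto
    \<comment> \<open>To arrive at \<open>e\<close>, the run does nothing at first and increments in
      the last \<open>e\<close> rounds; truncated subtraction describes both phases.\<close>
    show ?thesis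
    proof (rule wp_loop[where I = "\<lambda>k t. t = s(3 := k, x := e - k) \<and> k \<le> s r"])
      fix k t assume a: "t = s(3 := Suc k, x := e - Suc k) \<and> Suc k \<le> s r"
      let ?Q = "\<lambda>u. u 3 = k \<and> u = s(3 := k, x := e - k) \<and> k \<le> s r"
      show "W m (Prim (IncR x) [+] Prim Nop) ?Q (t(3 := k))"
      proof (cases "k < e")
        case True
        have "W m (Prim (IncR x)) ?Q (t(3 := k))"
          by (rule wp_inc) (use a True e sr r in \<open>auto simp: fun_eq_iff\<close>)
        then show ?thesis by (rule wp_choice(2)[OF False])
      next
        case k: False
        have "W m (Prim Nop) ?Q (t(3 := k))"
          by (rule wp_nop) (use a k e r in \<open>auto simp: fun_eq_iff\<close>)
        then show ?thesis by (rule wp_choice(3)[OF False])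
      qed
    next
      fix t assume "t = s(3 := 0, x := e - 0) \<and> 0 \<le> s r"
      then have "t = s(x := e)" using r by (auto simp: fun_eq_iff)
      then show "Q t" using e by simp
    qed (use r e in \<open>auto simp: fun_eq_iff\<close>)
  qed
qed (use r in auto)

lemma wp_for:
  assumes f: "fits s" and r: "s 2 = 0" "2 < i" "2 < r" "2 < t" "i \<noteq> t" "i \<noteq> r" "r \<noteq> t"
    and J0: "J 0 (s(i := 0, t := s r))"
    and J: "\<And>k u. k < s r \<Longrightarrow> J k u \<Longrightarrow> u i = k \<Longrightarrow> u t = s r - k \<Longrightarrow> u 1 = s 1 \<Longrightarrow>
       W m c (\<lambda>v. v t = s r - Suc k \<and> v i = k \<and> v 1 = s 1 \<and> J (Suc k) (v(i := Suc k))) (u(t := s r - Suc k))"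
    and Q: "\<And>u. J (s r) u \<Longrightarrow> u i = s r \<Longrightarrow> u t = 0 \<Longrightarrow> u 1 = s 1 \<Longrightarrow> Q (u(i := 0))"
  shows "W m (foreach i r t c) Q s"
  unfolding foreach_def
proof (rule wp_seq, rule wp_clear, rule wp_seq, rule wp_copy)
  show "fits (s(i := 0))" using f r by (auto intro!: fits_upd)
  have sr: "s r < 2 ^ s 1" using fitsD[OF f] r by auto
  show "W m (Loop t (c ;; Prim (IncR i)) ;; clear i) Q (s(i := 0, t := (s(i := 0)) r))"
  proof (rule wp_seq, rule wp_loop[where I = "\<lambda>k u. k \<le> s r \<and> J (s r - k) u \<and> u i = s r - k \<and> u 1 = s 1"])
    fix k u assume a: "Suc k \<le> s r \<and> J (s r - Suc k) u \<and> u i = s r - Suc k \<and> u 1 = s 1" "u t = Suc k"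
    have "W m c (\<lambda>v. v t = s r - Suc (s r - Suc k) \<and> v i = s r - Suc k \<and> v 1 = s 1 \<and>
        J (Suc (s r - Suc k)) (v(i := Suc (s r - Suc k)))) (u(t := s r - Suc (s r - Suc k)))"
      by (rule J) (use a in auto)
    moreover have "s r - Suc (s r - Suc k) = k" "Suc (s r - Suc k) = s r - k" using a by auto
    ultimately have "W m c (\<lambda>v. v t = k \<and> v i = s r - Suc k \<and> v 1 = s 1 \<and> J (s r - k) (v(i := s r - k))) (u(t := k))"
      by simp
    then have "W m c (W m (Prim (IncR i)) (\<lambda>u. u t = k \<and> k \<le> s r \<and> J (s r - k) u \<and> u i = s r - k \<and> u 1 = s 1)) (u(t := k))"
    proof (rule wp_mono)
      fix v assume v: "v t = k \<and> v i = s r - Suc k \<and> v 1 = s 1 \<and> J (s r - k) (v(i := s r - k))"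
      show "W m (Prim (IncR i)) (\<lambda>u. u t = k \<and> k \<le> s r \<and> J (s r - k) u \<and> u i = s r - k \<and> u 1 = s 1) v"
        by (rule wp_inc) (use v a r sr in \<open>auto simp: Suc_diff_Suc\<close>)
    qed
    then show "W m (c ;; Prim (IncR i)) (\<lambda>u. u t = k \<and> k \<le> s r \<and> J (s r - k) u \<and> u i = s r - k \<and> u 1 = s 1) (u(t := k))"
      by (rule wp_seq)
  next
    fix u assume "0 \<le> s r \<and> J (s r - 0) u \<and> u i = s r - 0 \<and> u 1 = s 1" "u t = 0"
    then show "W m (clear i) Q u" by (intro wp_clear Q) auto
  qed (use J0 r in auto)
qed (use r in auto)

definition std :: "(nat \<Rightarrow> nat) \<Rightarrow> bool" where
  "std s \<longleftrightarrow> fits s \<and> s 0 = 0 \<and> s 2 = 0 \<and> s 3 = 0 \<and> s 4 = 0 \<and> s 5 = 0 \<and> s 6 = 0 \<and> s 7 = Suc n"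

lemma std_upd: "std s \<Longrightarrow> 7 < r \<Longrightarrow> x < 2 ^ s 1 \<Longrightarrow> std (s(r := x))"
  by (simp add: std_def fits_upd)

lemma stdD: "std s \<Longrightarrow> fits s" "std s \<Longrightarrow> s 0 = 0" "std s \<Longrightarrow> s 2 = 0" "std s \<Longrightarrow> s 3 = 0"
  "std s \<Longrightarrow> s 4 = 0" "std s \<Longrightarrow> s 5 = 0" "std s \<Longrightarrow> s 6 = 0" "std s \<Longrightarrow> s 7 = Suc n"
  by (auto simp: std_def)

lemma std_n: "std s \<Longrightarrow> Suc n < 2 ^ s 1"
  using fitsD[of s 7] by (auto simp: std_def)

lemma wp_bitat:
  assumes s: "std s" and r: "6 < r" "6 < q"
    and Q: "s r + s q < n \<Longrightarrow> w ! (s r + s q) = b \<Longrightarrow> Q s" "\<not> (s r + s q < n \<and> w ! (s r + s q) = b) \<Longrightarrow> m"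
  shows "W m (bitat b r q) Q s"
proof -
  note d = stdD[OF s]
  have f: "fits (s(5 := x))" if "x < 2 ^ s 1" for x using d(1) that by (auto intro!: fits_upd)
  have res: "s(5 := 0) = s" using d by (auto simp: fun_eq_iff)
  \<comment> \<open>In mode False the position lies inside the input, and the content of register 7
    shows that such numbers fit.\<close>
  have b: "s r + s q < 2 ^ s 1" if "\<not> m"
  proof -
    have "s r + s q < n" using Q(2) that by blast
    then show ?thesis using std_n[OF s] by linarith
  qed
  show ?thesis
    unfolding bitat_def
  proof (rule wp_seq, rule wp_add)
    assume 1: "s 5 + s r < 2 ^ s 1"
    show "W m (add q 5 ;; bit b 5 ;; clear 5) Q (s(5 := s 5 + s r))"
    proof (rule wp_seq, rule wp_add)
      assume 2: "(s(5 := s 5 + s r)) 5 + (s(5 := s 5 + s r)) q < 2 ^ (s(5 := s 5 + s r)) 1"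
      show "W m (bit b 5 ;; clear 5) Q ((s(5 := s 5 + s r))(5 := (s(5 := s 5 + s r)) 5 + (s(5 := s 5 + s r)) q))"
        by (intro wp_seq wp_bit wp_clear) (use d r f Q res 2 in auto)
    qed (use d r f b 1 in auto)
  qed (use d r b in auto)
qed

text \<open>The input position of entry \<open>(u, v)\<close> of an adjacency matrix: the encoding
  starts at \<open>f\<close>, and \<open>r\<close> ones and a zero precede the matrix.\<close>

definition ix :: "nat \<Rightarrow> nat \<Rightarrow> nat \<Rightarrow> nat \<Rightarrow> nat" where
  "ix f r u v = f + r + 1 + u * r + v"

lemma wp_adj:
  assumes s: "std s" and r: "6 < f" "6 < r" "6 < u" "6 < v"
    and Q: "ix (s f) (s r) (s u) (s v) < n \<Longrightarrow> w ! ix (s f) (s r) (s u) (s v) = b \<Longrightarrow> Q s"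
      "\<not> (ix (s f) (s r) (s u) (s v) < n \<and> w ! ix (s f) (s r) (s u) (s v) = b) \<Longrightarrow> m"
  shows "W m (adj b f r u v) Q s"
proof -
  note d = stdD[OF s]
  have f: "fits (s(5 := x))" if "x < 2 ^ s 1" for x using d(1) that by (auto intro!: fits_upd)
  have res: "s(5 := 0) = s" using d by (auto simp: fun_eq_iff)
  have b: "s f + s r + 1 + s u * s r + s v < 2 ^ s 1" if "\<not> m"
  proof -
    have "ix (s f) (s r) (s u) (s v) < n" using Q(2) that by blast
    then show ?thesis using std_n[OF s] unfolding ix_def by linarith
  qed
  let ?c5 = "bit b 5 ;; clear 5" let ?c4 = "add v 5 ;; ?c5" let ?c3 = "addmul u r 5 ;; ?c4"
  let ?c2 = "Prim (IncR 5) ;; ?c3" let ?c1 = "add r 5 ;; ?c2"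
  have 5: "W m ?c5 Q (s(5 := s f + s r + 1 + s u * s r + s v))"
    if "s f + s r + 1 + s u * s r + s v < 2 ^ s 1"
    by (intro wp_seq wp_bit wp_clear) (use d r f[OF that] Q res in \<open>auto simp: ix_def\<close>)
  have 4: "W m ?c4 Q (s(5 := s f + s r + 1 + s u * s r))" if "s f + s r + 1 + s u * s r < 2 ^ s 1"
    by (rule wp_seq, rule wp_add) (use d r f[OF that] b 5 in auto)
  have 3: "W m ?c3 Q (s(5 := s f + s r + 1))" if "s f + s r + 1 < 2 ^ s 1"
    by (rule wp_seq, rule wp_addmul) (use d r f[OF that] b 4 in auto)
  have 2: "W m ?c2 Q (s(5 := s f + s r))" if "s f + s r < 2 ^ s 1"
    by (rule wp_seq, rule wp_inc) (use d r b 3 in auto)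
  have 1: "W m ?c1 Q (s(5 := s f))" if "s f < 2 ^ s 1"
    by (rule wp_seq, rule wp_add) (use d r f[OF that] b 2 in auto)
  show ?thesis
    unfolding adj_def
    by (rule wp_seq, rule wp_add) (use d r b 1 in auto)
qed

lemma wp_push:
  assumes s: "std s" and r: "7 < S" "7 < e" "S \<noteq> e"
    and b: "\<not> m \<Longrightarrow> s S * Suc n + s e < 2 ^ s 1"
    and Q: "s S * Suc n + s e < 2 ^ s 1 \<Longrightarrow> Q (s(S := s S * Suc n + s e))"
  shows "W m (push S e) Q s"
proof -
  note d = stdD[OF s]
  have f: "fits (s(5 := x))" if "x < 2 ^ s 1" for x using d(1) that by (auto intro!: fits_upd)
  let ?x = "s S * Suc n + s e"
  let ?c2 = "copy 5 S ;; clear 5" let ?c1 = "add e 5 ;; ?c2"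
  have res: "s(5 := ?x, S := ?x, 5 := 0) = s(S := ?x)"
    using d r by (auto simp: fun_eq_iff)
  have 2: "W m ?c2 Q (s(5 := ?x))" if "?x < 2 ^ s 1"
  proof (rule wp_seq, rule wp_copy)
    show "W m (clear 5) Q ((s(5 := ?x))(S := (s(5 := ?x)) 5))"
      using res Q that by (intro wp_clear) simp
  qed (use d r f[OF that] in auto)
  have 1: "W m ?c1 Q (s(5 := s S * Suc n))" if "s S * Suc n < 2 ^ s 1"
  proof (rule wp_seq, rule wp_add)
    assume a: "(s(5 := s S * Suc n)) 5 + (s(5 := s S * Suc n)) e < 2 ^ (s(5 := s S * Suc n)) 1"
    then have "(s(5 := s S * Suc n))(5 := (s(5 := s S * Suc n)) 5 + (s(5 := s S * Suc n)) e) = s(5 := ?x)"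
      using r by simp
    then show "W m ?c2 Q ((s(5 := s S * Suc n))(5 := (s(5 := s S * Suc n)) 5 + (s(5 := s S * Suc n)) e))"
      using 2 a r by simp
  qed (use d r f[OF that] b in auto)
  show ?thesis
    unfolding push_def
  proof (rule wp_seq, rule wp_addmul)
    assume "s 5 + s S * s 7 < 2 ^ s 1"
    then show "W m ?c1 Q (s(5 := s 5 + s S * s 7))" using 1 d by simp
  qed (use d r b in \<open>auto simp del: mult_Suc_right\<close>)
qed

text \<open>Uniqueness of division with remainder. The empty stack is told apart by
  \<open>0 < q\<close>, which makes the left-hand side at least \<open>N\<close> and so greater than
  1.\<close>

lemma enc_pop:
  assumes "0 < q" "e < N" "1 < N" "\<forall>x\<in>set l. x < N"
  shows "q * N + e = enc N l \<longleftrightarrow> (\<exists>l'. l = e # l' \<and> q = enc N l')"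
proof (cases l)
  case Nil
  have "q * N \<ge> N" using assms(1) by simp
  then have "q * N + e \<noteq> 1" using assms(3) by linarith
  then show ?thesis using Nil by simp
next
  case (Cons x l')
  have "q * N + e = enc N l' * N + x \<longleftrightarrow> q = enc N l' \<and> e = x"
  proof
    assume a: "q * N + e = enc N l' * N + x"
    have "(q * N + e) div N = q" "(q * N + e) mod N = e"
      "(enc N l' * N + x) div N = enc N l'" "(enc N l' * N + x) mod N = x"
      using assms Cons by auto
    then show "q = enc N l' \<and> e = x" using a by simp
  qed auto
  then show ?thesis using Cons by auto
qed

lemma wp_pop:
  assumes s: "std s" and z: "s 37 = 0" and r: "7 < S" "7 < e" "S \<noteq> e" "S \<noteq> 37" "e \<noteq> 37" and n: "0 < n"
    and l: "s S = enc (Suc n) l" "\<forall>x\<in>set l. x < Suc n"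
    and Q: "case l of [] \<Rightarrow> m | x # l' \<Rightarrow> Q (s(S := enc (Suc n) l', e := x))"
  shows "W m (pop S e) Q s"
proof -
  note d = stdD[OF s]
  have cap: "enc (Suc n) l < 2 ^ s 1" using fitsD[OF d(1), of S] r l by simp
  have main: "W m (lt e 7 ;; Prim (DecR 37) ;; Prim (IncR 37) ;;
     addmul 37 7 5 ;; add e 5 ;; eq 5 S ;; copy 37 S ;; clear 5 ;; clear 37) Q (s(37 := q, e := x))"
    if qx: "q \<le> s S" "x \<le> Suc n" "m \<or> (\<exists>l'. l = x # l' \<and> q = enc (Suc n) l')" for q x
  proof -
    let ?s = "s(37 := q, e := x)"
    let ?c5 = "eq 5 S ;; copy 37 S ;; clear 5 ;; clear 37" let ?c4 = "add e 5 ;; ?c5"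
    let ?c3 = "addmul 37 7 5 ;; ?c4" let ?c2 = "Prim (IncR 37) ;; ?c3"
    have ok: "x < Suc n \<and> 0 < q \<and> q * Suc n + x = enc (Suc n) l" if "\<not> m"
      using qx that l enc_pos[of "Suc n"] by auto
    have q2: "q < 2 ^ s 1" using qx(1) fitsD[OF d(1), of S] r by simp
    have x2: "x < 2 ^ s 1" using qx(2) std_n[OF s] by simp
    have fs: "fits ?s" using d(1) r q2 x2 by (auto intro!: fits_upd)
    have f: "fits (?s(5 := y))" if "y < 2 ^ s 1" for y using fs that r by (auto intro!: fits_upd)
    have 5: "W m ?c5 Q (?s(5 := q * Suc n + x))" if a: "q * Suc n + x < 2 ^ s 1" "0 < q" "x < Suc n"
    proof (rule wp_seq, rule wp_eq)
      assume "(?s(5 := q * Suc n + x)) 5 = (?s(5 := q * Suc n + x)) S"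
      then have "q * Suc n + x = enc (Suc n) l" using r l by simp
      then obtain l' where l': "l = x # l'" "q = enc (Suc n) l'"
        using enc_pop[of q x "Suc n" l] a n l by auto
      have "(?s(5 := q * Suc n + x))(S := (?s(5 := q * Suc n + x)) 37, 5 := 0, 37 := 0) = s(S := q, e := x)"
        using d z r by (auto simp: fun_eq_iff)
      then show "W m (copy 37 S ;; clear 5 ;; clear 37) Q (?s(5 := q * Suc n + x))"
        using Q l' f[OF a(1)] d r by (intro wp_seq wp_copy wp_clear) auto
    next
      assume "(?s(5 := q * Suc n + x)) 5 \<noteq> (?s(5 := q * Suc n + x)) S"
      then show m using ok r l by auto
    qed (use d r f[OF a(1)] in auto)
    have 4: "W m ?c4 Q (?s(5 := q * Suc n))" if a: "q * Suc n < 2 ^ s 1" "0 < q" "x < Suc n"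
    proof (rule wp_seq, rule wp_add)
      let ?t = "?s(5 := q * Suc n)"
      assume b: "?t 5 + ?t e < 2 ^ ?t 1"
      have "?t(5 := ?t 5 + ?t e) = ?s(5 := q * Suc n + x)" using r by simp
      then show "W m ?c5 Q (?t(5 := ?t 5 + ?t e))" using 5 a b r by simp
    qed (use d r f[OF a(1)] ok cap in \<open>auto simp del: mult_Suc_right\<close>)
    have 3: "W m ?c3 Q ?s" if a: "0 < q" "x < Suc n"
    proof (rule wp_seq, rule wp_addmul)
      assume b: "?s 5 + ?s 37 * ?s 7 < 2 ^ ?s 1"
      have "?s(5 := ?s 5 + ?s 37 * ?s 7) = ?s(5 := q * Suc n)" using r d by simp
      then show "W m ?c4 Q (?s(5 := ?s 5 + ?s 37 * ?s 7))" using 4 a b r d by simp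
    qed (use d r fs ok cap in \<open>auto simp del: mult_Suc_right\<close>)
    have 2: "W m ?c2 Q (?s(37 := q - 1))" if a: "0 < q" "x < Suc n"
    proof (rule wp_seq, rule wp_inc)
      have "?s(37 := q - 1, 37 := Suc ((?s(37 := q - 1)) 37)) = ?s"
        using a r by (auto simp: fun_eq_iff)
      then show "W m ?c3 Q ((?s(37 := q - 1))(37 := Suc ((?s(37 := q - 1)) 37)))" using 3 a by simp
    qed (use a q2 r in auto)
    show ?thesis
    proof (rule wp_seq, rule wp_lt)
      assume "?s e < ?s 7"
      then have xn: "x < Suc n" using r d by simp
      show "W m (Prim (DecR 37) ;; ?c2) Q ?s"
      proof (rule wp_seq, rule wp_dec)
        assume "0 < ?s 37"
        then show "W m ?c2 Q (?s(37 := ?s 37 - 1))" using 2 xn r by simp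
      qed (use ok r in auto)
    qed (use d r fs ok in auto)
  qed
  have g2: "W m (guess e 7 ;; lt e 7 ;; Prim (DecR 37) ;; Prim (IncR 37) ;;
     addmul 37 7 5 ;; add e 5 ;; eq 5 S ;; copy 37 S ;; clear 5 ;; clear 37) Q (s(37 := q))"
    if q: "q \<le> s S" "m \<or> (\<exists>x l'. l = x # l' \<and> q = enc (Suc n) l')" for q
  proof (rule wp_seq, rule wp_guess)
    have "q < 2 ^ s 1" using q(1) fitsD[OF d(1), of S] r by simp
    then show "fits (s(37 := q))" using d(1) by (auto intro!: fits_upd)
    have 7: "(s(37 := q)) 7 = Suc n" using d by simp
    let ?R = "W m (lt e 7 ;; Prim (DecR 37) ;; Prim (IncR 37) ;;
     addmul 37 7 5 ;; add e 5 ;; eq 5 S ;; copy 37 S ;; clear 5 ;; clear 37) Q"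
    show "if m then \<forall>x\<le>(s(37 := q)) 7. ?R ((s(37 := q))(e := x)) else \<exists>x\<le>(s(37 := q)) 7. ?R ((s(37 := q))(e := x))"
    proof (cases m)
      case True
      then show ?thesis unfolding 7 using main[OF q(1)] by simp
    next
      case False
      then obtain x l' where l': "l = x # l'" "q = enc (Suc n) l'" using q by auto
      then show ?thesis unfolding 7 using main[OF q(1), of x] l False by (auto intro!: exI[of _ x])
    qed
  qed (use d r in auto)
  show ?thesis
    unfolding pop_def
  proof (rule wp_seq, rule wp_guess)
    let ?R = "W m (guess e 7 ;; lt e 7 ;; Prim (DecR 37) ;; Prim (IncR 37) ;;
     addmul 37 7 5 ;; add e 5 ;; eq 5 S ;; copy 37 S ;; clear 5 ;; clear 37) Q"
    show "if m then \<forall>q\<le>s S. ?R (s(37 := q)) else \<exists>q\<le>s S. ?R (s(37 := q))"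
    proof (cases m)
      case True
      then show ?thesis using g2 by simp
    next
      case False
      then obtain x l' where l': "l = x # l'" using Q by (cases l) auto
      have "enc (Suc n) l' \<le> s S" using l l' by simp
      then show ?thesis using g2[of "enc (Suc n) l'"] l' False by auto
    qed
  qed (use d r in auto)
qed

end

section \<open>Recognising encodings of trees\<close>

text \<open>
  In the following, \<open>f\<close> and \<open>r\<close> are the registers holding the offset \<open>F\<close> of the encoding in the
  input and the number \<open>R\<close> of nodes; register 23 holds \<open>d + 1\<close>, and 18 sums up the degrees.
\<close>

definition header :: "nat \<Rightarrow> nat \<Rightarrow> com" where
  "header f r = foreach 15 r 16 (bitat True f 15) ;; bitat False f r"

text \<open>Each entry is guessed to be 1 or 0 and the guess is checked. Symmetry and the absence of
  loops are conditions on the entries 1 only, so one pass over all rows establishes them.\<close>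

definition row :: "nat \<Rightarrow> nat \<Rightarrow> com" where
  "row f r = foreach 15 r 16
     ((adj True f r 13 15 ;; adj True f r 15 13 ;; neq 13 15 ;; Prim (IncR 17) ;; Prim (IncR 18))
      [+] adj False f r 13 15) ;; lt 17 23 ;; clear 17"

text \<open>A walk to node 0 is a certificate that can be guessed step by step, with only the
  current node in memory. Register 7 provides more rounds than there are arcs, and spare rounds are
  spent on \<open>Nop\<close>.\<close>

definition to_root :: "nat \<Rightarrow> nat \<Rightarrow> com" where
  "to_root f r = copy 13 19 ;; copy 7 21 ;;
     Loop 21 ((guess 20 r ;; lt 20 r ;; adj True f r 19 20 ;; copy 20 19 ;; clear 20) [+] Prim Nop) ;;
     Prim (ZeroR 19)"

text \<open>The last comparison says that there is one edge less than there are nodes, doubled to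
  avoid division and with 2 added to the degree sum to avoid subtraction.\<close>

definition graph_check :: "nat \<Rightarrow> nat \<Rightarrow> com" where
  "graph_check f r = header f r ;; foreach 13 r 14 (row f r ;; to_root f r) ;;
     Prim (IncR 18) ;; Prim (IncR 18) ;; add r 5 ;; add r 5 ;; eq 5 18 ;; clear 5 ;; clear 18"

section \<open>Correctness of the checks\<close>

context input
begin

definition E :: "nat \<Rightarrow> nat \<Rightarrow> nat \<Rightarrow> nat \<Rightarrow> bool" where
  "E F R i j \<longleftrightarrow> w ! ix F R i j"

definition row_deg :: "nat \<Rightarrow> nat \<Rightarrow> nat \<Rightarrow> nat \<Rightarrow> nat" where
  "row_deg F R i k = card {j. j < k \<and> E F R i j}"

lemma row_deg_simps [simp]: "row_deg F R i 0 = 0"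
  "row_deg F R i (Suc k) = row_deg F R i k + of_bool (E F R i k)"
proof -
  have "{j. j < Suc k \<and> E F R i j} = {j. j < k \<and> E F R i j} \<union> (if E F R i k then {k} else {})"
    by (auto simp: less_Suc_eq)
  then show "row_deg F R i (Suc k) = row_deg F R i k + of_bool (E F R i k)"
    by (simp add: row_deg_def)
qed (simp add: row_deg_def)

lemma row_deg_le: "row_deg F R i k \<le> k"
  by (induction k) auto

definition sym_row :: "nat \<Rightarrow> nat \<Rightarrow> nat \<Rightarrow> nat \<Rightarrow> bool" where
  "sym_row F R i k \<longleftrightarrow> (\<forall>j<k. E F R i j \<longrightarrow> E F R j i \<and> i \<noteq> j)"

lemma sym_row_simps [simp]: "sym_row F R i 0"
  "sym_row F R i (Suc k) \<longleftrightarrow> sym_row F R i k \<and> (E F R i k \<longrightarrow> E F R k i \<and> i \<noteq> k)"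
  by (auto simp: sym_row_def less_Suc_eq)

definition arcs :: "nat \<Rightarrow> nat \<Rightarrow> (nat \<times> nat) set" where
  "arcs F R = {(i, j). i < R \<and> j < R \<and> E F R i j}"

definition header_ok :: "nat \<Rightarrow> nat \<Rightarrow> bool" where
  "header_ok F R \<longleftrightarrow> (\<forall>i<R. w ! (F + i)) \<and> \<not> w ! (F + R)"

definition row_ok :: "nat \<Rightarrow> nat \<Rightarrow> nat \<Rightarrow> nat \<Rightarrow> bool" where
  "row_ok d F R i \<longleftrightarrow> sym_row F R i R \<and> row_deg F R i R \<le> d \<and> (i, 0) \<in> (arcs F R)\<^sup>*"

definition graph_ok :: "nat \<Rightarrow> nat \<Rightarrow> nat \<Rightarrow> bool" where
  "graph_ok d F R \<longleftrightarrow> header_ok F R \<and> (\<forall>i<R. row_ok d F R i) \<and> (\<Sum>i<R. row_deg F R i R) + 2 = 2 * R"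

lemma ix_less:
  assumes "F + R + 1 + R * R \<le> n" "i < R" "j < R"
  shows "ix F R i j < n"
proof -
  have "i * R + j < Suc i * R" using assms(3) by simp
  also have "\<dots> \<le> R * R" using assms(2) by (intro mult_right_mono) auto
  finally show ?thesis using assms(1) by (simp add: ix_def)
qed

lemma wp_header:
  assumes s: "std s" and r: "6 < f" "6 < r" "f \<notin> {15, 16}" "r \<notin> {15, 16}"
    and z: "s 15 = 0" "s 16 = 0" and R: "s f + s r + 1 \<le> n"
    and Q: "header_ok (s f) (s r) \<Longrightarrow> Q s" "\<not> header_ok (s f) (s r) \<Longrightarrow> m"
  shows "W m (header f r) Q s"
  unfolding header_def
proof (rule wp_seq, rule wp_for[where J = "\<lambda>k u. u = s(15 := k, 16 := s r - k) \<and> (\<forall>i<k. w ! (s f + i))"])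
  note d = stdD[OF s]
  fix k u assume k: "k < s r" and u: "u = s(15 := k, 16 := s r - k) \<and> (\<forall>i<k. w ! (s f + i))"
  let ?t = "s(15 := k, 16 := s r - Suc k)"
  have lt: "s r < 2 ^ s 1" using fitsD[OF d(1)] r by simp
  have t: "std ?t" using s k lt by (auto intro!: std_upd)
  have ut: "u(16 := s r - Suc k) = ?t" using u by (auto simp: fun_eq_iff)
  show "W m (bitat True f 15) (\<lambda>v. v 16 = s r - Suc k \<and> v 15 = k \<and> v 1 = s 1 \<and>
      v(15 := Suc k) = s(15 := Suc k, 16 := s r - Suc k) \<and> (\<forall>i<Suc k. w ! (s f + i))) (u(16 := s r - Suc k))"
    unfolding ut
    by (rule wp_bitat[OF t])
       (use r u k Q(2) R in \<open>auto simp: fun_eq_iff less_Suc_eq header_ok_def\<close>)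
next
  fix u assume u: "u = s(15 := s r, 16 := s r - s r) \<and> (\<forall>i<s r. w ! (s f + i))"
  then have "u(15 := 0) = s" using z by (auto simp: fun_eq_iff)
  then show "W m (bitat False f r) Q (u(15 := 0))"
    using s r Q R u by (auto intro!: wp_bitat simp: header_ok_def)
qed (use s r z stdD[OF s] in \<open>auto simp: fun_eq_iff\<close>)

lemma wp_row:
  assumes s: "std s" and r: "6 < f" "6 < r" "f \<notin> {15, 16, 17, 18}" "r \<notin> {15, 16, 17, 18}"
    and z: "s 15 = 0" "s 16 = 0" "s 17 = 0" "s 13 < s r" and D: "s 23 = Suc d"
    and R: "s f + s r + 1 + s r * s r \<le> n"
    and b: "\<not> m \<Longrightarrow> s 18 + row_deg (s f) (s r) (s 13) (s r) < 2 ^ s 1"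
    and Q: "sym_row (s f) (s r) (s 13) (s r) \<Longrightarrow> row_deg (s f) (s r) (s 13) (s r) \<le> d \<Longrightarrow>
       s 18 + row_deg (s f) (s r) (s 13) (s r) < 2 ^ s 1 \<Longrightarrow>
       Q (s(18 := s 18 + row_deg (s f) (s r) (s 13) (s r)))"
      "\<not> (sym_row (s f) (s r) (s 13) (s r) \<and> row_deg (s f) (s r) (s 13) (s r) \<le> d) \<Longrightarrow> m"
  shows "W m (row f r) Q s"
proof -
  define F R i where "F = s f" and "R = s r" and "i = s 13"
  note defs = F_def[symmetric] R_def[symmetric] i_def[symmetric]
  note d = stdD[OF s]
  have lt: "R < 2 ^ s 1" using fitsD[OF d(1)] r by (simp add: R_def)
  have dlt: "row_deg F R i k < 2 ^ s 1" if "k \<le> R" for k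
    using row_deg_le[of F R i k] lt that by linarith
  have mono: "row_deg F R i k \<le> row_deg F R i R" if "k \<le> R" for k
    unfolding row_deg_def by (rule card_mono) (use that in auto)
  let ?J = "\<lambda>k u. u = s(15 := k, 16 := R - k, 17 := row_deg F R i k, 18 := s 18 + row_deg F R i k) \<and>
      sym_row F R i k \<and> s 18 + row_deg F R i k < 2 ^ s 1"
  show ?thesis
    unfolding row_def
  proof (rule wp_seq, rule wp_for[where J = ?J])
    show "?J 0 (s(15 := 0, 16 := s r))"
      using z fitsD[OF d(1), of 18] by (auto simp: fun_eq_iff R_def)
  next
    fix k u assume k: "k < s r" and u: "?J k u"
    let ?x = "row_deg F R i k"
    let ?t = "s(15 := k, 16 := R - Suc k, 17 := ?x, 18 := s 18 + ?x)"
    have kR: "k < R" using k by (simp add: R_def)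
    have t: "std ?t" using s kR lt dlt[of k] u by (auto intro!: std_upd)
    have ut: "u(16 := s r - Suc k) = ?t" using u by (auto simp: fun_eq_iff R_def)
    let ?Q = "\<lambda>v. v 16 = s r - Suc k \<and> v 15 = k \<and> v 1 = s 1 \<and> ?J (Suc k) (v(15 := Suc k))"
    have iR: "i < R" using z by (simp add: i_def R_def)
    have ixs: "ix F R i k < n" "ix F R k i < n"
      using ix_less[of F R] R kR iR by (auto simp: F_def R_def)
    have st: "?t f = F" "?t r = R" "?t 13 = i" "?t 15 = k" using r by (auto simp: F_def R_def i_def)
    have 1: "W m (adj True f r 13 15 ;; adj True f r 15 13 ;; neq 13 15 ;; Prim (IncR 17) ;; Prim (IncR 18)) ?Q ?t"
      if c: "m \<or> E F R i k"
    proof -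
      have sy: "\<not> m \<Longrightarrow> E F R k i \<and> i \<noteq> k" using Q(2) c kR unfolding defs sym_row_def by blast
      have bb: "\<not> m \<Longrightarrow> Suc (s 18 + ?x) < 2 ^ s 1"
        using b c mono[of "Suc k"] kR unfolding defs by force
      have f1: "W m (Prim (IncR 18)) ?Q (?t(17 := Suc ?x))"
        if e: "E F R i k" "E F R k i" "i \<noteq> k"
        by (rule wp_inc) (use bb e u in \<open>auto simp: fun_eq_iff R_def\<close>)
      have f2: "W m (Prim (IncR 17) ;; Prim (IncR 18)) ?Q ?t"
        if e: "E F R i k" "E F R k i" "i \<noteq> k"
      proof (rule wp_seq, rule wp_inc)
        have "?t(17 := Suc (?t 17)) = ?t(17 := Suc ?x)" by simp
        then show "W m (Prim (IncR 18)) ?Q (?t(17 := Suc (?t 17)))" using f1[OF e] by metis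
      qed (use dlt[of "Suc k"] kR e in auto)
      have f3: "W m (neq 13 15 ;; Prim (IncR 17) ;; Prim (IncR 18)) ?Q ?t"
        if e: "E F R i k" "E F R k i"
      proof (rule wp_seq, rule wp_neq)
        assume "?t 13 \<noteq> ?t 15"
        then show "W m (Prim (IncR 17) ;; Prim (IncR 18)) ?Q ?t" using f2 e by (simp add: i_def)
      qed (use stdD[OF t] sy in \<open>auto simp: i_def\<close>)
      have f4: "W m (adj True f r 15 13 ;; neq 13 15 ;; Prim (IncR 17) ;; Prim (IncR 18)) ?Q ?t"
        if e: "E F R i k"
      proof (rule wp_seq, rule wp_adj[OF t], unfold st)
        assume "w ! ix F R k i = True"
        then show "W m (neq 13 15 ;; Prim (IncR 17) ;; Prim (IncR 18)) ?Q ?t" using f3 e by (simp add: E_def)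
      qed (use r sy ixs in \<open>auto simp: E_def\<close>)
      show ?thesis
      proof (rule wp_seq, rule wp_adj[OF t], unfold st)
        assume "w ! ix F R i k = True"
        then show "W m (adj True f r 15 13 ;; neq 13 15 ;; Prim (IncR 17) ;; Prim (IncR 18)) ?Q ?t"
          using f4 by (simp add: E_def)
      qed (use r c ixs in \<open>auto simp: E_def\<close>)
    qed
    have 2: "W m (adj False f r 13 15) ?Q ?t" if c: "m \<or> \<not> E F R i k"
      by (rule wp_adj[OF t]) (use r st c ixs u in \<open>auto simp: E_def fun_eq_iff R_def F_def i_def\<close>)
    show "W m ((adj True f r 13 15 ;; adj True f r 15 13 ;; neq 13 15 ;; Prim (IncR 17) ;; Prim (IncR 18))
      [+] adj False f r 13 15) ?Q (u(16 := s r - Suc k))"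
      unfolding ut using 1 2 by (cases m; cases "E F R i k") (auto intro: wp_choice)
  next
    fix u assume u: "?J (s r) u"
    let ?x = "row_deg F R i R"
    let ?t = "s(17 := ?x, 18 := s 18 + ?x)"
    have ut: "u(15 := 0) = ?t" using u z by (auto simp: fun_eq_iff R_def)
    have t: "std ?t" using s dlt[of R] u by (auto intro!: std_upd simp: R_def)
    have res: "?t(17 := 0) = s(18 := s 18 + ?x)" using z by (auto simp: fun_eq_iff)
    show "W m (lt 17 23 ;; clear 17) Q (u(15 := 0))"
      unfolding ut
    proof (rule wp_seq, rule wp_lt)
      assume "?t 17 < ?t 23"
      then have "Q (s(18 := s 18 + ?x))"
        using Q(1) u D by (auto simp: F_def R_def i_def)
      then show "W m (clear 17) Q ?t"
        by (intro wp_clear) (simp only: res)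
    qed (use stdD[OF t] Q u D in \<open>auto simp: F_def R_def i_def\<close>)
  qed (use s r z d in auto)
qed

lemma finite_arcs: "finite (arcs F R)" "card (arcs F R) \<le> R * R"
proof -
  have sub: "arcs F R \<subseteq> {..<R} \<times> {..<R}" by (auto simp: arcs_def)
  then show "finite (arcs F R)" by (rule finite_subset) simp
  show "card (arcs F R) \<le> R * R" using card_mono[OF _ sub] by simp
qed

text \<open>In a finite relation, whatever can be reached at all is reached within as many steps as
  there are pairs, here at most \<open>R * R \<le> n\<close>.\<close>

lemma wp_to_root:
  assumes s: "std s" and r: "6 < f" "6 < r" "f \<notin> {19, 20, 21}" "r \<notin> {19, 20, 21}"
    and z: "s 19 = 0" "s 20 = 0" "s 21 = 0" "s 13 < s r"
    and R: "s f + s r + 1 + s r * s r \<le> n"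
    and Q: "(s 13, 0) \<in> (arcs (s f) (s r))\<^sup>* \<Longrightarrow> Q s" "\<not> (s 13, 0) \<in> (arcs (s f) (s r))\<^sup>* \<Longrightarrow> m"
  shows "W m (to_root f r) Q s"
proof -
  define F R i where "F = s f" and "R = s r" and "i = s 13"
  note d = stdD[OF s]
  have lt: "R < 2 ^ s 1" using fitsD[OF d(1)] r by (simp add: R_def)
  have iR: "i < R" using z by (simp add: i_def R_def)
  let ?A = "arcs F R"
  let ?c = "guess 20 r ;; lt 20 r ;; adj True f r 19 20 ;; copy 20 19 ;; clear 20"
  \<comment> \<open>The invariant looks back in mode True, to where the walk came from, and ahead in
    mode False, to whether node 0 is within reach of the rounds left.\<close>
  define P where "P k x \<longleftrightarrow> (if m then (i, x) \<in> ?A\<^sup>* else \<exists>j\<le>k. (x, 0) \<in> ?A ^^ j)" for k x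
  let ?I = "\<lambda>k u. k \<le> Suc n \<and> (\<exists>x<R. u = s(19 := x, 21 := k) \<and> P k x)"
  have P0: "P (Suc n) i"
  proof (cases m)
    case False
    then have "(i, 0) \<in> ?A\<^sup>*" using Q(2) by (auto simp: i_def F_def R_def)
    then obtain j where "j \<le> card ?A" "(i, 0) \<in> ?A ^^ j"
      using rtrancl_finite_eq_relpow[OF finite_arcs(1)] by auto
    moreover have "card ?A \<le> n" using finite_arcs(2)[of F R] R by (simp add: F_def R_def)
    ultimately show ?thesis using False by (auto simp: P_def intro!: exI[of _ j])
  qed (simp add: P_def)
  have step: "W m ?c (\<lambda>u. u 21 = k \<and> ?I k u) (s(19 := x, 21 := k))"
    if k: "Suc k \<le> Suc n" and x: "x < R" and y: "m \<or> (\<exists>y. (x, y) \<in> ?A \<and> P k y)"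
      and mm: "m \<Longrightarrow> (i, x) \<in> ?A\<^sup>*" for k x
  proof -
    let ?t = "s(19 := x, 21 := k)"
    have t: "std ?t" using s x lt k std_n[OF s] by (auto intro!: std_upd)
    have st: "?t f = F" "?t r = R" using r by (auto simp: F_def R_def)
    have rest: "W m (lt 20 r ;; adj True f r 19 20 ;; copy 20 19 ;; clear 20) (\<lambda>u. u 21 = k \<and> ?I k u) (?t(20 := y))"
      if "y \<le> R" "m \<or> (x, y) \<in> ?A \<and> P k y" for y
    proof -
      let ?u = "?t(20 := y)"
      have u: "std ?u" using t that lt by (auto intro!: std_upd)
      have su: "?u f = F" "?u r = R" "?u 19 = x" "?u 20 = y" using r by (auto simp: F_def R_def)
      have fin: "W m (copy 20 19 ;; clear 20) (\<lambda>u. u 21 = k \<and> ?I k u) ?u" if "y < R" "E F R x y"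
      proof -
        have "(x, y) \<in> ?A" using that x by (simp add: arcs_def)
        then have "P k y" using \<open>m \<or> (x, y) \<in> ?A \<and> P k y\<close> mm by (auto simp: P_def)
        moreover have "?u(19 := y, 20 := 0) = s(19 := y, 21 := k)" using z by (auto simp: fun_eq_iff)
        ultimately have "W m (clear 20) (\<lambda>u. u 21 = k \<and> ?I k u) (?u(19 := ?u 20))"
          using that(1) k by (intro wp_clear) auto
        then show ?thesis
          by (intro wp_seq wp_copy) (use stdD[OF u] in auto)
      qed
      show ?thesis
      proof (rule wp_seq, rule wp_lt)
        assume "?u 20 < ?u r"
        then have yR: "y < R" using su by simp
        then have ixy: "ix F R x y < n" using ix_less[of F R x y] R x by (simp add: F_def R_def)
        show "W m (adj True f r 19 20 ;; copy 20 19 ;; clear 20) (\<lambda>u. u 21 = k \<and> ?I k u) ?u"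
        proof (rule wp_seq, rule wp_adj[OF u], unfold su)
          assume "w ! ix F R x y = True"
          then show "W m (copy 20 19 ;; clear 20) (\<lambda>u. u 21 = k \<and> ?I k u) ?u"
            using fin[OF yR] by (simp add: E_def)
        qed (use r yR that ixy in \<open>auto simp: E_def arcs_def\<close>)
      qed (use stdD[OF u] su r that in \<open>auto simp: arcs_def\<close>)
    qed
    show ?thesis
    proof (rule wp_seq, rule wp_guess)
      let ?R = "W m (lt 20 r ;; adj True f r 19 20 ;; copy 20 19 ;; clear 20) (\<lambda>u. u 21 = k \<and> ?I k u)"
      show "if m then \<forall>e\<le>?t r. ?R (?t(20 := e)) else \<exists>e\<le>?t r. ?R (?t(20 := e))"
      proof (cases m)
        case True
        then show ?thesis unfolding st using rest by simp
      next
        case False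
        then obtain y where "(x, y) \<in> ?A" "P k y" using y by blast
        moreover from this have "y \<le> R" by (simp add: arcs_def)
        ultimately show ?thesis unfolding st using rest[of y] False by auto
      qed
    qed (use stdD[OF t] r in auto)
  qed
  have loop: "W m (Loop 21 (?c [+] Prim Nop) ;; Prim (ZeroR 19)) Q (s(19 := i, 21 := Suc n))"
  proof (rule wp_seq, rule wp_loop[where I = ?I])
    show "?I ((s(19 := i, 21 := Suc n)) 21) (s(19 := i, 21 := Suc n))"
      using iR P0 by auto
  next
    fix k u assume "?I (Suc k) u"
    then obtain x where x: "Suc k \<le> Suc n" "x < R" "u(21 := k) = s(19 := x, 21 := k)" "P (Suc k) x"
      by (auto simp: fun_eq_iff)
    have nop: "W m (Prim Nop) (\<lambda>u. u 21 = k \<and> ?I k u) (s(19 := x, 21 := k))" if "P k x"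
      by (rule wp_nop) (use x that in auto)
    show "W m (?c [+] Prim Nop) (\<lambda>u. u 21 = k \<and> ?I k u) (u(21 := k))"
      unfolding x(3)
    proof (cases m)
      case True
      then show "W m (?c [+] Prim Nop) (\<lambda>u. u 21 = k \<and> ?I k u) (s(19 := x, 21 := k))"
        by (intro wp_choice(1) step nop) (use x in \<open>auto simp: P_def\<close>)
    next
      case False
      then obtain j where j: "j \<le> Suc k" "(x, 0) \<in> ?A ^^ j" using x by (auto simp: P_def)
      show "W m (?c [+] Prim Nop) (\<lambda>u. u 21 = k \<and> ?I k u) (s(19 := x, 21 := k))"
      proof (cases j)
        case 0
        then have "P k x" using j False by (auto simp: P_def intro!: exI[of _ 0])
        then show ?thesis using False nop by (intro wp_choice(3)) auto
      next
        case (Suc j')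
        then obtain y where "(x, y) \<in> ?A" "(y, 0) \<in> ?A ^^ j'" using j relpow_Suc_D2 by metis
        then have "\<exists>y. (x, y) \<in> ?A \<and> P k y" using False j Suc by (auto simp: P_def)
        then show ?thesis using False x by (intro wp_choice(2) step) auto
      qed
    qed
  next
    fix u assume "?I 0 u" "u 21 = 0"
    then obtain x where x: "x < R" "u = s(19 := x)" "P 0 x" using z by (auto simp: fun_eq_iff)
    have res: "s(19 := 0) = s" using z by (auto simp: fun_eq_iff)
    show "W m (Prim (ZeroR 19)) Q u"
      by (rule wp_zero) (use x res Q in \<open>auto simp: P_def i_def F_def R_def split: if_splits\<close>)
  qed
  have f1: "fits (s(19 := i))" using d(1) lt iR by (auto intro!: fits_upd)
  have 1: "W m (copy 7 21 ;; Loop 21 (?c [+] Prim Nop) ;; Prim (ZeroR 19)) Q (s(19 := i))"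
  proof (rule wp_seq, rule wp_copy)
    show "W m (Loop 21 (?c [+] Prim Nop) ;; Prim (ZeroR 19)) Q ((s(19 := i))(21 := (s(19 := i)) 7))"
      using loop d by simp
  qed (use d r f1 in auto)
  show ?thesis
    unfolding to_root_def
    by (rule wp_seq, rule wp_copy) (use d r 1 in \<open>auto simp: i_def\<close>)
qed

lemma wp_graph_check:
  assumes s: "std s" and r: "6 < f" "6 < r" "f \<notin> {13..21}" "r \<notin> {13..21}"
    and z: "\<forall>j\<in>{13..21}. s j = 0" and D: "s 23 = Suc d"
    and R: "s f + s r + 1 + s r * s r \<le> n"
    and Q: "graph_ok d (s f) (s r) \<Longrightarrow> Q s" "\<not> graph_ok d (s f) (s r) \<Longrightarrow> m"
  shows "W m (graph_check f r) Q s"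
proof -
  define F R where "F = s f" and "R = s r"
  note d = stdD[OF s]
  have z': "s 13 = 0" "s 14 = 0" "s 15 = 0" "s 16 = 0" "s 17 = 0" "s 18 = 0" "s 19 = 0" "s 20 = 0" "s 21 = 0"
    using z by auto
  have r': "f \<noteq> 13" "f \<noteq> 14" "f \<noteq> 15" "f \<noteq> 16" "f \<noteq> 17" "f \<noteq> 18" "f \<noteq> 19" "f \<noteq> 20" "f \<noteq> 21"
     "r \<noteq> 13" "r \<noteq> 14" "r \<noteq> 15" "r \<noteq> 16" "r \<noteq> 17" "r \<noteq> 18" "r \<noteq> 19" "r \<noteq> 20" "r \<noteq> 21"
    using r(3,4) by auto
  have lt: "R < 2 ^ s 1" using fitsD[OF d(1)] r by (simp add: R_def)
  \<comment> \<open>Twice the number of nodes has to fit into a register; it does because the matrix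
    alone has \<open>R * R\<close> bits and is preceded by at least one more.\<close>
  have "2 * R \<le> R * R + 1"
  proof (cases R)
    case (Suc k) then show ?thesis by (cases k) auto
  qed simp
  then have R2: "2 * R < 2 ^ s 1" using R std_n[OF s] by (simp add: R_def)
  let ?T = "\<lambda>k. \<Sum>i<k. row_deg F R i R"
  have ok: "graph_ok d F R" if "\<not> m" using Q(2) that by (auto simp: F_def R_def)
  have T2: "?T R + 2 = 2 * R" if "\<not> m" using ok[OF that] by (simp add: graph_ok_def)
  have mono: "?T k \<le> ?T R" if "k \<le> R" for k
    by (rule sum_mono2) (use that in auto)
  let ?J = "\<lambda>k u. u = s(13 := k, 14 := R - k, 18 := ?T k) \<and> (\<forall>i<k. row_ok d F R i) \<and> ?T k < 2 ^ s 1"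
  let ?c6 = "clear 5 ;; clear 18" let ?c5 = "eq 5 18 ;; ?c6" let ?c4 = "add r 5 ;; ?c5"
  let ?c3 = "add r 5 ;; ?c4" let ?c2 = "Prim (IncR 18) ;; ?c3" let ?c1 = "Prim (IncR 18) ;; ?c2"
  have tail: "W m ?c1 Q (s(18 := ?T R))"
    if T: "?T R < 2 ^ s 1" and rows: "\<forall>i<R. row_ok d F R i" "header_ok F R"
  proof -
    let ?x = "?T R + 2"
    have b: "\<not> m \<Longrightarrow> ?x < 2 ^ s 1" using T2 R2 by simp
    have f: "fits (s(18 := y, 5 := y'))" if "y < 2 ^ s 1" "y' < 2 ^ s 1" for y y'
      using d(1) that by (auto intro!: fits_upd)
    have 5: "W m ?c5 Q (s(18 := ?x, 5 := R + R))" if a: "?x < 2 ^ s 1"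
    proof (rule wp_seq, rule wp_eq)
      assume "(s(18 := ?x, 5 := R + R)) 5 = (s(18 := ?x, 5 := R + R)) 18"
      then have "graph_ok d F R" using rows by (simp add: graph_ok_def)
      moreover have "s(18 := ?x, 5 := R + R, 5 := 0, 18 := 0) = s" using d z' by (auto simp: fun_eq_iff)
      ultimately show "W m ?c6 Q (s(18 := ?x, 5 := R + R))"
        using Q(1) by (intro wp_seq wp_clear) (simp add: F_def R_def)
    qed (use f[OF a, of "R + R"] R2 d T2 in auto)
    have 4: "W m ?c4 Q (s(18 := ?x, 5 := R))" if a: "?x < 2 ^ s 1"
    proof (rule wp_seq, rule wp_add)
      let ?t = "s(18 := ?x, 5 := R)"
      have "?t(5 := ?t 5 + ?t r) = s(18 := ?x, 5 := R + R)" using r r' by (simp add: R_def)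
      then show "W m ?c5 Q (?t(5 := ?t 5 + ?t r))" using 5[OF a] by (simp only:)
    qed (use f[OF a lt] R2 d r r' in \<open>auto simp: R_def\<close>)
    have 3: "W m ?c3 Q (s(18 := ?x))" if a: "?x < 2 ^ s 1"
    proof (rule wp_seq, rule wp_add)
      let ?t = "s(18 := ?x)"
      have "?t(5 := ?t 5 + ?t r) = s(18 := ?x, 5 := R)" using r r' d by (simp add: R_def)
      then show "W m ?c4 Q (?t(5 := ?t 5 + ?t r))" using 4[OF a] by (simp only:)
      show "fits ?t" using d(1) a by (intro fits_upd) auto
    qed (use lt d r r' in \<open>auto simp: R_def\<close>)
    have 2: "W m ?c2 Q (s(18 := ?T R + 1))"
    proof (rule wp_seq, rule wp_inc)
      let ?t = "s(18 := ?T R + 1)"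
      assume a: "Suc (?t 18) < 2 ^ ?t 1"
      have "?t(18 := Suc (?t 18)) = s(18 := ?x)" by simp
      then show "W m ?c3 Q (?t(18 := Suc (?t 18)))" using 3 a by (simp only:) simp
    qed (use b in auto)
    show ?thesis
    proof (rule wp_seq, rule wp_inc)
      let ?t = "s(18 := ?T R)"
      have "?t(18 := Suc (?t 18)) = s(18 := ?T R + 1)" by simp
      then show "W m ?c2 Q (?t(18 := Suc (?t 18)))" using 2 by (simp only:)
    qed (use b in auto)
  qed
  have loop: "W m (foreach 13 r 14 (row f r ;; to_root f r) ;; ?c1) Q s" if h: "header_ok F R"
  proof (rule wp_seq, rule wp_for[where J = ?J])
    show "?J 0 (s(13 := 0, 14 := s r))" using z' by (auto simp: fun_eq_iff R_def)
  next
    fix k u assume k: "k < s r" and u: "?J k u"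
    let ?Q = "\<lambda>v. v 14 = s r - Suc k \<and> v 13 = k \<and> v 1 = s 1 \<and> ?J (Suc k) (v(13 := Suc k))"
    let ?t = "s(13 := k, 14 := R - Suc k, 18 := ?T k)"
    have kR: "k < R" using k by (simp add: R_def)
    have ut: "u(14 := s r - Suc k) = ?t" using u by (auto simp: fun_eq_iff R_def)
    have t: "std ?t" using s kR lt u by (auto intro!: std_upd)
    have st: "?t f = F" "?t r = R" "?t 13 = k" using r' by (auto simp: F_def R_def)
    show "W m (row f r ;; to_root f r) ?Q (u(14 := s r - Suc k))"
      unfolding ut
    proof (rule wp_seq, rule wp_row[OF t, where d = d], unfold st)
      have "?T (Suc k) < 2 ^ s 1" if "\<not> m" using mono[of "Suc k"] T2[OF that] R2 kR by linarith
      then show "?t 18 + row_deg F R k R < 2 ^ ?t 1" if "\<not> m" using that by simp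
    next
      assume a: "sym_row F R k R" "row_deg F R k R \<le> d" "?t 18 + row_deg F R k R < 2 ^ ?t 1"
      let ?v = "?t(18 := ?t 18 + row_deg F R k R)"
      have v: "std ?v" by (rule std_upd[OF t]) (use a(3) in auto)
      have sv: "?v f = F" "?v r = R" "?v 13 = k" using r' by (auto simp: F_def R_def)
      show "W m (to_root f r) ?Q ?v"
      proof (rule wp_to_root[OF v])
        assume "(?v 13, 0) \<in> (arcs (?v f) (?v r))\<^sup>*"
        then have "row_ok d F R k" using a unfolding sv by (simp add: row_ok_def)
        then show "?Q ?v" using u a by (auto simp: fun_eq_iff R_def less_Suc_eq)
      next
        assume "(?v 13, 0) \<notin> (arcs (?v f) (?v r))\<^sup>*"
        then show m using ok kR unfolding sv by (auto simp: graph_ok_def row_ok_def)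
      qed (use r r' z' kR R in \<open>auto simp: F_def R_def\<close>)
    next
      assume "\<not> (sym_row F R k R \<and> row_deg F R k R \<le> d)"
      then show m using ok kR by (auto simp: graph_ok_def row_ok_def)
    qed (use r r' z' kR R D in \<open>auto simp: F_def R_def\<close>)
  next
    fix u assume u: "?J (s r) u"
    then have "u(13 := 0) = s(18 := ?T R)" using z' by (auto simp: fun_eq_iff R_def)
    then show "W m ?c1 Q (u(13 := 0))" using tail u h unfolding R_def[symmetric] by simp
  qed (use r r' z' d in auto)
  show ?thesis
    unfolding graph_check_def
  proof (rule wp_seq, rule wp_header[OF s])
    assume "header_ok (s f) (s r)"
    then show "W m (foreach 13 r 14 (row f r ;; to_root f r) ;; ?c1) Q s" using loop by (simp add: F_def R_def)
  next
    assume "\<not> header_ok (s f) (s r)"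
    then show m using ok by (auto simp: graph_ok_def F_def R_def)
  qed (use r r' z' R in auto)
qed

end

section \<open>Encodings and the graphs that they present\<close>

lemma nth_concat_map:
  assumes "u < m" "v < n"
  shows "concat (map (\<lambda>u. map (f u) [0..<n]) [0..<m]) ! (u * n + v) = f u v"
  using assms(1)
proof (induction m)
  case (Suc m)
  let ?c = "concat (map (\<lambda>u. map (f u) [0..<n]) [0..<m])"
  have len: "length ?c = m * n" by (induction m) auto
  show ?case
  proof (cases "u < m")
    case True
    have "u * n + v < Suc u * n" using assms(2) by simp
    also have "\<dots> \<le> m * n" using True by (intro mult_right_mono) auto
    finally show ?thesis using Suc.IH[OF True] len by (simp add: nth_append)
  next
    case False
    then have "u = m" using Suc.prems by simp
    then show ?thesis using len assms(2) by (simp add: nth_append)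
  qed
qed simp

lemma nth_encode:
  assumes "R = card (nodes T)"
  shows "i < R \<Longrightarrow> encode_graph T ! i" "\<not> encode_graph T ! R"
    "u < R \<Longrightarrow> v < R \<Longrightarrow> encode_graph T ! (R + 1 + u * R + v) \<longleftrightarrow> {u, v} \<in> edges T"
proof -
  let ?m = "concat (map (\<lambda>u. map (\<lambda>v. {u, v} \<in> edges T) [0..<R]) [0..<R])"
  have e: "encode_graph T = replicate R True @ False # ?m"
    by (simp add: encode_graph_def assms Let_def)
  show "i < R \<Longrightarrow> encode_graph T ! i" "\<not> encode_graph T ! R" by (simp_all add: e nth_append)
  assume uv: "u < R" "v < R"
  have "encode_graph T ! (R + 1 + u * R + v) = ?m ! (u * R + v)"
    by (simp add: e nth_append)
  also have "\<dots> \<longleftrightarrow> {u, v} \<in> edges T" by (rule nth_concat_map) (use uv in auto)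
  finally show "encode_graph T ! (R + 1 + u * R + v) \<longleftrightarrow> {u, v} \<in> edges T" .
qed

lemma encode_eqI:
  assumes R: "R = card (nodes T)" and len: "length xs = R * R + R + 1"
    and xs: "\<And>i. i < R \<Longrightarrow> xs ! i" "\<not> xs ! R"
      "\<And>u v. u < R \<Longrightarrow> v < R \<Longrightarrow> xs ! (R + 1 + u * R + v) \<longleftrightarrow> {u, v} \<in> edges T"
  shows "xs = encode_graph T"
proof (rule nth_equalityI)
  show "length xs = length (encode_graph T)"
    using len by (simp add: length_encode_graph R power2_eq_square)
  fix i assume i: "i < length xs"
  consider "i < R" | "i = R" | "i > R" by linarith
  then show "xs ! i = encode_graph T ! i"
  proof cases
    case 3
    define k where "k = i - (R + 1)"
    have k: "i = R + 1 + k" "k < R * R" using 3 i len by (auto simp: k_def)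
    then have "R > 0" by (cases R) auto
    then have "k div R < R" "k mod R < R" using k(2) by (auto simp: less_mult_imp_div_less)
    moreover have "i = R + 1 + (k div R) * R + k mod R" using k(1) by simp
    ultimately show ?thesis using xs(3) nth_encode(3)[OF R] by metis
  qed (use xs nth_encode[OF R] in auto)
qed

context input
begin

text \<open>Relates the matrix at offset \<open>F\<close> to an arbitrary graph, so that the same
  facts serve the graph read off a checked input and the tree that a given input encodes.\<close>

definition presents :: "nat \<Rightarrow> nat \<Rightarrow> nat ugraph \<Rightarrow> bool" where
  "presents F R T \<longleftrightarrow> nodes T = {..<R} \<and> (\<forall>e\<in>edges T. e \<subseteq> nodes T) \<and>
     (\<forall>i<R. \<forall>j<R. {i, j} \<in> edges T \<longleftrightarrow> E F R i j)"

lemma presents_row_deg: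
  assumes p: "presents F R T" and T: "simple_graph T" and i: "i < R"
  shows "row_deg F R i R = degree T i"
proof -
  have "bij_betw (\<lambda>j. {i, j}) {j. j < R \<and> E F R i j} {e \<in> edges T. i \<in> e}"
    unfolding bij_betw_def
  proof (intro conjI equalityI subsetI)
    show "inj_on (\<lambda>j. {i, j}) {j. j < R \<and> E F R i j}"
      by (rule inj_onI) (auto simp: doubleton_eq_iff)
  next
    fix e assume "e \<in> {e \<in> edges T. i \<in> e}"
    then have e: "e \<in> edges T" "i \<in> e" by auto
    then have "card e = 2" "e \<subseteq> {..<R}" using T p by (auto simp: simple_graph_def presents_def)
    then obtain j where "e = {i, j}" using e(2) by (auto simp: card_2_iff)
    then show "e \<in> (\<lambda>j. {i, j}) ` {j. j < R \<and> E F R i j}"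
      using e(1) p i \<open>e \<subseteq> {..<R}\<close> by (auto simp: presents_def)
  qed (use p i in \<open>auto simp: presents_def\<close>)
  then show ?thesis unfolding row_deg_def degree_def by (rule bij_betw_same_card)
qed

text \<open>The handshake lemma, by double counting.\<close>

lemma presents_sum_deg:
  assumes p: "presents F R T" and T: "simple_graph T"
  shows "(\<Sum>i<R. row_deg F R i R) = 2 * card (edges T)"
proof -
  have fin: "finite (edges T)"
    using T finite_subset[of "edges T" "Pow (nodes T)"] by (auto simp: simple_graph_def)
  have "(\<Sum>i<R. row_deg F R i R) = (\<Sum>i<R. card {e \<in> edges T. i \<in> e})"
    by (rule sum.cong) (auto simp: presents_row_deg[OF assms] degree_def)
  also have "\<dots> = 2 * card (edges T)"
  proof (rule sum_multicount)
    show "\<forall>e\<in>edges T. card {i \<in> {..<R}. i \<in> e} = 2"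
    proof
      fix e assume "e \<in> edges T"
      then have "card e = 2" "e \<subseteq> {..<R}" using T p by (auto simp: simple_graph_def presents_def)
      moreover from this have "{i \<in> {..<R}. i \<in> e} = e" by auto
      ultimately show "card {i \<in> {..<R}. i \<in> e} = 2" by simp
    qed
  qed (use fin in auto)
  finally show ?thesis .
qed

lemma walk_arcs:
  assumes p: "presents F R T"
  shows "walk T q \<Longrightarrow> (hd q, last q) \<in> (arcs F R)\<^sup>*"
proof (induction q)
  case (Cons a q)
  show ?case
  proof (cases q)
    case (Cons b q')
    then have "walk T q" "{a, b} \<in> edges T" "a < R" "b < R"
      using Cons.prems p by (auto simp: walk_def presents_def)
    then have "(a, b) \<in> arcs F R" "(hd q, last q) \<in> (arcs F R)\<^sup>*"
      using p Cons.IH by (auto simp: presents_def arcs_def)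
    then show ?thesis using Cons by (auto intro: converse_rtrancl_into_rtrancl)
  qed simp
qed (simp add: walk_def)

lemma arcs_walk:
  assumes p: "presents F R T"
  shows "(i, j) \<in> (arcs F R)\<^sup>* \<Longrightarrow> i < R \<Longrightarrow> \<exists>q. walk T q \<and> hd q = i \<and> last q = j"
proof (induction rule: rtrancl_induct)
  case base
  then show ?case using p by (intro exI[of _ "[i]"]) (auto simp: walk_def presents_def)
next
  case (step j k)
  then obtain q where q: "walk T q" "hd q = i" "last q = j" by blast
  have "j < R" "k < R" "{j, k} \<in> edges T" using step(2) p by (auto simp: arcs_def presents_def)
  then have "walk T (q @ [k])"
    using q p by (auto simp: walk_def presents_def successively_append_iff)
  then show ?case using q by (intro exI[of _ "q @ [k]"]) (auto simp: walk_def)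
qed

text \<open>Node 0 suffices as the only target, since the arcs are symmetric.\<close>

lemma presents_connected:
  assumes p: "presents F R T" and "0 < R"
  shows "connected_graph T \<longleftrightarrow> (\<forall>i<R. (i, 0) \<in> (arcs F R)\<^sup>*)"
proof
  assume c: "connected_graph T"
  show "\<forall>i<R. (i, 0) \<in> (arcs F R)\<^sup>*"
  proof (intro allI impI)
    fix i assume "i < R"
    then have "i \<in> nodes T" "0 \<in> nodes T" using p assms(2) by (auto simp: presents_def)
    then obtain q where "walk T q" "hd q = i" "last q = 0"
      using c unfolding connected_graph_def by blast
    then show "(i, 0) \<in> (arcs F R)\<^sup>*" using walk_arcs[OF p, of q] by simp
  qed
next
  assume a: "\<forall>i<R. (i, 0) \<in> (arcs F R)\<^sup>*"
  have "sym (arcs F R)"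
    using p by (auto simp: sym_def arcs_def presents_def) (metis insert_commute)
  then have "sym ((arcs F R)\<^sup>*)" by (rule sym_rtrancl)
  then have "(i, j) \<in> (arcs F R)\<^sup>*" if "i < R" "j < R" for i j
    using a that by (meson rtrancl_trans symD)
  then show "connected_graph T"
    using arcs_walk[OF p] p by (auto simp: connected_graph_def presents_def)
qed

text \<open>Apart from the header, the checks amount to degrees, connectedness and the number of
  edges, and for a connected graph the last is acyclicity. The empty graph fails on both sides: its
  degree sum plus 2 is not 0, and a tree has a node.\<close>

lemma graph_ok_presents:
  assumes p: "presents F R T" and T: "simple_graph T"
  shows "graph_ok d F R \<longleftrightarrow> header_ok F R \<and> tree_instance d T"
proof (cases "R = 0")
  case True
  then show ?thesis using p by (auto simp: graph_ok_def tree_instance_def is_tree_def presents_def)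
next
  case False
  have n: "nodes T = {..<R}" using p by (simp add: presents_def)
  have "sym_row F R i R" if "i < R" for i
  proof -
    have "{j} \<notin> edges T" for j using T by (auto simp: simple_graph_def)
    then show ?thesis using p that unfolding sym_row_def presents_def
      by (metis insert_absorb2 insert_commute)
  qed
  then have "(\<forall>i<R. row_ok d F R i) \<longleftrightarrow> max_degree_le d T \<and> connected_graph T"
    using presents_connected[OF p] presents_row_deg[OF assms] False n
    by (auto simp: row_ok_def max_degree_le_def)
  moreover have "(\<Sum>i<R. row_deg F R i R) + 2 = 2 * R \<longleftrightarrow> Suc (card (edges T)) = card (nodes T)"
    unfolding presents_sum_deg[OF assms] n by auto
  moreover have "nodes T \<noteq> {}" using n False by auto
  ultimately show ?thesis
    using acyclic_iff_card_edges[OF T] T n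
    by (auto simp: graph_ok_def tree_instance_def is_tree_def)
qed

definition graph_of :: "nat \<Rightarrow> nat \<Rightarrow> nat ugraph" where
  "graph_of F R = \<lparr>nodes = {..<R}, edges = {{i, j} | i j. (i, j) \<in> arcs F R}\<rparr>"

lemma graph_ok_imp:
  assumes "graph_ok d F R" "F + R + 1 + R * R \<le> n"
  shows "tree_instance d (graph_of F R)" "presents F R (graph_of F R)"
    "encode_graph (graph_of F R) = take (R * R + R + 1) (drop F w)"
proof -
  let ?T = "graph_of F R"
  have sy: "E F R j i \<and> i \<noteq> j" if "i < R" "j < R" "E F R i j" for i j
    using assms(1) that by (auto simp: graph_ok_def row_ok_def sym_row_def)
  have ed: "{i, j} \<in> edges ?T \<longleftrightarrow> i < R \<and> j < R \<and> E F R i j" for i j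
    using sy by (auto simp: graph_of_def arcs_def doubleton_eq_iff)
  show p: "presents F R ?T"
    unfolding presents_def ed by (auto simp: graph_of_def arcs_def)
  have "simple_graph ?T"
    unfolding simple_graph_def using sy by (auto simp: graph_of_def arcs_def)
  then show "tree_instance d ?T" using graph_ok_presents[OF p] assms(1) by blast
  have R: "R = card (nodes ?T)" by (simp add: graph_of_def)
  show "encode_graph ?T = take (R * R + R + 1) (drop F w)"
  proof (rule encode_eqI[OF R, symmetric])
    have le: "R + 1 + R * R \<le> n - F" using assms(2) by linarith
    then show "length (take (R * R + R + 1) (drop F w)) = R * R + R + 1" by simp
    have nth: "take (R * R + R + 1) (drop F w) ! i = w ! (F + i)" if "i < R * R + R + 1" for i
      using that le by (simp add: less_diff_conv)
    show "take (R * R + R + 1) (drop F w) ! i" if "i < R" for i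
      using nth[of i] that assms(1) by (auto simp: graph_ok_def header_ok_def)
    show "\<not> take (R * R + R + 1) (drop F w) ! R"
      using nth[of R] assms(1) by (auto simp: graph_ok_def header_ok_def)
    show "take (R * R + R + 1) (drop F w) ! (R + 1 + u * R + v) \<longleftrightarrow> {u, v} \<in> edges ?T"
      if "u < R" "v < R" for u v
    proof -
      have "u * R + v < Suc u * R" using that by simp
      also have "\<dots> \<le> R * R" using that by (intro mult_right_mono) auto
      finally have "R + 1 + u * R + v < R * R + R + 1" by simp
      from nth[OF this] show ?thesis using ed that by (simp add: E_def ix_def add.assoc)
    qed
  qed
qed

lemma encode_imp_graph_ok:
  assumes T: "tree_instance d T" and w: "w = pre @ encode_graph T @ post" and "length pre = F"
    and R: "R = card (nodes T)"
  shows "graph_ok d F R" "presents F R T"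
proof -
  have nth: "w ! (F + i) = encode_graph T ! i" if "i < R * R + R + 1" for i
    using that assms by (simp add: nth_append length_encode_graph power2_eq_square)
  have n: "nodes T = {..<R}" using T R by (simp add: tree_instance_def)
  have "E F R u v \<longleftrightarrow> {u, v} \<in> edges T" if "u < R" "v < R" for u v
  proof -
    have "u * R + v < Suc u * R" using that by simp
    also have "\<dots> \<le> R * R" using that by (intro mult_right_mono) auto
    finally have "R + 1 + u * R + v < R * R + R + 1" by simp
    from nth[OF this] show ?thesis using nth_encode(3)[OF R that] by (simp add: E_def ix_def add.assoc)
  qed
  moreover have sg: "simple_graph T" using T by (simp add: tree_instance_def is_tree_def)
  ultimately show p: "presents F R T"
    using n by (auto simp: presents_def simple_graph_def)
  have "header_ok F R" using nth nth_encode(1,2)[OF R] by (simp add: header_ok_def)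
  then show "graph_ok d F R" using graph_ok_presents[OF p sg] T by simp
qed

end

section \<open>Searching for an embedding\<close>

text \<open>
  Registers 9 to 12 hold the offset and the size of the two encodings. Register 24 is the stack,
  26 to 29 are the components of the current task, 30 counts the children pushed so far, 31 and 32
  are a guessed child and its image, and 40 is the number of tasks that may still be processed.
  The children pushed so far are the topmost tasks of the stack, which \<open>fresh\<close> inspects on a copy.
\<close>

definition pop4 :: "nat \<Rightarrow> nat \<Rightarrow> nat \<Rightarrow> nat \<Rightarrow> nat \<Rightarrow> com" where
  "pop4 S v p x y = pop S v ;; pop S p ;; pop S x ;; pop S y"

definition push4 :: "nat \<Rightarrow> nat \<Rightarrow> nat \<Rightarrow> nat \<Rightarrow> nat \<Rightarrow> com" where
  "push4 S v p x y = push S y ;; push S x ;; push S p ;; push S v"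

definition fresh :: com where
  "fresh = copy 24 25 ;; copy 30 39 ;; Loop 39 (pop4 25 33 34 35 36 ;; neq 31 33 ;; neq 32 35)"

definition add_child :: com where
  "add_child = guess 31 10 ;; lt 31 10 ;; guess 32 12 ;; lt 32 12 ;; adj True 9 10 26 31 ;; neq 31 27 ;;
     adj True 11 12 28 32 ;; neq 32 29 ;; fresh ;; push4 24 31 26 32 28 ;; Prim (IncR 30)"

text \<open>The children on the stack are already known to be distinct children of \<open>v\<close>,
  so counting shows that none is missing: each node is guessed to be no neighbour, the parent or a
  child, and register 30 has to come out as 0.\<close>

definition cover :: com where
  "cover = foreach 13 10 14 (adj False 9 10 26 13 [+] eq 13 27 [+]
     (adj True 9 10 26 13 ;; neq 13 27 ;; Prim (DecR 30))) ;; Prim (ZeroR 30)"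

text \<open>How many children there are is guessed as well: a round of the loop pushes one or
  passes. Register 23 gives \<open>d + 1\<close> rounds, enough for a node of degree at most
  \<open>d\<close>.\<close>

definition expand :: com where
  "expand = pop4 24 26 27 28 29 ;; copy 23 38 ;; Loop 38 (add_child [+] Prim Nop) ;; cover"

primrec flat :: "(nat \<times> nat \<times> nat \<times> nat) list \<Rightarrow> nat list" where
  "flat [] = []"
| "flat (t # l) = (case t of (v, p, x, y) \<Rightarrow> v # p # x # y # flat l)"

lemma length_flat [simp]: "length (flat l) = 4 * length l"
  by (induction l) auto

definition eqx :: "nat set \<Rightarrow> (nat \<Rightarrow> nat) \<Rightarrow> (nat \<Rightarrow> nat) \<Rightarrow> bool" where
  "eqx X s t \<longleftrightarrow> (\<forall>r. r \<notin> X \<longrightarrow> t r = s r)"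

lemma eqx_trans: "eqx X s u \<Longrightarrow> eqx Y u t \<Longrightarrow> X \<subseteq> Z \<Longrightarrow> Y \<subseteq> Z \<Longrightarrow> eqx Z s t"
  unfolding eqx_def subset_iff by metis

section \<open>Stacks of tasks\<close>

locale search = input w B for w B +
  fixes A T :: "nat ugraph" and a b F d :: nat
  assumes pA: "presents 0 a A" and pT: "presents F b T"
    and tA: "is_tree A" and tT: "is_tree T" and deg: "max_degree_le d A"
    and F: "F = a * a + a + 1" and nw: "n = F + b * b + b + 1"
begin

lemma bounds: "a < n" "b < n" "0 < n" "0 + a + 1 + a * a \<le> n" "F + b + 1 + b * b \<le> n"
  using F nw by auto

lemma edgeA: "i < a \<Longrightarrow> j < a \<Longrightarrow> w ! ix 0 a i j \<longleftrightarrow> {i, j} \<in> edges A"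
  using pA by (simp add: presents_def E_def)

lemma edgeT: "i < b \<Longrightarrow> j < b \<Longrightarrow> w ! ix F b i j \<longleftrightarrow> {i, j} \<in> edges T"
  using pT by (simp add: presents_def E_def)

lemma ch_less: "c \<in> ch A v p \<Longrightarrow> c < a" "z \<in> ch T x y \<Longrightarrow> z < b"
  using pA pT by (auto simp: ch_def presents_def)

abbreviation code where "code l \<equiv> enc (Suc n) (flat l)"

definition tasks :: "(nat \<times> nat \<times> nat \<times> nat) list \<Rightarrow> bool" where
  "tasks l \<longleftrightarrow> (\<forall>(v, p, x, y) \<in> set l. v < a \<and> p < a \<and> x < b \<and> y < b)"

lemma tasks_simps [simp]: "tasks []" "tasks ((v, p, x, y) # l) \<longleftrightarrow> v < a \<and> p < a \<and> x < b \<and> y < b \<and> tasks l"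
  "tasks (l @ l') \<longleftrightarrow> tasks l \<and> tasks l'"
  by (simp_all add: tasks_def ball_Un)

lemma tasks_flat: "tasks l \<Longrightarrow> \<forall>e\<in>set (flat l). e < Suc n"
  using bounds(1,2) by (induction l) auto

text \<open>Whatever lies at the bottom of a stack that fits into a register fits as well, so only
  the highest stack of each phase has to be bounded.\<close>

lemma code_append_mono: "code l \<le> code (l' @ l)"
proof (induction l')
  case (Cons t l')
  have "x \<le> (((x * Suc n + e1) * Suc n + e2) * Suc n + e3) * Suc n + e4" for x e1 e2 e3 e4
    by (induction x) auto
  then have "code (l' @ l) \<le> code ((t # l') @ l)" by (cases t) (simp del: mult_Suc_right)
  then show ?case using Cons by simp
qed simp

lemma wp_pop4:
  assumes s: "std s" "s 37 = 0" and l: "s S = code l" "tasks l"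
    and r: "7 < S" "7 < rv" "7 < rp" "7 < rx" "7 < ry" "distinct [S, rv, rp, rx, ry, 37]"
    and Q: "case l of [] \<Rightarrow> m | (v, p, x, y) # l' \<Rightarrow> Q (s(S := code l', rv := v, rp := p, rx := x, ry := y))"
  shows "W m (pop4 S rv rp rx ry) Q s"
proof (cases l)
  case Nil
  show ?thesis unfolding pop4_def
    by (rule wp_seq, rule wp_pop[where l = "[]"]) (use s l r Q Nil bounds in auto)
next
  case (Cons t l')
  obtain v p x y where t: "t = (v, p, x, y)" by (cases t)
  let ?N = "Suc n"
  let ?e1 = "enc ?N (p # x # y # flat l')" let ?e2 = "enc ?N (x # y # flat l')" let ?e3 = "enc ?N (y # flat l')"
  let ?e4 = "enc ?N (flat l')"
  have c: "code l = enc ?N (v # p # x # y # flat l')" using Cons t by simp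
  have lt: "code l < 2 ^ s 1" using fitsD[OF stdD(1)[OF s(1)], of S] l r by simp
  have step: "y \<le> y * ?N + e" for y e by (induction y) auto
  have le: "?e1 \<le> code l" "?e2 \<le> ?e1" "?e3 \<le> ?e2" "?e4 \<le> ?e3"
    unfolding c enc.simps(2)[of _ v] enc.simps(2)[of _ p "x # y # flat l'"] enc.simps(2)[of _ x "y # flat l'"]
      enc.simps(2)[of _ y "flat l'"] by (rule step)+
  have small: "v < ?N" "p < ?N" "x < ?N" "y < ?N" "\<forall>e\<in>set (flat l'). e < ?N"
    using tasks_flat[of l'] l Cons t bounds by auto
  have n2: "Suc n < 2 ^ s 1" using std_n[OF s(1)] .
  have e: "?e1 < 2 ^ s 1" "?e2 < 2 ^ s 1" "?e3 < 2 ^ s 1" "?e4 < 2 ^ s 1" using le lt by linarith+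
  have v: "v < 2 ^ s 1" "p < 2 ^ s 1" "x < 2 ^ s 1" "y < 2 ^ s 1" using small n2 by linarith+
  let ?s1 = "s(S := ?e1, rv := v)" let ?s2 = "s(S := ?e2, rv := v, rp := p)"
  let ?s3 = "s(S := ?e3, rv := v, rp := p, rx := x)" let ?s4 = "s(S := ?e4, rv := v, rp := p, rx := x, ry := y)"
  have std: "std ?s1" "std ?s2" "std ?s3" using s(1) e v r by (auto intro!: std_upd simp del: enc.simps)
  have eqs: "?s1(S := ?e2, rp := p) = ?s2" "?s2(S := ?e3, rx := x) = ?s3" "?s3(S := ?e4, ry := y) = ?s4"
    using r by (auto simp: fun_eq_iff simp del: enc.simps)
  have Q4: "Q ?s4" using Q Cons t by simp
  have 3: "W m (pop S ry) Q ?s3"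
    by (rule wp_pop[where l = "y # flat l'"])
       (use std(3) s r bounds small Q4 eqs in \<open>auto simp del: enc.simps\<close>)
  have 2: "W m (pop S rx ;; pop S ry) Q ?s2"
    by (rule wp_seq, rule wp_pop[where l = "x # y # flat l'"])
       (use std(2) s r bounds small 3 eqs in \<open>auto simp del: enc.simps\<close>)
  have 1: "W m (pop S rp ;; pop S rx ;; pop S ry) Q ?s1"
    by (rule wp_seq, rule wp_pop[where l = "p # x # y # flat l'"])
       (use std(1) s r bounds small 2 eqs in \<open>auto simp del: enc.simps\<close>)
  show ?thesis unfolding pop4_def
    by (rule wp_seq, rule wp_pop[where l = "v # p # x # y # flat l'"])
       (use s r bounds small 1 l c in \<open>auto simp del: enc.simps\<close>)
qed

lemma wp_push4:
  assumes s: "std s" and S: "s S = code l"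
    and r: "7 < S" "7 < rv" "7 < rp" "7 < rx" "7 < ry" "S \<notin> {rv, rp, rx, ry}"
    and b: "\<not> m \<Longrightarrow> code ((s rv, s rp, s rx, s ry) # l) < 2 ^ s 1"
    and Q: "code ((s rv, s rp, s rx, s ry) # l) < 2 ^ s 1 \<Longrightarrow>
      Q (s(S := code ((s rv, s rp, s rx, s ry) # l)))"
  shows "W m (push4 S rv rp rx ry) Q s"
proof -
  let ?N = "Suc n"
  let ?e0 = "enc ?N (flat l)" let ?e1 = "?e0 * ?N + s ry" let ?e2 = "?e1 * ?N + s rx"
  let ?e3 = "?e2 * ?N + s rp" let ?e4 = "?e3 * ?N + s rv"
  have c: "code ((s rv, s rp, s rx, s ry) # l) = ?e4" by (simp del: mult_Suc_right)
  have step: "y \<le> y * ?N + e" for y e by (induction y) auto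
  have le: "?e3 \<le> ?e4" "?e2 \<le> ?e3" "?e1 \<le> ?e2" by (rule step)+
  have b': "?e4 < 2 ^ s 1" if "\<not> m" using b[OF that] c by simp
  have b3: "?e3 < 2 ^ s 1" "?e2 < 2 ^ s 1" "?e1 < 2 ^ s 1" if "\<not> m" using b'[OF that] le by linarith+
  have std: "std (s(S := e))" if "e < 2 ^ s 1" for e using s r that by (auto intro!: std_upd)
  have 3: "W m (push S rv) Q (s(S := ?e3))" if a: "?e3 < 2 ^ s 1"
    by (rule wp_push[OF std[OF a]]) (use r b' Q c in \<open>auto simp del: mult_Suc_right enc.simps flat.simps\<close>)
  have 2: "W m (push S rp ;; push S rv) Q (s(S := ?e2))" if a: "?e2 < 2 ^ s 1"
    by (rule wp_seq, rule wp_push[OF std[OF a]])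
       (use r b3 3 in \<open>auto simp del: mult_Suc_right enc.simps flat.simps\<close>)
  have 1: "W m (push S rx ;; push S rp ;; push S rv) Q (s(S := ?e1))" if a: "?e1 < 2 ^ s 1"
    by (rule wp_seq, rule wp_push[OF std[OF a]])
       (use r b3 2 in \<open>auto simp del: mult_Suc_right enc.simps flat.simps\<close>)
  show ?thesis unfolding push4_def
    by (rule wp_seq, rule wp_push[OF s])
       (use r b3 1 S in \<open>auto simp del: mult_Suc_right enc.simps flat.simps\<close>)
qed

definition env :: "(nat \<Rightarrow> nat) \<Rightarrow> bool" where
  "env s \<longleftrightarrow> std s \<and> s 9 = 0 \<and> s 10 = a \<and> s 11 = F \<and> s 12 = b \<and> s 23 = Suc d \<and> s 37 = 0"

lemma env_upd: "env s \<Longrightarrow> 12 < r \<Longrightarrow> r \<noteq> 23 \<Longrightarrow> r \<noteq> 37 \<Longrightarrow> x < 2 ^ s 1 \<Longrightarrow> env (s(r := x))"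
  by (auto simp: env_def intro!: std_upd)

lemma envD: "env s \<Longrightarrow> std s" "env s \<Longrightarrow> fits s" "env s \<Longrightarrow> s 9 = 0" "env s \<Longrightarrow> s 10 = a" "env s \<Longrightarrow> s 11 = F"
  "env s \<Longrightarrow> s 12 = b" "env s \<Longrightarrow> s 23 = Suc d" "env s \<Longrightarrow> s 37 = 0" "env s \<Longrightarrow> s 2 = 0" "env s \<Longrightarrow> s 3 = 0"
  "env s \<Longrightarrow> s 4 = 0" "env s \<Longrightarrow> s 7 = Suc n"
  by (simp_all add: env_def std_def)

lemma env_fits: "env s \<Longrightarrow> 2 \<le> r \<Longrightarrow> s r < 2 ^ s 1"
  using fitsD envD(2) by blast

lemma env_n: "env s \<Longrightarrow> x \<le> Suc n \<Longrightarrow> x < 2 ^ s 1"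
  using std_n envD(1) by (meson le_less_trans)

section \<open>Expanding a single task\<close>

definition child_tasks :: "nat \<Rightarrow> nat \<Rightarrow> (nat \<times> nat) list \<Rightarrow> (nat \<times> nat \<times> nat \<times> nat) list" where
  "child_tasks v x cs = map (\<lambda>(c, z). (c, v, z, x)) cs"

lemma wp_fresh:
  assumes s: "env s" and S: "s 24 = code (child_tasks v x cs @ l)" "tasks (child_tasks v x cs @ l)"
    and j: "s 30 = length cs"
    and Q: "\<And>t. s 31 \<notin> fst ` set cs \<Longrightarrow> s 32 \<notin> snd ` set cs \<Longrightarrow> env t \<Longrightarrow>
        eqx {25, 33, 34, 35, 36, 39} s t \<Longrightarrow> Q t"
      "\<not> (s 31 \<notin> fst ` set cs \<and> s 32 \<notin> snd ` set cs) \<Longrightarrow> m"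
  shows "W m fresh Q s"
proof -
  let ?l = "child_tasks v x cs @ l" and ?j = "length cs"
  let ?X = "{25, 33, 34, 35, 36, 39} :: nat set"
  let ?I = "\<lambda>k u. k \<le> ?j \<and> env u \<and> eqx ?X s u \<and> u 25 = code (drop (?j - k) ?l) \<and>
      (\<forall>q\<in>set (take (?j - k) cs). fst q \<noteq> s 31 \<and> snd q \<noteq> s 32)"
  let ?c = "pop4 25 33 34 35 36 ;; neq 31 33 ;; neq 32 35"
  have body: "W m ?c (\<lambda>u. u 39 = k \<and> ?I k u) (u(39 := k))" if I: "?I (Suc k) u" "u 39 = Suc k" for k u
  proof -
    let ?i = "?j - Suc k"
    have i: "?i < ?j" "?j - k = Suc ?i" using I(1) by auto
    obtain c z where cz: "cs ! ?i = (c, z)" by force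
    have dr: "drop ?i ?l = (c, v, z, x) # drop (?j - k) ?l"
    proof -
      have "drop ?i ?l = ?l ! ?i # drop (Suc ?i) ?l"
        by (rule Cons_nth_drop_Suc[symmetric]) (use i in \<open>simp add: child_tasks_def\<close>)
      moreover have "?l ! ?i = (c, v, z, x)" using i(1) cz by (simp add: child_tasks_def nth_append)
      ultimately show ?thesis using i(2) by simp
    qed
    have tk: "take (?j - k) cs = take ?i cs @ [(c, z)]" using i cz by (simp add: take_Suc_conv_app_nth)
    have td: "tasks (drop ?i ?l)" using S(2) unfolding tasks_def by (meson in_set_dropD)
    then have cv: "c < a" "v < a" "z < b" "x < b" unfolding dr by auto
    let ?t = "u(39 := k)"
    have k2: "k < 2 ^ u 1" using env_fits[of u 39] I by simp
    have t: "env ?t" using I(1) k2 by (intro env_upd) auto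
    let ?v = "?t(25 := code (drop (?j - k) ?l), 33 := c, 34 := v, 35 := z, 36 := x)"
    have "code (drop (?j - k) ?l) \<le> code (drop ?i ?l)"
      using code_append_mono[of "drop (?j - k) ?l" "[(c, v, z, x)]"] dr by simp
    then have cl: "code (drop (?j - k) ?l) < 2 ^ u 1" using env_fits[of u 25] I(1) by simp
    have lt: "c < 2 ^ u 1" "v < 2 ^ u 1" "z < 2 ^ u 1" "x < 2 ^ u 1"
      using cv bounds env_n[of u n] I(1) by (auto intro: less_trans)
    have ve: "env ?v" by (intro env_upd t) (use cl lt in auto)
    have vx: "eqx ?X s ?v" using I(1) by (auto simp: eqx_def)
    have v31: "?v 31 = s 31" "?v 32 = s 32" using I(1) by (auto simp: eqx_def)
    have 2: "W m (neq 32 35) (\<lambda>u. u 39 = k \<and> ?I k u) ?v" if ne: "s 31 \<noteq> c"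
    proof (rule wp_neq)
      assume "?v 32 \<noteq> ?v 35"
      then have "s 32 \<noteq> z" using v31 by simp
      then show "?v 39 = k \<and> ?I k ?v" using ve vx I(1) tk ne by auto
    next
      assume "?v 32 = ?v 35"
      then have "s 32 = z" using v31 by simp
      then show m using Q(2) cz i nth_mem[OF i(1)] by force
    qed (use envD[OF ve] in auto)
    have 1: "W m (neq 31 33 ;; neq 32 35) (\<lambda>u. u 39 = k \<and> ?I k u) ?v"
    proof (rule wp_seq, rule wp_neq)
      assume "?v 31 \<noteq> ?v 33"
      then show "W m (neq 32 35) (\<lambda>u. u 39 = k \<and> ?I k u) ?v" using 2 v31 by simp
    next
      assume "?v 31 = ?v 33"
      then have "s 31 = c" using v31 by simp
      then show m using Q(2) cz i nth_mem[OF i(1)] by force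
    qed (use envD[OF ve] in auto)
    show ?thesis
    proof (rule wp_seq, rule wp_pop4[where l = "drop ?i ?l"])
      show "std ?t" "?t 37 = 0" by (rule envD[OF t])+
      show "?t 25 = code (drop ?i ?l)" using I(1) by simp
      show "tasks (drop ?i ?l)" by (rule td)
      show "case drop ?i ?l of [] \<Rightarrow> m | (v, p, x, y) # l' \<Rightarrow> W m (neq 31 33 ;; neq 32 35)
          (\<lambda>u. u 39 = k \<and> ?I k u) (?t(25 := code l', 33 := v, 34 := p, 35 := x, 36 := y))"
        unfolding dr using 1 by simp
    qed simp_all
  qed
  let ?s1 = "s(25 := s 24)" let ?s2 = "s(25 := s 24, 39 := ?j)"
  have e1: "env ?s1" by (intro env_upd s) (use env_fits[OF s] in auto)
  have e2: "env ?s2" by (intro env_upd s) (use env_fits[OF s, of 24] env_fits[OF s, of 30] j in auto)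
  have loop: "W m (Loop 39 ?c) Q ?s2"
  proof (rule wp_loop[where I = ?I])
    show "?I (?s2 39) ?s2" using e2 S(1) by (auto simp: eqx_def)
  next
    fix k t assume "?I (Suc k) t" "t 39 = Suc k"
    then show "W m ?c (\<lambda>u. u 39 = k \<and> ?I k u) (t(39 := k))" by (rule body)
  next
    fix t assume t: "?I 0 t" "t 39 = 0"
    then show "Q t" by (intro Q(1)) auto
  qed
  have 1: "W m (copy 30 39 ;; Loop 39 ?c) Q ?s1"
    by (rule wp_seq, rule wp_copy) (use envD[OF e1] loop j in auto)
  show ?thesis unfolding fresh_def
    by (rule wp_seq, rule wp_copy) (use envD[OF s] 1 in auto)
qed

end

declare enc.simps(2) [simp del] flat.simps(2) [simp del]

context search
begin

lemma child_tasks_simps [simp]: "child_tasks v x [] = []"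
  "child_tasks v x ((c, z) # cs) = (c, v, z, x) # child_tasks v x cs"
  by (simp_all add: child_tasks_def)

text \<open>The scratch registers are left open by \<open>post\<close>, so \<open>Q\<close> must
  hold in every state that satisfies it. In mode False one suitable pair is to be guessed, and its
  task must still fit on the stack.\<close>

lemma wp_add_child:
  assumes s: "env s" and S: "s 24 = code (child_tasks v x cs @ l)" "tasks (child_tasks v x cs @ l)"
    and j: "s 30 = length cs" and vs: "s 26 = v" "s 27 = p" "s 28 = x" "s 29 = y" "v < a" "x < b"
  defines "good \<equiv> \<lambda>c z. c \<in> ch A v p \<and> z \<in> ch T x y \<and> c \<notin> fst ` set cs \<and> z \<notin> snd ` set cs"
    and "post \<equiv> \<lambda>c z t. env t \<and> t 24 = code (child_tasks v x ((c, z) # cs) @ l) \<and>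
      t 30 = Suc (length cs) \<and> eqx {24, 25, 30, 31, 32, 33, 34, 35, 36, 39} s t"
  assumes Q: "if m then \<forall>c z t. good c z \<longrightarrow> post c z t \<longrightarrow> Q t
     else \<exists>c z. good c z \<and> code (child_tasks v x ((c, z) # cs) @ l) < 2 ^ s 1 \<and> Suc (length cs) < 2 ^ s 1 \<and>
       (\<forall>t. post c z t \<longrightarrow> Q t)"
  shows "W m add_child Q s"
proof -
  let ?c8 = "Prim (IncR 30)" let ?c7 = "push4 24 31 26 32 28 ;; ?c8" let ?c6 = "fresh ;; ?c7"
  let ?c5 = "neq 32 29 ;; ?c6" let ?c4 = "adj True 11 12 28 32 ;; ?c5" let ?c3 = "neq 31 27 ;; ?c4"
  let ?c2 = "adj True 9 10 26 31 ;; ?c3" let ?c1 = "lt 32 12 ;; ?c2"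
  let ?c0 = "guess 32 12 ;; ?c1" let ?cm = "lt 31 10 ;; ?c0"
  let ?l = "child_tasks v x cs @ l"
  have tail: "W m ?c2 Q (s(31 := c, 32 := z))"
    if cz: "c < a" "z < b"
      and g: "m \<or> good c z \<and> code ((c, v, z, x) # ?l) < 2 ^ s 1 \<and> Suc (length cs) < 2 ^ s 1"
      and Qcz: "\<And>t. good c z \<Longrightarrow> post c z t \<Longrightarrow> Q t" for c z
  proof -
    let ?s = "s(31 := c, 32 := z)"
    have lt: "c < 2 ^ s 1" "z < 2 ^ s 1" using cz bounds env_n[OF s, of n] by auto
    have e: "env ?s" by (intro env_upd s) (use lt in auto)
    note D = envD[OF e]
    have 7: "W m ?c7 Q t" if gd: "good c z" and t: "env t" "eqx {25, 33, 34, 35, 36, 39} ?s t" for t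
    proof -
      have tr: "t 24 = code ?l" "t 31 = c" "t 26 = v" "t 32 = z" "t 28 = x" "t 30 = length cs" "t 1 = s 1"
        using t(2) S(1) vs j by (simp_all add: eqx_def)
      show ?thesis
      proof (rule wp_seq, rule wp_push4[where l = ?l], unfold tr)
        show "code ((c, v, z, x) # ?l) < 2 ^ s 1" if "\<not> m" using g that by blast
        assume cd: "code ((c, v, z, x) # ?l) < 2 ^ s 1"
        let ?u = "t(24 := code ((c, v, z, x) # ?l))"
        have u: "env ?u" by (intro env_upd t) (use cd tr in auto)
        have u30: "?u 30 = length cs" "?u 1 = s 1" using tr by simp_all
        show "W m ?c8 Q ?u"
        proof (rule wp_inc, unfold u30)
          show "Suc (length cs) < 2 ^ s 1" if "\<not> m" using g that by blast
          assume "Suc (length cs) < 2 ^ s 1"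
          then have "env (?u(30 := Suc (length cs)))" by (intro env_upd u) (use tr in auto)
          moreover have "eqx {24, 25, 30, 31, 32, 33, 34, 35, 36, 39} s (?u(30 := Suc (length cs)))"
            using t(2) by (auto simp: eqx_def)
          ultimately have "post c z (?u(30 := Suc (length cs)))"
            unfolding post_def by simp
          then show "Q (?u(30 := Suc (length cs)))" using Qcz gd by blast
        qed simp
      qed (use envD[OF t(1)] in simp_all)
    qed
    have s': "?s 31 = c" "?s 32 = z" "?s 26 = v" "?s 27 = p" "?s 28 = x" "?s 29 = y" "?s 9 = 0" "?s 10 = a"
       "?s 11 = F" "?s 12 = b"
      using vs D by simp_all
    have 6: "W m ?c6 Q ?s" if c1: "c \<in> ch A v p" "z \<in> ch T x y"
    proof (rule wp_seq, rule wp_fresh[where v = v and x = x and cs = cs and l = l])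
      fix t assume "?s 31 \<notin> fst ` set cs" "?s 32 \<notin> snd ` set cs" "env t"
        "eqx {25, 33, 34, 35, 36, 39} ?s t"
      then show "W m ?c7 Q t" using 7 c1 by (simp add: good_def s')
    next
      assume "\<not> (?s 31 \<notin> fst ` set cs \<and> ?s 32 \<notin> snd ` set cs)"
      then show m using g by (auto simp: good_def s')
    qed (use e S j in simp_all)
    have 5: "W m ?c5 Q ?s" if c1: "c \<in> ch A v p" "{x, z} \<in> edges T"
    proof (rule wp_seq, rule wp_neq)
      assume "?s 32 \<noteq> ?s 29"
      then show "W m ?c6 Q ?s" using 6 c1 by (simp add: ch_def vs)
    next
      assume "?s 32 = ?s 29"
      then show m using g by (auto simp: good_def ch_def vs)
    qed (use D in simp_all)
    have ixs: "ix 0 a v c < n" "ix F b x z < n"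
      using ix_less[of 0 a v c] ix_less[of F b x z] bounds cz vs by auto
    have 4: "W m ?c4 Q ?s" if c1: "c \<in> ch A v p"
    proof (rule wp_seq, rule wp_adj[OF D(1)], unfold s')
      assume "w ! ix F b x z = True"
      then show "W m ?c5 Q ?s" using 5 c1 edgeT vs cz by simp
    next
      assume "\<not> (ix F b x z < n \<and> w ! ix F b x z = True)"
      then show m using g ixs edgeT vs cz by (auto simp: good_def ch_def)
    qed simp_all
    have 3: "W m ?c3 Q ?s" if c1: "{v, c} \<in> edges A"
    proof (rule wp_seq, rule wp_neq)
      assume "?s 31 \<noteq> ?s 27"
      then show "W m ?c4 Q ?s" using 4 c1 by (simp add: ch_def vs)
    next
      assume "?s 31 = ?s 27"
      then show m using g by (auto simp: good_def ch_def vs)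
    qed (use D in simp_all)
    show ?thesis
    proof (rule wp_seq, rule wp_adj[OF D(1)], unfold s')
      assume "w ! ix 0 a v c = True"
      then show "W m ?c3 Q ?s" using 3 edgeA vs cz by simp
    next
      assume "\<not> (ix 0 a v c < n \<and> w ! ix 0 a v c = True)"
      then show m using g ixs edgeA vs cz by (auto simp: good_def ch_def)
    qed simp_all
  qed
  \<comment> \<open>\<open>P\<close> is vacuous in mode True and singles out the pair to be guessed
    in mode False.\<close>
  define P where "P c z \<longleftrightarrow> m \<or> good c z \<and> code ((c, v, z, x) # ?l) < 2 ^ s 1 \<and> Suc (length cs) < 2 ^ s 1 \<and>
     (\<forall>t. post c z t \<longrightarrow> Q t)" for c z
  have Pex: "\<exists>c z. c < a \<and> z < b \<and> P c z" if "\<not> m"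
  proof -
    obtain c z where g: "good c z" "code (child_tasks v x ((c, z) # cs) @ l) < 2 ^ s 1"
      "Suc (length cs) < 2 ^ s 1" "\<forall>t. post c z t \<longrightarrow> Q t"
      using Q \<open>\<not> m\<close> by auto
    then have "c < a" "z < b" using ch_less unfolding good_def by blast+
    moreover have "P c z" using g unfolding P_def by simp
    ultimately show ?thesis by blast
  qed
  have PQ: "Q t" if "P c z" "good c z" "post c z t" for c z t
    using that Q unfolding P_def by (auto split: if_splits)
  have 1: "W m ?c1 Q (s(31 := c, 32 := z))" if cz: "c < a" "z \<le> b" "m \<or> z < b" "P c z" for c z
  proof (rule wp_seq, rule wp_lt)
    let ?s = "s(31 := c, 32 := z)"
    have "c < 2 ^ s 1" "z < 2 ^ s 1" using cz bounds env_n[OF s, of n] by auto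
    then have e: "env ?s" by (intro env_upd s) auto
    show "fits ?s" "?s 2 = 0" "?s 3 = 0" "?s 4 = 0" by (rule envD[OF e])+
    assume "?s 32 < ?s 12"
    then show "W m ?c2 Q ?s" using cz PQ[OF cz(4)] envD[OF e] by (intro tail) (auto simp: P_def)
  next
    show m if "\<not> (s(31 := c, 32 := z)) 32 < (s(31 := c, 32 := z)) 12"
      using that cz envD[OF s] by auto
  qed simp_all
  have 0: "W m ?c0 Q (s(31 := c))" if cz: "c < a" "m \<or> (\<exists>z<b. P c z)" for c
  proof (rule wp_seq, rule wp_guess)
    have "c < 2 ^ s 1" using cz bounds env_n[OF s, of n] by auto
    then have e: "env (s(31 := c))" by (intro env_upd s) auto
    show "fits (s(31 := c))" "(s(31 := c)) 2 = 0" "(s(31 := c)) 3 = 0" by (rule envD[OF e])+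
    have b: "(s(31 := c)) 12 = b" using envD[OF e] by simp
    show "if m then \<forall>z\<le>(s(31 := c)) 12. W m ?c1 Q ((s(31 := c))(32 := z))
      else \<exists>z\<le>(s(31 := c)) 12. W m ?c1 Q ((s(31 := c))(32 := z))"
    proof (cases m)
      case True
      then have "\<forall>z\<le>b. W m ?c1 Q (s(31 := c, 32 := z))" using 1 cz by (simp add: P_def)
      then show ?thesis unfolding b using True by simp
    next
      case False
      then obtain z where "z < b" "P c z" using cz by blast
      then show ?thesis unfolding b using 1[OF cz(1), of z] False by (auto intro!: exI[of _ z])
    qed
  qed simp_all
  have m1: "W m ?cm Q (s(31 := c))" if cz: "c \<le> a" "m \<or> c < a \<and> (\<exists>z<b. P c z)" for c
  proof (rule wp_seq, rule wp_lt)
    let ?s = "s(31 := c)"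
    have "c < 2 ^ s 1" using cz bounds env_n[OF s, of n] by auto
    then have e: "env ?s" by (intro env_upd s) auto
    show "fits ?s" "?s 2 = 0" "?s 3 = 0" "?s 4 = 0" by (rule envD[OF e])+
    assume "?s 31 < ?s 10"
    then show "W m ?c0 Q ?s" using cz envD[OF e] by (intro 0) auto
  next
    show m if "\<not> (s(31 := c)) 31 < (s(31 := c)) 10"
      using that cz envD[OF s] by auto
  qed simp_all
  show ?thesis
    unfolding add_child_def
  proof (rule wp_seq, rule wp_guess)
    show "fits s" "s 2 = 0" "s 3 = 0" by (rule envD[OF s])+
    show "if m then \<forall>c\<le>s 10. W m ?cm Q (s(31 := c)) else \<exists>c\<le>s 10. W m ?cm Q (s(31 := c))"
    proof (cases m)
      case True
      then have "\<forall>c\<le>a. W m ?cm Q (s(31 := c))" using m1 by simp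
      then show ?thesis using True envD[OF s] by simp
    next
      case False
      then obtain c z where "c < a" "z < b" "P c z" using Pex by blast
      then have "W m ?cm Q (s(31 := c))" "c \<le> a" using m1[of c] by auto
      then show ?thesis using False envD[OF s] by auto
    qed
  qed simp_all
qed

lemma wp_cover:
  assumes s: "env s" and vs: "s 26 = v" "s 27 = p" "v < a" "p < a"
    and Q: "\<And>t. s 30 = card (ch A v p) \<Longrightarrow> env t \<Longrightarrow> eqx {13, 14, 30} s t \<Longrightarrow> t 30 = 0 \<Longrightarrow> Q t"
      "s 30 \<noteq> card (ch A v p) \<Longrightarrow> m"
  shows "W m cover Q s"
proof -
  note D = envD[OF s]
  define cnt where "cnt k = card {u. u < k \<and> u \<in> ch A v p}" for k
  have cnt_Suc: "cnt (Suc k) = cnt k + of_bool (k \<in> ch A v p)" for k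
  proof -
    have "{u. u < Suc k \<and> u \<in> ch A v p} = {u. u < k \<and> u \<in> ch A v p} \<union> (if k \<in> ch A v p then {k} else {})"
      by (auto simp: less_Suc_eq)
    then show ?thesis by (simp add: cnt_def)
  qed
  have cnt_a: "cnt a = card (ch A v p)"
    unfolding cnt_def by (rule arg_cong[of _ _ card]) (use ch_less in auto)
  have cnt_mono: "cnt k \<le> cnt a" if "k \<le> a" for k
    unfolding cnt_def by (rule card_mono) (use that in auto)
  let ?b3 = "adj True 9 10 26 13 ;; neq 13 27 ;; Prim (DecR 30)"
  let ?body = "adj False 9 10 26 13 [+] eq 13 27 [+] ?b3"
  let ?J = "\<lambda>k u. u = s(13 := k, 14 := a - k, 30 := s 30 - cnt k) \<and> cnt k \<le> s 30"
  show ?thesis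
    unfolding cover_def
  proof (rule wp_seq, rule wp_for[where J = ?J])
    show "?J 0 (s(13 := 0, 14 := s 10))" using D by (auto simp: cnt_def fun_eq_iff)
  next
    fix k u assume k: "k < s 10" and u: "?J k u"
    let ?t = "s(13 := k, 14 := a - Suc k, 30 := s 30 - cnt k)"
    let ?Q = "\<lambda>v. v 14 = s 10 - Suc k \<and> v 13 = k \<and> v 1 = s 1 \<and> ?J (Suc k) (v(13 := Suc k))"
    have ka: "k < a" using k D by simp
    have ut: "u(14 := s 10 - Suc k) = ?t" using u D by (auto simp: fun_eq_iff)
    have lt: "k < 2 ^ s 1" "a - Suc k < 2 ^ s 1" "s 30 - cnt k < 2 ^ s 1"
      using ka bounds env_n[OF s, of n] env_fits[OF s, of 30] by auto
    have t: "env ?t" by (intro env_upd s) (use lt in auto)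
    note E = envD[OF t]
    have t': "?t 9 = 0" "?t 10 = a" "?t 26 = v" "?t 13 = k" "?t 27 = p" using vs D by simp_all
    have ixs: "ix 0 a v k < n" using ix_less[of 0 a v k] bounds ka vs by auto
    have skip: "?Q ?t" if "k \<notin> ch A v p" using that u D by (auto simp: cnt_Suc fun_eq_iff)
    have 1: "W m (adj False 9 10 26 13) ?Q ?t" if "m \<or> {v, k} \<notin> edges A"
    proof (rule wp_adj[OF E(1)])
      assume "w ! ix (?t 9) (?t 10) (?t 26) (?t 13) = False"
      then show "?Q ?t" unfolding t' using skip edgeA[OF vs(3) ka] by (auto simp: ch_def)
    next
      assume "\<not> (ix (?t 9) (?t 10) (?t 26) (?t 13) < n \<and> w ! ix (?t 9) (?t 10) (?t 26) (?t 13) = False)"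
      then show m unfolding t' using ixs edgeA[OF vs(3) ka] that by auto
    qed simp_all
    have 2: "W m (eq 13 27) ?Q ?t" if "m \<or> k = p"
    proof (rule wp_eq)
      assume "?t 13 = ?t 27"
      then show "?Q ?t" unfolding t' using skip by (auto simp: ch_def)
    next
      assume "?t 13 \<noteq> ?t 27"
      then show m unfolding t' using that by auto
    qed (use E in simp_all)
    have 3: "W m ?b3 ?Q ?t" if c: "m \<or> k \<in> ch A v p"
    proof -
      have c3: "W m (Prim (DecR 30)) ?Q ?t" if "k \<in> ch A v p"
      proof (rule wp_dec)
        assume "0 < ?t 30"
        then show "?Q (?t(30 := ?t 30 - 1))" using that u D by (auto simp: cnt_Suc fun_eq_iff)
      next
        assume "?t 30 = 0"
        then have "s 30 < cnt (Suc k)" using that u by (simp add: cnt_Suc)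
        then show m using Q(2) cnt_mono[of "Suc k"] ka cnt_a by auto
      qed
      have c2: "W m (neq 13 27 ;; Prim (DecR 30)) ?Q ?t" if e: "{v, k} \<in> edges A"
      proof (rule wp_seq, rule wp_neq)
        assume "?t 13 \<noteq> ?t 27"
        then show "W m (Prim (DecR 30)) ?Q ?t" using c3 e unfolding t' by (simp add: ch_def)
      next
        assume "?t 13 = ?t 27"
        then show m using c unfolding t' by (auto simp: ch_def)
      qed (use E in simp_all)
      show ?thesis
      proof (rule wp_seq, rule wp_adj[OF E(1)], unfold t')
        assume "w ! ix 0 a v k = True"
        then show "W m (neq 13 27 ;; Prim (DecR 30)) ?Q ?t" using c2 edgeA[OF vs(3) ka] by simp
      next
        assume "\<not> (ix 0 a v k < n \<and> w ! ix 0 a v k = True)"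
        then show m using ixs edgeA[OF vs(3) ka] c by (auto simp: ch_def)
      qed simp_all
    qed
    show "W m ?body ?Q (u(14 := s 10 - Suc k))"
      unfolding ut
    proof (cases m)
      case True
      then show "W m ?body ?Q ?t" by (intro wp_choice(1) 1 2 3) auto
    next
      case False
      consider "{v, k} \<notin> edges A" | "k = p" | "k \<in> ch A v p" by (auto simp: ch_def)
      then show "W m ?body ?Q ?t"
      proof cases
        case 1
        then show ?thesis by (intro wp_choice(2)[OF False] \<open>m \<or> {v, k} \<notin> edges A \<Longrightarrow> W m (adj False 9 10 26 13) ?Q ?t\<close>) simp
      next
        case 2
        then have "W m (eq 13 27) ?Q ?t" by (intro \<open>m \<or> k = p \<Longrightarrow> W m (eq 13 27) ?Q ?t\<close>) simp
        then show ?thesis by (intro wp_choice(3)[OF False] wp_choice(2)[OF False])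
      next
        case 3
        then have "W m ?b3 ?Q ?t" by (intro \<open>m \<or> k \<in> ch A v p \<Longrightarrow> W m ?b3 ?Q ?t\<close>) simp
        then show ?thesis by (intro wp_choice(3)[OF False])
      qed
    qed
  next
    fix u assume u: "?J (s 10) u"
    let ?t = "s(13 := 0, 14 := 0, 30 := s 30 - cnt a)"
    have ut: "u(13 := 0) = ?t" using u D by (auto simp: fun_eq_iff)
    have t: "env ?t" by (intro env_upd s) (use env_fits[OF s, of 30] in auto)
    show "W m (Prim (ZeroR 30)) Q (u(13 := 0))"
      unfolding ut
    proof (rule wp_zero)
      assume "?t 30 = 0"
      then have c: "s 30 = card (ch A v p)" using u D cnt_a by simp
      show "Q ?t" by (rule Q(1)[OF c t]) (use cnt_a c in \<open>auto simp: eqx_def\<close>)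
    next
      assume "?t 30 \<noteq> 0"
      then show m using Q(2) cnt_a by auto
    qed
  qed (use D in simp_all)
qed

end

text \<open>The empty stack is 1, hence the increment at the beginning and the test by
  \<open>DecR\<close> and \<open>ZeroR\<close> at the end. The initial task maps node 0 to a guessed
  node, each being its own parent. Register 40 allows one round for each node of the first
  tree.\<close>

definition tree_search :: com where
  "tree_search = Prim (IncR 24) ;; guess 28 12 ;; lt 28 12 ;; push4 24 26 26 28 28 ;; copy 10 40 ;;
     Loop 40 (expand [+] Prim Nop) ;; Prim (DecR 24) ;; Prim (ZeroR 24)"

section \<open>The height of the stack\<close>

context rooted_tree
begin

definition weight :: "nat \<Rightarrow> 'a \<Rightarrow> nat" where
  "weight d v = d * floor_log (card (sub v)) + 1"

text \<open>
  The bound \<open>weight d v\<close> is the height to which the stack may grow while the subtree of \<open>v\<close> is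
  being processed; \<open>fit_stack\<close> says that the stack never gets higher than \<open>H\<close>.
\<close>

primrec fit_stack :: "nat \<Rightarrow> nat \<Rightarrow> 'a list \<Rightarrow> bool" where
  "fit_stack d H [] \<longleftrightarrow> True"
| "fit_stack d H (v # vs) \<longleftrightarrow> weight d v + length vs \<le> H \<and> fit_stack d H vs"

lemma fit_stack_length: "fit_stack d H vs \<Longrightarrow> length vs \<le> H"
  by (cases vs) (auto simp: weight_def)

lemma card_sub_pos: "v \<in> nodes T \<Longrightarrow> 0 < card (sub v)"
  using card_sub by simp

lemma weight_child:
  assumes "v \<in> nodes T" "c \<in> children v"
  shows "weight d c \<le> weight d v"
proof -
  have "card (sub c) \<le> (\<Sum>c\<in>children v. card (sub c))"
    using assms(2) finite_children by (intro member_le_sum) auto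
  then have "card (sub c) \<le> card (sub v)" using card_sub[OF assms(1)] by simp
  then have "floor_log (card (sub c)) \<le> floor_log (card (sub v))" by (rule floor_log_le_iff)
  then show ?thesis by (simp add: weight_def)
qed

text \<open>Two disjoint subtrees share the nodes below \<open>v\<close>, so the smaller has at most
  half of the size of the subtree of \<open>v\<close>, and its rounded logarithm is lower by at
  least 1. The factor \<open>d\<close> in \<open>weight\<close> turns this into room for
  \<open>d\<close> entries on the stack.\<close>

lemma weight_light_child:
  assumes "v \<in> nodes T" "c \<in> children v" "h \<in> children v" "c \<noteq> h" "card (sub c) \<le> card (sub h)"
  shows "weight d c + d \<le> weight d v"
proof -
  have "card (sub c) + card (sub h) = (\<Sum>u\<in>{c, h}. card (sub u))" using assms(4) by simp
  also have "\<dots> \<le> (\<Sum>c\<in>children v. card (sub c))"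
    using assms finite_children by (intro sum_mono2) auto
  finally have "2 * card (sub c) \<le> card (sub v)" using card_sub[OF assms(1)] assms(5) by simp
  then have "floor_log (2 * card (sub c)) \<le> floor_log (card (sub v))" by (rule floor_log_le_iff)
  moreover have "card (sub c) \<noteq> 0" using card_sub_pos children_nodes(1)[OF assms(2)] by simp
  ultimately have "Suc (floor_log (card (sub c))) \<le> floor_log (card (sub v))" by simp
  then have "d * Suc (floor_log (card (sub c))) \<le> d * floor_log (card (sub v))" by (rule mult_le_mono2)
  then show ?thesis by (simp add: weight_def)
qed

text \<open>With the largest child \<open>h\<close> deepest, every other child has at most
  \<open>d - 1\<close> siblings below it, for which its lower weight leaves room. When
  \<open>h\<close> is reached no sibling is left, so \<open>h\<close> may weigh as much as
  \<open>v\<close>.\<close>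

lemma fit_stack_expand:
  assumes v: "v \<in> nodes T" and fit: "fit_stack d H (v # vs)" and d: "card (children v) \<le> d"
  shows "\<exists>xs. distinct xs \<and> set xs = children v \<and> fit_stack d H (xs @ vs)"
proof (cases "children v = {}")
  case True
  then show ?thesis using fit by (intro exI[of _ "[]"]) auto
next
  case False
  have "Max ((\<lambda>c. card (sub c)) ` children v) \<in> (\<lambda>c. card (sub c)) ` children v"
    using False finite_children by (intro Max_in) auto
  then obtain h where h: "h \<in> children v" "card (sub h) = Max ((\<lambda>c. card (sub c)) ` children v)" by auto
  have hmax: "card (sub c) \<le> card (sub h)" if "c \<in> children v" for c
    unfolding h(2) using that finite_children by (intro Max_ge) auto
  obtain ys where ys: "set ys = children v - {h}" "distinct ys"
    using finite_distinct_list[of "children v - {h}"] finite_children by auto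
  have "length ys = card (children v - {h})" using ys distinct_card by force
  then have len: "Suc (length ys) \<le> d"
    using d h(1) finite_children card_Suc_Diff1[of "children v" h] by simp
  have "fit_stack d H (zs @ h # vs)" if "length zs \<le> length ys" "set zs \<subseteq> set ys" for zs
    using that
  proof (induction zs)
    case Nil
    then show ?case using fit weight_child[OF v h(1), of d] by auto
  next
    case (Cons z zs)
    have "weight d z + d \<le> weight d v"
      by (rule weight_light_child[OF v _ h(1)]) (use Cons.prems ys hmax in auto)
    then have "weight d z + length (zs @ h # vs) \<le> H" using Cons.prems(1) len fit by simp
    then show ?case using Cons by simp
  qed
  from this[of ys] show ?thesis using ys h(1) by (intro exI[of _ "ys @ [h]"]) auto
qed

text \<open>The total size of the subtrees on the stack measures progress: replacing a node by its
  children lowers it by 1.\<close>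

lemma sum_list_children:
  assumes "v \<in> nodes T" "distinct xs" "set xs = children v"
  shows "Suc (sum_list (map (\<lambda>c. card (sub c)) xs)) = card (sub v)"
  using card_sub[OF assms(1)] sum_list_distinct_conv_sum_set[OF assms(2), of "\<lambda>c. card (sub c)"] assms(3)
  by simp

end

section \<open>Correctness of the search in both modes\<close>

context search
begin

definition expansion :: "nat \<Rightarrow> nat \<Rightarrow> nat \<Rightarrow> nat \<Rightarrow> (nat \<times> nat) list \<Rightarrow> bool" where
  "expansion v p x y cs \<longleftrightarrow> distinct (map fst cs) \<and> distinct (map snd cs) \<and>
     fst ` set cs = ch A v p \<and> snd ` set cs \<subseteq> ch T x y"

lemma expansion_emb:
  assumes e: "expansion v p x y cs" and c: "\<And>c z. (c, z) \<in> set cs \<Longrightarrow> emb A T c v z x"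
  shows "emb A T v p x y"
proof -
  define g where "g c = the (map_of cs c)" for c
  have g: "(c, g c) \<in> set cs" if "c \<in> ch A v p" for c
  proof -
    have "c \<in> fst ` set cs" using e that by (simp add: expansion_def)
    then obtain z where "map_of cs c = Some z" by (metis map_of_eq_None_iff not_None_eq)
    then show ?thesis unfolding g_def by (simp add: map_of_SomeD)
  qed
  show ?thesis
  proof (rule emb.intros[of g])
    show "inj_on g (ch A v p)"
    proof (rule inj_onI)
      fix c c' assume a: "c \<in> ch A v p" "c' \<in> ch A v p" "g c = g c'"
      have "inj_on snd (set cs)" using e by (simp add: expansion_def distinct_map)
      then have "(c, g c) = (c', g c')" by (rule inj_onD) (use g[OF a(1)] g[OF a(2)] a(3) in auto)
      then show "c = c'" by simp
    qed
    show "g c \<in> ch T x y" if "c \<in> ch A v p" for c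
      using g[OF that] e by (force simp: expansion_def)
    show "emb A T c v (g c) x" if "c \<in> ch A v p" for c using g[OF that] c by blast
  qed
qed

text \<open>In mode True any expansion may have been pushed; in mode False the run that pushes a
  given \<open>cs\<close> is followed. One invariant covers both.\<close>

lemma wp_expand:
  assumes s: "env s" and S: "s 24 = code l" "tasks l" and z: "s 30 = 0"
  defines "post \<equiv> \<lambda>l' t. env t \<and> t 24 = code l' \<and> t 30 = 0 \<and> t 1 = s 1 \<and> t 40 = s 40"
  assumes Q: "if m then \<forall>v p x y l0 cs t. l = (v, p, x, y) # l0 \<longrightarrow> expansion v p x y cs \<longrightarrow>
       post (child_tasks v x cs @ l0) t \<longrightarrow> Q t
     else \<exists>v p x y l0 cs. l = (v, p, x, y) # l0 \<and> expansion v p x y cs \<and> length cs \<le> d \<and>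
       code (child_tasks v x cs @ l0) < 2 ^ s 1 \<and> (\<forall>t. post (child_tasks v x cs @ l0) t \<longrightarrow> Q t)"
  shows "W m expand Q s"
proof -
  let ?c = "copy 23 38 ;; Loop 38 (add_child [+] Prim Nop) ;; cover"
  have main: "W m ?c Q (s(24 := code l0, 26 := v, 27 := p, 28 := x, 29 := y))"
    if l: "l = (v, p, x, y) # l0" for v p x y l0
  proof -
    let ?s = "s(24 := code l0, 26 := v, 27 := p, 28 := x, 29 := y)"
    have vs: "v < a" "p < a" "x < b" "y < b" "tasks l0" using S(2) l by auto
    have "code l0 \<le> code l" using code_append_mono[of l0 "[(v, p, x, y)]"] l by simp
    then have lt: "code l0 < 2 ^ s 1" using env_fits[OF s, of 24] S(1) by simp
    have lt': "v < 2 ^ s 1" "p < 2 ^ s 1" "x < 2 ^ s 1" "y < 2 ^ s 1"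
      using vs bounds env_n[OF s, of n] by auto
    have e: "env ?s" by (intro env_upd s) (use lt lt' in auto)
    have d2: "Suc d < 2 ^ s 1" using env_fits[OF s, of 23] envD[OF s] by simp
    \<comment> \<open>In mode True \<open>cs\<close> is arbitrary; stating its properties
      conditionally lets the modes share the rest of the proof.\<close>
    obtain cs where cs: "\<not> m \<Longrightarrow> expansion v p x y cs" "\<not> m \<Longrightarrow> length cs \<le> d"
      "\<not> m \<Longrightarrow> code (child_tasks v x cs @ l0) < 2 ^ s 1"
      "\<not> m \<Longrightarrow> (\<forall>t. post (child_tasks v x cs @ l0) t \<longrightarrow> Q t)"
      using Q l by (cases m) auto
    define part where "part cs' \<longleftrightarrow> distinct (map fst cs') \<and> distinct (map snd cs') \<and>
       fst ` set cs' \<subseteq> ch A v p \<and> snd ` set cs' \<subseteq> ch T x y" for cs'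
    \<comment> \<open>A push lands on top, so in mode False the entries of \<open>cs\<close> are
      added from the last to the first, and those present form a suffix \<open>drop i cs\<close>;
      \<open>i \<le> k\<close> says that enough rounds are left for the others.\<close>
    define P where "P k cs' \<longleftrightarrow> part cs' \<and> (\<not> m \<longrightarrow> (\<exists>i\<le>k. i \<le> length cs \<and> cs' = drop i cs))" for k cs'
    have part_drop: "part (drop i cs)" if "\<not> m" for i
    proof -
      have "set (drop i cs) \<subseteq> set cs" by (rule set_drop_subset)
      then show ?thesis
        using cs(1)[OF that] image_mono[of "set (drop i cs)" "set cs" fst] image_mono[of "set (drop i cs)" "set cs" snd]
        unfolding part_def expansion_def by (simp add: drop_map[symmetric]) blast
    qed
    have tk: "tasks (child_tasks v x cs' @ l0)" if "part cs'" for cs'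
    proof -
      have "c < a \<and> z < b" if "(c, z) \<in> set cs'" for c z
      proof -
        have "c \<in> ch A v p" "z \<in> ch T x y"
          using that \<open>part cs'\<close> image_eqI[of c fst "(c, z)"] image_eqI[of z snd "(c, z)"] unfolding part_def by auto
        then show ?thesis using ch_less by blast
      qed
      then have "tasks (child_tasks v x cs')" using vs by (auto simp: tasks_def child_tasks_def)
      then show ?thesis using vs by simp
    qed
    let ?I = "\<lambda>k u. \<exists>cs'. env u \<and> u 24 = code (child_tasks v x cs' @ l0) \<and> u 30 = length cs' \<and>
       eqx {24, 25, 30, 31, 32, 33, 34, 35, 36, 38, 39} ?s u \<and> P k cs' \<and> k \<le> Suc d"
    have body: "W m (add_child [+] Prim Nop) (\<lambda>u. u 38 = k \<and> ?I k u) (u(38 := k))"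
      if I: "?I (Suc k) u" for k u
    proof -
      let ?Q = "\<lambda>u. u 38 = k \<and> ?I k u"
      obtain cs' where c: "env u" "u 24 = code (child_tasks v x cs' @ l0)" "u 30 = length cs'"
        "eqx {24, 25, 30, 31, 32, 33, 34, 35, 36, 38, 39} ?s u" "P (Suc k) cs'" "Suc k \<le> Suc d" using I by blast
      let ?u = "u(38 := k)"
      have u1: "u 1 = s 1" using c(4) by (simp add: eqx_def)
      have eu: "env ?u" by (intro env_upd c) (use c(6) d2 u1 in auto)
      have eq: "eqx {24, 25, 30, 31, 32, 33, 34, 35, 36, 38, 39} ?s ?u" using c(4) by (simp add: eqx_def)
      have ur: "?u 24 = code (child_tasks v x cs' @ l0)" "?u 30 = length cs'" "?u 26 = v" "?u 27 = p" "?u 28 = x" "?u 29 = y"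
        using c(2-4) by (simp_all add: eqx_def)
      have part: "part cs'" using c(5) by (simp add: P_def)
      have nop: "W m (Prim Nop) ?Q ?u" if "m \<or> (\<exists>i\<le>k. i \<le> length cs \<and> cs' = drop i cs)"
        by (rule wp_nop) (use eu eq ur part that c(6) in \<open>auto simp: P_def intro!: exI[of _ cs']\<close>)
      have add: "W m add_child ?Q ?u" if ii: "m \<or> (\<exists>i\<le>k. Suc i \<le> length cs \<and> cs' = drop (Suc i) cs)"
      proof (rule wp_add_child[where v = v and x = x and cs = cs' and l = l0 and p = p and y = y])
        let ?good = "\<lambda>c z. c \<in> ch A v p \<and> z \<in> ch T x y \<and> c \<notin> fst ` set cs' \<and> z \<notin> snd ` set cs'"
        let ?post = "\<lambda>c z t. env t \<and> t 24 = code (child_tasks v x ((c, z) # cs') @ l0) \<and> t 30 = Suc (length cs') \<and>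
          eqx {24, 25, 30, 31, 32, 33, 34, 35, 36, 39} ?u t"
        have res: "?Q t" if g: "?good c z" and p: "?post c z t" and P: "P k ((c, z) # cs')" for c z t
        proof -
          have "t 38 = k" using p by (simp add: eqx_def)
          moreover have "eqx {24, 25, 30, 31, 32, 33, 34, 35, 36, 38, 39} ?s t"
          proof (rule eqx_trans[OF eq])
            show "eqx {24, 25, 30, 31, 32, 33, 34, 35, 36, 39} ?u t" using p by blast
          qed auto
          ultimately show ?thesis using p P c(6) by (intro conjI exI[of _ "(c, z) # cs'"]) auto
        qed
        have pc: "part ((c, z) # cs')" if "?good c z" for c z
          using that part by (auto simp: part_def)
        show "if m then \<forall>c z t. ?good c z \<longrightarrow> ?post c z t \<longrightarrow> ?Q t
          else \<exists>c z. ?good c z \<and> code (child_tasks v x ((c, z) # cs') @ l0) < 2 ^ ?u 1 \<and> Suc (length cs') < 2 ^ ?u 1 \<and>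
            (\<forall>t. ?post c z t \<longrightarrow> ?Q t)"
        proof (cases m)
          case True
          then have "\<forall>c z t. ?good c z \<longrightarrow> ?post c z t \<longrightarrow> ?Q t"
            using res pc unfolding P_def by blast
          then show ?thesis using True by (simp only: if_True)
        next
          case False
          then obtain i where i: "i \<le> k" "i < length cs" "cs' = drop (Suc i) cs" using ii by auto
          obtain c1 z1 where cz: "cs ! i = (c1, z1)" by force
          have dr: "drop i cs = (c1, z1) # cs'" using i cz by (simp add: Cons_nth_drop_Suc[symmetric])
          have pd: "part ((c1, z1) # cs')" using part_drop[OF False, of i] dr by simp
          then have g: "?good c1 z1" by (auto simp: part_def)
          have Pk: "P k ((c1, z1) # cs')" using pd i dr unfolding P_def by (auto intro!: exI[of _ i])
          have "child_tasks v x cs @ l0 = child_tasks v x (take i cs) @ (child_tasks v x (drop i cs) @ l0)"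
            by (simp add: child_tasks_def flip: map_append append_assoc)
          then have "code (child_tasks v x (drop i cs) @ l0) \<le> code (child_tasks v x cs @ l0)"
            using code_append_mono by metis
          then have "code (child_tasks v x ((c1, z1) # cs') @ l0) < 2 ^ ?u 1"
            using cs(3)[OF False] dr u1 by simp
          moreover have "Suc (length cs') \<le> d" using cs(2)[OF False] i by simp
          then have "Suc (length cs') < 2 ^ ?u 1" using d2 u1 by simp
          ultimately have "\<exists>c z. ?good c z \<and> code (child_tasks v x ((c, z) # cs') @ l0) < 2 ^ ?u 1 \<and>
             Suc (length cs') < 2 ^ ?u 1 \<and> (\<forall>t. ?post c z t \<longrightarrow> ?Q t)"
            using g Pk res by blast
          then show ?thesis using False by (simp only: if_False)
        qed
      qed (use eu ur tk[OF part] vs in auto)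
      show ?thesis
      proof (cases m)
        case True
        then show ?thesis using add nop by (intro wp_choice(1)) blast+
      next
        case False
        then obtain i where i: "i \<le> Suc k" "i \<le> length cs" "cs' = drop i cs" using c(5) by (auto simp: P_def)
        show ?thesis
        proof (cases i)
          case 0
          then have "W m (Prim Nop) ?Q ?u" using i by (intro nop) (auto intro!: exI[of _ 0])
          then show ?thesis by (rule wp_choice(3)[OF False])
        next
          case (Suc i')
          then have "W m add_child ?Q ?u" using i by (intro add) auto
          then show ?thesis by (rule wp_choice(2)[OF False])
        qed
      qed
    qed
    have fin: "W m cover Q u" if I: "?I 0 u" for u
    proof -
      obtain cs' where c: "env u" "u 24 = code (child_tasks v x cs' @ l0)" "u 30 = length cs'"
        "eqx {24, 25, 30, 31, 32, 33, 34, 35, 36, 38, 39} ?s u" "P 0 cs'" using I by blast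
      have ur: "u 26 = v" "u 27 = p" "u 1 = s 1" "u 40 = s 40" using c(4) by (simp_all add: eqx_def)
      have part: "part cs'" using c(5) by (simp add: P_def)
      have len: "length cs' = card (fst ` set cs')"
        using part distinct_card[of "map fst cs'"] by (simp add: part_def)
      have finch: "finite (ch A v p)" by (rule finite_subset[of _ "{..<a}"]) (use ch_less in auto)
      show ?thesis
      proof (rule wp_cover[OF c(1) ur(1,2) vs(1,2)])
        fix t assume t: "u 30 = card (ch A v p)" "env t" "eqx {13, 14, 30} u t" "t 30 = 0"
        have "fst ` set cs' = ch A v p"
          by (rule card_subset_eq[OF finch]) (use part t(1) c(3) len in \<open>auto simp: part_def\<close>)
        then have ex: "expansion v p x y cs'" using part by (simp add: part_def expansion_def)
        have po: "post (child_tasks v x cs' @ l0) t"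
          using t c(2) ur unfolding post_def by (simp add: eqx_def)
        show "Q t"
        proof (cases m)
          case True
          then show ?thesis using Q l ex po by simp
        next
          case False
          then have "cs' = cs" using c(5) by (simp add: P_def)
          then show ?thesis using cs(4)[OF False] po by blast
        qed
      next
        assume ne: "u 30 \<noteq> card (ch A v p)"
        show m
        proof (rule ccontr)
          assume False: "\<not> m"
          then have "cs' = cs" using c(5) by (simp add: P_def)
          then show False using cs(1)[OF False] len c(3) ne by (simp add: expansion_def)
        qed
      qed
    qed
    have s2: "env (?s(38 := Suc d))" by (intro env_upd e) (use d2 in auto)
    have loop: "W m (Loop 38 (add_child [+] Prim Nop) ;; cover) Q (?s(38 := Suc d))"
    proof (rule wp_seq, rule wp_loop[where I = ?I])
      have "P (Suc d) []"
        unfolding P_def part_def using cs(2) by (auto intro!: exI[of _ "length cs"])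
      then show "?I ((?s(38 := Suc d)) 38) (?s(38 := Suc d))"
        using s2 z by (intro exI[of _ "[]"]) (auto simp: eqx_def)
    qed (use body fin in blast)+
    show ?thesis
    proof (rule wp_seq, rule wp_copy)
      have "?s 23 = Suc d" using envD[OF e] by simp
      then show "W m (Loop 38 (add_child [+] Prim Nop) ;; cover) Q (?s(38 := ?s 23))" using loop by simp
    qed (use envD[OF e] in simp_all)
  qed
  show ?thesis
    unfolding expand_def
  proof (rule wp_seq, rule wp_pop4[where l = l])
    show "std s" "s 37 = 0" by (rule envD[OF s])+
    show "case l of [] \<Rightarrow> m | (v, p, x, y) # l' \<Rightarrow> W m ?c Q (s(24 := code l', 26 := v, 27 := p, 28 := x, 29 := y))"
    proof (cases l)
      case Nil
      then show ?thesis using Q by (cases m) auto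
    next
      case (Cons t l')
      obtain v p x y where "t = (v, p, x, y)" by (cases t)
      then show ?thesis using main Cons by simp
    qed
  qed (use S in simp_all)
qed

lemma a_pos: "0 < a"
  using tA pA by (auto simp: is_tree_def presents_def)

lemma code_eq_1: "code l = 1 \<longleftrightarrow> l = []"
proof (cases l)
  case (Cons t l')
  obtain v p x y where t: "t = (v, p, x, y)" by (cases t)
  have "Suc n \<le> enc (Suc n) (p # x # y # flat l') * Suc n"
    using enc_pos[of "Suc n" "p # x # y # flat l'"] by (cases "enc (Suc n) (p # x # y # flat l')") auto
  moreover have "code l = enc (Suc n) (p # x # y # flat l') * Suc n + v"
    by (simp only: Cons t flat.simps(2) prod.case enc.simps(2)[of _ v])
  ultimately have "code l \<noteq> 1" using bounds(3) by linarith
  then show ?thesis using Cons by simp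
qed simp

abbreviation main_loop :: com where
  "main_loop \<equiv> Loop 40 (expand [+] Prim Nop) ;; Prim (DecR 24) ;; Prim (ZeroR 24)"

lemma wp_tree_search:
  assumes s: "env s" and z: "s 24 = 0" "s 26 = 0"
    and Q: "if m then \<forall>x<b. code [(0, 0, x, x)] < 2 ^ s 1 \<longrightarrow> W m main_loop Q (s(24 := code [(0, 0, x, x)], 28 := x, 40 := a))
       else \<exists>x<b. code [(0, 0, x, x)] < 2 ^ s 1 \<and> W m main_loop Q (s(24 := code [(0, 0, x, x)], 28 := x, 40 := a))"
  shows "W m tree_search Q s"
proof -
  let ?c3 = "copy 10 40 ;; main_loop" let ?c2 = "push4 24 26 26 28 28 ;; ?c3" let ?c1 = "lt 28 12 ;; ?c2"
  let ?c0 = "guess 28 12 ;; ?c1"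
  have n1: "Suc 0 < 2 ^ s 1" using env_n[OF s, of 1] by simp
  have e0: "env (s(24 := 1))" by (intro env_upd s) (use n1 in auto)
  define P where "P x \<longleftrightarrow> x < b \<and> (\<not> m \<longrightarrow> code [(0, 0, x, x)] < 2 ^ s 1) \<and>
     (code [(0, 0, x, x)] < 2 ^ s 1 \<longrightarrow> W m main_loop Q (s(24 := code [(0, 0, x, x)], 28 := x, 40 := a)))" for x
  have 2: "W m ?c2 Q (s(24 := 1, 28 := x))" if x: "P x" for x
  proof -
    have "x < 2 ^ s 1" using x bounds env_n[OF s, of n] by (auto simp: P_def)
    then have e: "env (s(24 := 1, 28 := x))" by (intro env_upd e0) auto
    have r: "(s(24 := 1, 28 := x)) 26 = 0" "(s(24 := 1, 28 := x)) 28 = x" "(s(24 := 1, 28 := x)) 1 = s 1"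
      using z by simp_all
    show ?thesis
    proof (rule wp_seq, rule wp_push4[where l = "[]"], unfold r)
      show "code [(0, 0, x, x)] < 2 ^ s 1" if "\<not> m" using x that by (simp add: P_def)
      assume c: "code [(0, 0, x, x)] < 2 ^ s 1"
      let ?t = "s(24 := 1, 28 := x, 24 := code [(0, 0, x, x)])"
      have t: "env ?t" by (intro env_upd e) (use c in auto)
      have eq: "?t(40 := ?t 10) = s(24 := code [(0, 0, x, x)], 28 := x, 40 := a)"
        using envD[OF s] by (auto simp: fun_eq_iff)
      show "W m ?c3 Q ?t"
      proof (rule wp_seq, rule wp_copy)
        show "W m main_loop Q (?t(40 := ?t 10))" unfolding eq using x c by (simp add: P_def)
      qed (use envD[OF t] in simp_all)
    qed (use envD[OF e] in simp_all)
  qed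
  have 1: "W m ?c1 Q (s(24 := 1, 28 := x))" if x: "x \<le> b" "x < b \<Longrightarrow> P x" "m \<or> x < b" for x
  proof (rule wp_seq, rule wp_lt)
    have "x < 2 ^ s 1" using x bounds env_n[OF s, of n] by auto
    then have e: "env (s(24 := 1, 28 := x))" by (intro env_upd e0) auto
    show "fits (s(24 := 1, 28 := x))" "(s(24 := 1, 28 := x)) 2 = 0" "(s(24 := 1, 28 := x)) 3 = 0"
      "(s(24 := 1, 28 := x)) 4 = 0" by (rule envD[OF e])+
    assume "(s(24 := 1, 28 := x)) 28 < (s(24 := 1, 28 := x)) 12"
    then show "W m ?c2 Q (s(24 := 1, 28 := x))" using x 2 envD[OF s] by simp
  next
    assume "\<not> (s(24 := 1, 28 := x)) 28 < (s(24 := 1, 28 := x)) 12"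
    then show m using x envD[OF s] by simp
  qed simp_all
  have 0: "W m ?c0 Q (s(24 := 1))"
  proof (rule wp_seq, rule wp_guess)
    show "fits (s(24 := 1))" "(s(24 := 1)) 2 = 0" "(s(24 := 1)) 3 = 0" by (rule envD[OF e0])+
    have r: "(s(24 := 1)) 12 = b" using envD[OF s] by simp
    show "if m then \<forall>x\<le>(s(24 := 1)) 12. W m ?c1 Q (s(24 := 1, 28 := x))
      else \<exists>x\<le>(s(24 := 1)) 12. W m ?c1 Q (s(24 := 1, 28 := x))"
    proof (cases m)
      case True
      then have "\<forall>x\<le>b. W m ?c1 Q (s(24 := 1, 28 := x))" using Q 1 by (simp add: P_def)
      then show ?thesis unfolding r using True by (simp only: if_True)
    next
      case False
      then obtain x where x: "x < b" "P x" using Q by (auto simp: P_def)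
      then have "W m ?c1 Q (s(24 := 1, 28 := x))" by (intro 1) auto
      then have "\<exists>x\<le>b. W m ?c1 Q (s(24 := 1, 28 := x))" using x(1) by (auto intro!: exI[of _ x])
      then show ?thesis unfolding r using False by (simp only: if_False)
    qed
  qed simp_all
  show ?thesis
    unfolding tree_search_def
  proof (rule wp_seq, rule wp_inc)
    have "s(24 := Suc (s 24)) = s(24 := 1)" using z by simp
    then show "W m ?c0 Q (s(24 := Suc (s 24)))" using 0 by (simp only:)
  qed (use z n1 in auto)
qed

abbreviation task_emb :: "nat \<times> nat \<times> nat \<times> nat \<Rightarrow> bool" where
  "task_emb \<equiv> \<lambda>(v, p, x, y). emb A T v p x y"

lemma must_search:
  assumes s: "env s" and z: "s 24 = 0" "s 26 = 0" "s 30 = 0"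
    and \<phi>: "\<And>x. x < b \<Longrightarrow> emb A T 0 0 x x \<Longrightarrow> \<phi>"
  shows "W True tree_search (\<lambda>_. \<phi>) s"
proof (rule wp_tree_search[OF s z(1,2)])
  have "W True main_loop (\<lambda>_. \<phi>) (s(24 := code [(0, 0, x, x)], 28 := x, 40 := a))"
    if x: "x < b" "code [(0, 0, x, x)] < 2 ^ s 1" for x
  proof (rule wp_seq)
    let ?s = "s(24 := code [(0, 0, x, x)], 28 := x, 40 := a)"
    \<comment> \<open>The invariant reasons backwards: embeddings for all tasks on the stack would
      give one for the root task. Expanding a task preserves this by \<open>expansion_emb\<close>,
      and the empty stack leaves nothing to assume.\<close>
    let ?I = "\<lambda>k u. k \<le> a \<and> env u \<and> u 30 = 0 \<and> (\<exists>l. u 24 = code l \<and> tasks l \<and>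
       ((\<forall>t\<in>set l. task_emb t) \<longrightarrow> emb A T 0 0 x x))"
    have lt: "x < 2 ^ s 1" "a < 2 ^ s 1" using x bounds env_n[OF s, of n] by auto
    show "W True (Loop 40 (expand [+] Prim Nop)) (W True (Prim (DecR 24) ;; Prim (ZeroR 24)) (\<lambda>_. \<phi>)) ?s"
    proof (rule wp_loop[where I = ?I])
      have "env ?s" by (intro env_upd s) (use lt x in auto)
      then show "?I (?s 40) ?s" using z x a_pos by (auto intro!: exI[of _ "[(0, 0, x, x)]"])
    next
      fix k u assume I: "?I (Suc k) u"
      let ?Q = "\<lambda>u. u 40 = k \<and> ?I k u"
      obtain l where l: "u 24 = code l" "tasks l" "(\<forall>t\<in>set l. task_emb t) \<longrightarrow> emb A T 0 0 x x" using I by blast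
      have "k < 2 ^ u 1" using I bounds env_n[of u n] by auto
      then have e: "env (u(40 := k))" by (intro env_upd) (use I in auto)
      have "W True (Prim Nop) ?Q (u(40 := k))"
        by (rule wp_nop) (use e I l in auto)
      moreover have "W True expand ?Q (u(40 := k))"
      proof (rule wp_expand[OF e, where l = l])
        have "?Q t" if c: "l = (v, p, x', y) # l0" "expansion v p x' y cs"
           "env t \<and> t 24 = code (child_tasks v x' cs @ l0) \<and> t 30 = 0 \<and> t 1 = (u(40 := k)) 1 \<and> t 40 = (u(40 := k)) 40"
          for v p x' y l0 cs t
        proof -
          let ?l = "child_tasks v x' cs @ l0"
          have mem: "c < a \<and> z < b" if "(c, z) \<in> set cs" for c z
          proof -
            have "c \<in> ch A v p" "z \<in> ch T x' y"
              using \<open>expansion v p x' y cs\<close> that image_eqI[of c fst "(c, z)"] image_eqI[of z snd "(c, z)"]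
              unfolding expansion_def by auto
            then show ?thesis using ch_less by blast
          qed
          have "v < a" "x' < b" "tasks l0" using l(2) c(1) by auto
          then have tl: "tasks ?l" using mem by (auto simp: tasks_def child_tasks_def)
          have "emb A T 0 0 x x" if all: "\<forall>t\<in>set ?l. task_emb t"
          proof -
            have "emb A T v p x' y"
            proof (rule expansion_emb[OF c(2)])
              fix c z assume "(c, z) \<in> set cs"
              then have "(c, v, z, x') \<in> set ?l" by (force simp: child_tasks_def)
              then show "emb A T c v z x'" using all by force
            qed
            then show ?thesis using l(3) c(1) all by auto
          qed
          then show ?thesis using c(3) tl I by auto
        qed
        then show "if True then \<forall>v p x y l0 cs t. l = (v, p, x, y) # l0 \<longrightarrow> expansion v p x y cs \<longrightarrow>
            env t \<and> t 24 = code (child_tasks v x cs @ l0) \<and> t 30 = 0 \<and> t 1 = (u(40 := k)) 1 \<and> t 40 = (u(40 := k)) 40 \<longrightarrow> ?Q t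
          else \<exists>v p x y l0 cs. l = (v, p, x, y) # l0 \<and> expansion v p x y cs \<and> length cs \<le> d \<and>
            code (child_tasks v x cs @ l0) < 2 ^ (u(40 := k)) 1 \<and> (\<forall>t. env t \<and> t 24 = code (child_tasks v x cs @ l0) \<and>
              t 30 = 0 \<and> t 1 = (u(40 := k)) 1 \<and> t 40 = (u(40 := k)) 40 \<longrightarrow> ?Q t)"
          unfolding if_True by blast
      qed (use l I in auto)
      ultimately show "W True (expand [+] Prim Nop) ?Q (u(40 := k))" by (intro wp_choice(1))
    next
      fix u assume I: "?I 0 u"
      then obtain l where l: "u 24 = code l" "(\<forall>t\<in>set l. task_emb t) \<longrightarrow> emb A T 0 0 x x" by blast
      show "W True (Prim (DecR 24) ;; Prim (ZeroR 24)) (\<lambda>_. \<phi>) u"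
      proof (rule wp_seq, rule wp_dec)
        assume pos: "0 < u 24"
        show "W True (Prim (ZeroR 24)) (\<lambda>_. \<phi>) (u(24 := u 24 - 1))"
        proof (rule wp_zero)
          assume "(u(24 := u 24 - 1)) 24 = 0"
          then have "u 24 = 1" using pos by simp
          then have "l = []" unfolding l(1) code_eq_1 .
          then show \<phi> using l(2) \<phi>[OF x(1)] by simp
        qed simp
      qed simp
    qed
  qed
  then show "if True then \<forall>x<b. code [(0, 0, x, x)] < 2 ^ s 1 \<longrightarrow> W True main_loop (\<lambda>_. \<phi>) (s(24 := code [(0, 0, x, x)], 28 := x, 40 := a))
    else \<exists>x<b. code [(0, 0, x, x)] < 2 ^ s 1 \<and> W True main_loop (\<lambda>_. \<phi>) (s(24 := code [(0, 0, x, x)], 28 := x, 40 := a))"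
    by simp
qed

text \<open>The run follows \<open>f\<close>: it guesses the values of \<open>f\<close> as images
  and pushes the children in the order supplied by \<open>fit_stack_expand\<close>, which keeps the
  stack within the capacity.\<close>

lemma may_search:
  assumes s: "env s" and z: "s 24 = 0" "s 26 = 0" "s 30 = 0"
    and cap: "\<And>l. tasks l \<Longrightarrow> length l \<le> d * floor_log a + 1 \<Longrightarrow> code l < 2 ^ s 1"
    and f: "inj_on f (nodes A)" "f ` nodes A \<subseteq> nodes T"
      "\<And>u v. u \<in> nodes A \<Longrightarrow> v \<in> nodes A \<Longrightarrow> {u, v} \<in> edges A \<Longrightarrow> {f u, f v} \<in> edges T"
  shows "W False tree_search (\<lambda>_. True) s"
proof -
  have nA: "nodes A = {..<a}" and nT: "nodes T = {..<b}" using pA pT by (auto simp: presents_def)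
  obtain par dep where "rooted A 0 par dep" using tree_rooted[OF tA, of 0] nA a_pos by auto
  then interpret A: rooted_tree A 0 par dep by unfold_locales
  let ?H = "d * floor_log a + 1"
  define task where "task v = (v, A.pa v, f v, f (A.pa v))" for v
  have pan: "A.pa v \<in> nodes A" if "v \<in> nodes A" for v
    using that A.par(1) A.root(1) by (simp add: A.pa_def)
  have fbd: "f v < b" if "v \<in> nodes A" for v using f(2) nT that by auto
  have tasks_map: "tasks (map task vs)" if "set vs \<subseteq> nodes A" for vs
  proof -
    have "v < a \<and> A.pa v < a \<and> f v < b \<and> f (A.pa v) < b" if "v \<in> nodes A" for v
      using that pan[OF that] fbd[OF that] fbd[OF pan[OF that]] nA by simp
    then show ?thesis using that by (induction vs) (simp_all add: task_def)
  qed
  have fb: "f 0 < b" using f(2) nA nT a_pos by auto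
  have t0: "map task [0] = [(0, 0, f 0, f 0)]" by (simp add: task_def A.pa_def)
  have szr: "card (A.sub 0) = a" using A.sub_root nA by simp
  let ?sz = "\<lambda>v. card (A.sub v)"
  have c0: "code [(0, 0, f 0, f 0)] < 2 ^ s 1"
    by (rule cap) (use fb a_pos in auto)
  let ?s = "s(24 := code [(0, 0, f 0, f 0)], 28 := f 0, 40 := a)"
  \<comment> \<open>The stack lists the nodes whose subtrees are still to be mapped. Their total
    size is at most the number of rounds left, so the stack is empty in the end.\<close>
  let ?I = "\<lambda>k u. k \<le> a \<and> env u \<and> u 30 = 0 \<and> u 1 = s 1 \<and> (\<exists>vs. u 24 = code (map task vs) \<and>
     set vs \<subseteq> nodes A \<and> sum_list (map ?sz vs) \<le> k \<and> A.fit_stack d ?H vs)"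
  have "W False main_loop (\<lambda>_. True) ?s"
  proof (rule wp_seq, rule wp_loop[where I = ?I])
    have "f 0 < 2 ^ s 1" "a < 2 ^ s 1" using fb bounds env_n[OF s, of n] by auto
    then have "env ?s" by (intro env_upd s) (use c0 in auto)
    then show "?I (?s 40) ?s"
      using z t0 szr A.root(1) by (auto intro!: exI[of _ "[0]"] simp: A.weight_def)
  next
    fix k u assume I: "?I (Suc k) u"
    let ?Q = "\<lambda>u. u 40 = k \<and> ?I k u"
    obtain vs where vs: "u 24 = code (map task vs)" "set vs \<subseteq> nodes A" "sum_list (map ?sz vs) \<le> Suc k"
       "A.fit_stack d ?H vs" using I by blast
    have "k < 2 ^ u 1" using I bounds env_n[of u n] by auto
    then have e: "env (u(40 := k))" by (intro env_upd) (use I in auto)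
    show "W False (expand [+] Prim Nop) ?Q (u(40 := k))"
    proof (cases vs)
      case Nil
      then have "W False (Prim Nop) ?Q (u(40 := k))"
        by (intro wp_nop) (use e I vs in \<open>auto intro!: exI[of _ "[]"]\<close>)
      then show ?thesis by (intro wp_choice(3)) auto
    next
      case (Cons v vs')
      have v: "v \<in> nodes A" using vs(2) Cons by simp
      have chv: "ch A v (A.pa v) = A.children v" by (rule A.ch_pa[OF v])
      have cd: "card (A.children v) \<le> d"
      proof -
        have "inj_on (\<lambda>c. {v, c}) (A.children v)" by (rule inj_onI) (auto simp: doubleton_eq_iff)
        then have "card (A.children v) = card ((\<lambda>c. {v, c}) ` A.children v)" by (simp add: card_image)
        also have "\<dots> \<le> degree A v"
          unfolding degree_def
        proof (rule card_mono)
          show "finite {e \<in> edges A. v \<in> e}" using A.edges_eq A.finite_nodes by simp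
          show "(\<lambda>c. {v, c}) ` A.children v \<subseteq> {e \<in> edges A. v \<in> e}"
            using chv unfolding ch_def by auto
        qed
        also have "\<dots> \<le> d" using deg v by (simp add: max_degree_le_def)
        finally show ?thesis .
      qed
      obtain xs where xs: "distinct xs" "set xs = A.children v" "A.fit_stack d ?H (xs @ vs')"
        using A.fit_stack_expand[OF v _ cd, of ?H vs'] vs(4) Cons by auto
      let ?cs = "map (\<lambda>c. (c, f c)) xs"
      have xn: "set xs \<subseteq> nodes A" using xs(2) A.children_nodes(1) by auto
      have ex: "expansion v (A.pa v) (f v) (f (A.pa v)) ?cs"
        unfolding expansion_def
      proof (intro conjI)
        show "distinct (map fst ?cs)" using xs(1) by (simp add: comp_def)
        show "distinct (map snd ?cs)" using xs(1) inj_on_subset[OF f(1) xn] by (simp add: comp_def distinct_map)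
        show "fst ` set ?cs = ch A v (A.pa v)" using xs(2) chv by (simp add: image_image)
        show "snd ` set ?cs \<subseteq> ch T (f v) (f (A.pa v))"
        proof
          fix y assume "y \<in> snd ` set ?cs"
          then obtain c where c: "c \<in> A.children v" "y = f c" using xs(2) by auto
          then have e: "{v, c} \<in> edges A" "c \<noteq> A.pa v" using chv unfolding ch_def by blast+
          have cn: "c \<in> nodes A" using A.children_nodes(1) c(1) by blast
          then have "f c \<noteq> f (A.pa v)" using f(1) e(2) pan[OF v] by (auto dest: inj_onD)
          then show "y \<in> ch T (f v) (f (A.pa v))" using f(3)[OF v cn e(1)] c(2) by (simp add: ch_def)
        qed
      qed
      have ct: "child_tasks v (f v) ?cs @ map task vs' = map task (xs @ vs')"
        using xs(2) A.children_nodes(2) by (auto simp: child_tasks_def task_def)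
      have sub: "set (xs @ vs') \<subseteq> nodes A" using xn vs(2) Cons by auto
      have lenH: "length (xs @ vs') \<le> ?H" by (rule A.fit_stack_length[OF xs(3)])
      have cc: "code (map task (xs @ vs')) < 2 ^ s 1"
        by (rule cap[OF tasks_map[OF sub]]) (use lenH in simp)
      have sum: "sum_list (map ?sz (xs @ vs')) \<le> k"
        using A.sum_list_children[OF v xs(1,2)] vs(3) Cons by simp
      have "W False expand ?Q (u(40 := k))"
      proof (rule wp_expand[OF e, where l = "map task vs"])
        let ?post = "\<lambda>t. env t \<and> t 24 = code (child_tasks v (f v) ?cs @ map task vs') \<and> t 30 = 0 \<and>
          t 1 = (u(40 := k)) 1 \<and> t 40 = (u(40 := k)) 40"
        have "map task vs = (v, A.pa v, f v, f (A.pa v)) # map task vs'" using Cons by (simp add: task_def)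
        moreover have "length ?cs \<le> d" using cd xs(1,2) distinct_card[of xs] by simp
        moreover have "code (child_tasks v (f v) ?cs @ map task vs') < 2 ^ (u(40 := k)) 1"
          unfolding ct using cc I by simp
        moreover have "\<forall>t. ?post t \<longrightarrow> ?Q t"
          unfolding ct
        proof (intro allI impI, elim conjE)
          fix t assume t: "env t" "t 24 = code (map task (xs @ vs'))" "t 30 = 0" "t 1 = (u(40 := k)) 1"
            "t 40 = (u(40 := k)) 40"
          have "\<exists>vs. t 24 = code (map task vs) \<and> set vs \<subseteq> nodes A \<and> sum_list (map ?sz vs) \<le> k \<and>
              A.fit_stack d ?H vs"
            using t(2) sub sum xs(3) by blast
          moreover have "k \<le> a" "u 1 = s 1" using I by auto
          ultimately show "?Q t" using t by (intro conjI) simp_all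
        qed
        ultimately have "\<exists>v p x y l0 cs. map task vs = (v, p, x, y) # l0 \<and> expansion v p x y cs \<and> length cs \<le> d \<and>
            code (child_tasks v x cs @ l0) < 2 ^ (u(40 := k)) 1 \<and> (\<forall>t. env t \<and> t 24 = code (child_tasks v x cs @ l0) \<and>
              t 30 = 0 \<and> t 1 = (u(40 := k)) 1 \<and> t 40 = (u(40 := k)) 40 \<longrightarrow> ?Q t)"
          using ex by (intro exI[of _ v] exI[of _ "A.pa v"] exI[of _ "f v"] exI[of _ "f (A.pa v)"]
              exI[of _ "map task vs'"] exI[of _ ?cs] conjI)
        then show "if False then \<forall>v p x y l0 cs t. map task vs = (v, p, x, y) # l0 \<longrightarrow> expansion v p x y cs \<longrightarrow>
            env t \<and> t 24 = code (child_tasks v x cs @ l0) \<and> t 30 = 0 \<and> t 1 = (u(40 := k)) 1 \<and> t 40 = (u(40 := k)) 40 \<longrightarrow> ?Q t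
          else \<exists>v p x y l0 cs. map task vs = (v, p, x, y) # l0 \<and> expansion v p x y cs \<and> length cs \<le> d \<and>
            code (child_tasks v x cs @ l0) < 2 ^ (u(40 := k)) 1 \<and> (\<forall>t. env t \<and> t 24 = code (child_tasks v x cs @ l0) \<and>
              t 30 = 0 \<and> t 1 = (u(40 := k)) 1 \<and> t 40 = (u(40 := k)) 40 \<longrightarrow> ?Q t)"
          unfolding if_False .
      qed (use vs tasks_map I in auto)
      then show ?thesis by (intro wp_choice(2)) auto
    qed
  next
    fix u assume I: "?I 0 u"
    then obtain vs where vs: "u 24 = code (map task vs)" "set vs \<subseteq> nodes A" "sum_list (map ?sz vs) \<le> 0" by blast
    have "vs = []"
    proof (cases vs)
      case (Cons v vs')
      then show ?thesis using vs(2,3) A.card_sub_pos[of v] by simp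
    qed simp
    then have "u 24 = 1" using vs(1) by simp
    then show "W False (Prim (DecR 24) ;; Prim (ZeroR 24)) (\<lambda>_. True) u"
      by (intro wp_seq wp_dec wp_zero) auto
  qed
  then have "\<exists>x<b. code [(0, 0, x, x)] < 2 ^ s 1 \<and>
      W False main_loop (\<lambda>_. True) (s(24 := code [(0, 0, x, x)], 28 := x, 40 := a))"
    using fb c0 by blast
  then show ?thesis
    by (intro wp_tree_search[OF s z(1,2)]) (simp only: if_False)
qed

end

section \<open>The decision procedure\<close>

primrec grows :: "nat \<Rightarrow> com" where
  "grows 0 = Prim Nop"
| "grows (Suc k) = Prim GrowT ;; grows k"

primrec incs :: "nat \<Rightarrow> nat \<Rightarrow> com" where
  "incs 0 r = Prim Nop"
| "incs (Suc k) r = Prim (IncR r) ;; incs k r"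

text \<open>Running the head over the input counts \<open>n + 1\<close> moves in register 7. A full
  counter is the signal to add a cell, so the tapes get the binary length of the count; register 8
  repeats this length, since programs have no access to register 1.\<close>

definition measure_input :: com where
  "measure_input = Loop 0 (Prim (IncR 7) [+] (Prim (FullR 7) ;; Prim GrowT ;; Prim (IncR 8) ;; Prim (IncR 7)))"

text \<open>The tapes grow while loops with registers on them are running. This is harmless, as an
  appended bit is a leading 0.\<close>

definition stretch :: "nat \<Rightarrow> com" where
  "stretch c = copy 8 9 ;; Loop 9 (copy 8 10 ;; Loop 10 (grows c))"

text \<open>The total length is \<open>(a * a + a + 1) + (b * b + b + 1)\<close>; the second
  increment of register 13 is due to register 7 holding \<open>n + 1\<close>. Different sizes may
  give the same total; the test of the headers settles which ones are meant.\<close>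

definition parse :: com where
  "parse = guess 10 7 ;; guess 12 7 ;; addmul 10 10 11 ;; add 10 11 ;; Prim (IncR 11) ;;
     add 11 13 ;; addmul 12 12 13 ;; add 12 13 ;; Prim (IncR 13) ;; Prim (IncR 13) ;; eq 13 7 ;; clear 13"

definition decide :: "nat \<Rightarrow> com" where
  "decide d = measure_input ;; stretch (4 * d + 5) ;; incs (Suc d) 23 ;; parse ;;
     graph_check 9 10 ;; graph_check 11 12 ;; tree_search"

definition bits :: "nat \<Rightarrow> nat" where
  "bits n = Suc (floor_log (Suc n))"

text \<open>
  A stack of at most \<open>d (bits n) + 1\<close> tasks has at most \<open>4 (d (bits n) + 1) + 1\<close> digits of
  \<open>bits n\<close> bits each.
\<close>

definition cells_used :: "nat \<Rightarrow> nat \<Rightarrow> nat" where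
  "cells_used d n = bits n + bits n * bits n * (4 * d + 5)"

lemma bits_less: "Suc n < 2 ^ bits n"
  using floor_log_exp2_gt[of "Suc n"] by (simp add: bits_def)

lemma cells_used_bounds: "bits n \<le> cells_used d n" "Suc n < 2 ^ cells_used d n"
  "bits n < 2 ^ cells_used d n" "Suc d < 2 ^ cells_used d n"
proof -
  show bl: "bits n \<le> cells_used d n" by (simp add: cells_used_def)
  have le: "(2::nat) ^ bits n \<le> 2 ^ cells_used d n" using bl by (intro power_increasing) auto
  show "Suc n < 2 ^ cells_used d n" using bits_less[of n] le by linarith
  show "bits n < 2 ^ cells_used d n" using less_exp[of "bits n"] le by linarith
  have "bits n \<ge> 1" by (simp add: bits_def)
  then have "4 * d + 5 \<le> bits n * bits n * (4 * d + 5)" by simp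
  then have "Suc d \<le> cells_used d n" unfolding cells_used_def by linarith
  then show "Suc d < 2 ^ cells_used d n" using less_exp[of "cells_used d n"] by linarith
qed

section \<open>Correctness of measuring, stretching and parsing\<close>

context input
begin

lemma wp_full: "r \<noteq> 0 \<Longrightarrow> (Suc (s r) = 2 ^ s 1 \<Longrightarrow> Q s) \<Longrightarrow> (Suc (s r) \<noteq> 2 ^ s 1 \<Longrightarrow> m) \<Longrightarrow> W m (Prim (FullR r)) Q s"
  by (auto simp: wp.simps room_def)

lemma wp_grow: "s 1 < B \<Longrightarrow> Q (s(1 := Suc (s 1))) \<Longrightarrow> W m (Prim GrowT) Q s"
  by (simp add: wp.simps)

lemma wp_grows: "s 1 + k \<le> B \<Longrightarrow> Q (s(1 := s 1 + k)) \<Longrightarrow> W m (grows k) Q s"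
proof (induction k arbitrary: s)
  case 0
  then show ?case by (auto intro!: wp_nop)
next
  case (Suc k)
  have "W m (grows k) Q (s(1 := Suc (s 1)))"
  proof (rule Suc.IH)
    have "(s(1 := Suc (s 1)))(1 := (s(1 := Suc (s 1))) 1 + k) = s(1 := s 1 + Suc k)"
      by (simp add: fun_eq_iff)
    then show "Q ((s(1 := Suc (s 1)))(1 := (s(1 := Suc (s 1))) 1 + k))" using Suc.prems(2) by (simp only:)
  qed (use Suc.prems(1) in simp)
  then show ?case using Suc.prems by (auto intro!: wp_seq wp_grow)
qed

lemma wp_incs: "s r + k < 2 ^ s 1 \<or> m \<Longrightarrow> 2 \<le> r \<Longrightarrow> s r < 2 ^ s 1 \<Longrightarrow>
    (s r + k < 2 ^ s 1 \<Longrightarrow> Q (s(r := s r + k))) \<Longrightarrow> W m (incs k r) Q s"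
proof (induction k arbitrary: s)
  case 0
  then show ?case by (auto intro!: wp_nop)
next
  case (Suc k)
  have "W m (incs k r) Q (s(r := Suc (s r)))" if "Suc (s r) < 2 ^ s 1"
  proof (rule Suc.IH)
    assume "(s(r := Suc (s r))) r + k < 2 ^ (s(r := Suc (s r))) 1"
    then have "s r + Suc k < 2 ^ s 1" using Suc.prems(2) by simp
    moreover have "(s(r := Suc (s r)))(r := (s(r := Suc (s r))) r + k) = s(r := s r + Suc k)"
      by (simp add: fun_eq_iff)
    ultimately show "Q ((s(r := Suc (s r)))(r := (s(r := Suc (s r))) r + k))"
      using Suc.prems(4) by (simp only:)
  qed (use Suc.prems that in auto)
  then show ?case using Suc.prems by (auto intro!: wp_seq wp_inc)
qed

abbreviation base :: "nat \<Rightarrow> nat \<Rightarrow> nat \<Rightarrow> nat \<Rightarrow> nat \<Rightarrow> nat" where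
  "base k L x l \<equiv> (\<lambda>_. 0)(0 := k, 1 := L, 7 := x, 8 := l)"

lemma wp_measure:
  assumes B: "bits n \<le> B" and Q: "Q (base 0 (bits n) (Suc n) (bits n))"
  shows "W m measure_input Q ((\<lambda>_. 0)(0 := Suc n))"
  unfolding measure_input_def
\<comment> \<open>\<open>L\<close> is the binary length of the count \<open>Suc n - k\<close>, where
  the count 0 has length 0.\<close>
proof (rule wp_loop[where I = "\<lambda>k u. \<exists>L. u = base k L (Suc n - k) L \<and> k \<le> Suc n \<and> Suc n - k < 2 ^ L \<and>
    (L = 0 \<and> k = Suc n \<or> L \<ge> 1 \<and> 2 ^ (L - 1) \<le> Suc n - k)"])
  show "\<exists>L. (\<lambda>_. 0)(0 := Suc n) = base (((\<lambda>_. 0)(0 := Suc n)) 0) L (Suc n - ((\<lambda>_. 0)(0 := Suc n)) 0) L \<and>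
    ((\<lambda>_. 0)(0 := Suc n)) 0 \<le> Suc n \<and> Suc n - ((\<lambda>_. 0)(0 := Suc n)) 0 < 2 ^ L \<and>
    (L = 0 \<and> ((\<lambda>_. 0)(0 := Suc n)) 0 = Suc n \<or> L \<ge> 1 \<and> 2 ^ (L - 1) \<le> Suc n - ((\<lambda>_. 0)(0 := Suc n)) 0)"
    by (rule exI[of _ 0]) (auto simp: fun_eq_iff)
next
  fix k u
  assume "\<exists>L. u = base (Suc k) L (Suc n - Suc k) L \<and> Suc k \<le> Suc n \<and> Suc n - Suc k < 2 ^ L \<and>
    (L = 0 \<and> Suc k = Suc n \<or> L \<ge> 1 \<and> 2 ^ (L - 1) \<le> Suc n - Suc k)"
  then obtain L where L: "u = base (Suc k) L (Suc n - Suc k) L" "Suc k \<le> Suc n" "Suc n - Suc k < 2 ^ L"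
    "L = 0 \<and> Suc k = Suc n \<or> L \<ge> 1 \<and> 2 ^ (L - 1) \<le> Suc n - Suc k" by blast
  let ?Q = "\<lambda>u. u 0 = k \<and> (\<exists>L. u = base k L (Suc n - k) L \<and> k \<le> Suc n \<and> Suc n - k < 2 ^ L \<and>
    (L = 0 \<and> k = Suc n \<or> L \<ge> 1 \<and> 2 ^ (L - 1) \<le> Suc n - k))"
  let ?u = "base k L (n - k) L"
  have u: "u(0 := k) = ?u" unfolding L(1) by (auto simp: fun_eq_iff)
  have sk: "Suc n - k = Suc (n - k)" using L(2) by simp
  have 1: "W m (Prim (IncR 7)) ?Q ?u" if "m \<or> Suc (n - k) < 2 ^ L"
  proof (rule wp_inc)
    assume "Suc (?u 7) < 2 ^ ?u 1"
    then have lt: "Suc (n - k) < 2 ^ L" by simp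
    then have "L \<noteq> 0" by (cases L) auto
    then have "base k L (Suc n - k) L = base k L (Suc n - k) L \<and> k \<le> Suc n \<and> Suc n - k < 2 ^ L \<and>
      (L = 0 \<and> k = Suc n \<or> L \<ge> 1 \<and> 2 ^ (L - 1) \<le> Suc n - k)" using lt L(2,4) sk by auto
    moreover have "?u(7 := Suc (?u 7)) = base k L (Suc n - k) L" unfolding sk by (auto simp: fun_eq_iff)
    ultimately show "?Q (?u(7 := Suc (?u 7)))" by (metis (no_types, lifting) fun_upd_same fun_upd_other zero_neq_numeral zero_neq_one)
  qed (use that in auto)
  have 2: "W m (Prim (FullR 7) ;; Prim GrowT ;; Prim (IncR 8) ;; Prim (IncR 7)) ?Q ?u"
    if c: "m \<or> Suc (n - k) = 2 ^ L"
  proof (rule wp_seq, rule wp_full)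
    assume "Suc (?u 7) = 2 ^ ?u 1"
    then have e: "Suc (n - k) = 2 ^ L" by simp
    \<comment> \<open>A counter that is full at length \<open>L\<close> is about to take the value
      \<open>2 ^ L\<close>, which is at most \<open>n + 1\<close>.\<close>
    have "L \<le> floor_log (Suc n)" using e by (intro floor_log_le_iff[of "2 ^ L" "Suc n", simplified]) auto
    then have LB: "L < B" using B by (simp add: bits_def)
    have lt: "Suc L < 2 ^ Suc L" by (rule less_exp)
    let ?v = "base k (Suc L) (Suc n - k) (Suc L)"
    have v: "?u(1 := Suc L, 8 := Suc L, 7 := Suc (n - k)) = ?v" unfolding sk by (auto simp: fun_eq_iff)
    have "?v = base k (Suc L) (Suc n - k) (Suc L) \<and> k \<le> Suc n \<and> Suc n - k < 2 ^ Suc L \<and>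
      (Suc L = 0 \<and> k = Suc n \<or> Suc L \<ge> 1 \<and> 2 ^ (Suc L - 1) \<le> Suc n - k)" using e L(2) unfolding sk by auto
    then have Qv: "?Q ?v" by (intro conjI exI[of _ "Suc L"]) auto
    show "W m (Prim GrowT ;; Prim (IncR 8) ;; Prim (IncR 7)) ?Q ?u"
      by (intro wp_seq wp_grow wp_inc) (use LB lt e v Qv in auto)
  qed (use c in auto)
  show "W m (Prim (IncR 7) [+] (Prim (FullR 7) ;; Prim GrowT ;; Prim (IncR 8) ;; Prim (IncR 7))) ?Q (u(0 := k))"
    unfolding u
  proof (cases m)
    case True
    then show "W m (Prim (IncR 7) [+] (Prim (FullR 7) ;; Prim GrowT ;; Prim (IncR 8) ;; Prim (IncR 7))) ?Q ?u"
      using 1 2 by (intro wp_choice(1)) blast+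
  next
    case False
    have "Suc (n - k) < 2 ^ L \<or> Suc (n - k) = 2 ^ L" using L(3) by auto
    then show "W m (Prim (IncR 7) [+] (Prim (FullR 7) ;; Prim GrowT ;; Prim (IncR 8) ;; Prim (IncR 7))) ?Q ?u"
      using 1 2 wp_choice(2,3)[OF False] by blast
  qed
next
  fix u
  assume "\<exists>L. u = base 0 L (Suc n - 0) L \<and> 0 \<le> Suc n \<and> Suc n - 0 < 2 ^ L \<and>
    (L = 0 \<and> 0 = Suc n \<or> L \<ge> 1 \<and> 2 ^ (L - 1) \<le> Suc n - 0)"
  then obtain L where L: "u = base 0 L (Suc n) L" "Suc n < 2 ^ L" "L \<ge> 1" "2 ^ (L - 1) \<le> Suc n" by auto
  have "floor_log (Suc n) = L - 1"
    by (rule floor_log_eqI) (use L in \<open>auto simp flip: power_Suc\<close>)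
  then have "L = bits n" using L(3) by (simp add: bits_def)
  then show "Q u" using L(1) Q by simp
qed

lemma wp_stretch:
  assumes B: "bits n + bits n * bits n * c \<le> B"
    and Q: "Q (base 0 (bits n + bits n * bits n * c) (Suc n) (bits n))"
  shows "W m (stretch c) Q (base 0 (bits n) (Suc n) (bits n))"
proof -
  define l where "l = bits n"
  have nl: "Suc n < 2 ^ l" using bits_less by (simp add: l_def)
  have ll: "l < 2 ^ l" by (rule less_exp)
  have mono: "x < 2 ^ (l + y)" if "x < 2 ^ l" for x y :: nat
    using that by (simp add: power_add less_le_trans)
  let ?st = "\<lambda>g k j. (base 0 (l + g * c) (Suc n) l)(9 := k, 10 := j)"
  have fits: "fits (?st g k j)" if "k \<le> l" "j \<le> l" for g k j
    using that mono[OF nl, of "g * c"] mono[OF ll, of "g * c"] by (auto simp: fits_def)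
  have inner: "W m (copy 8 10 ;; Loop 10 (grows c)) Q' (?st g k 0)"
    if k: "k \<le> l" and g: "g + l \<le> l * l" and Q': "Q' (?st (g + l) k 0)" for g k Q'
  proof (rule wp_seq, rule wp_copy)
    have e: "(?st g k 0)(10 := (?st g k 0) 8) = ?st g k l" by (auto simp: fun_eq_iff)
    show "W m (Loop 10 (grows c)) Q' ((?st g k 0)(10 := (?st g k 0) 8))"
      unfolding e
    proof (rule wp_loop[where I = "\<lambda>j u. j \<le> l \<and> u = ?st (g + (l - j)) k j"])
      fix j u assume u: "Suc j \<le> l \<and> u = ?st (g + (l - Suc j)) k (Suc j)"
      have sj: "l - j = Suc (l - Suc j)" using u by auto
      have le: "g + (l - j) \<le> l * l" using g by linarith
      have "(g + (l - j)) * c \<le> l * l * c" using le by (rule mult_le_mono1)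
      then have "l + (g + (l - j)) * c \<le> B" using B unfolding l_def[symmetric] by linarith
      then have b: "l + (g + (l - Suc j)) * c + c \<le> B" unfolding sj by (simp add: algebra_simps)
      have e2: "(u(10 := j))(1 := (u(10 := j)) 1 + c) = ?st (g + (l - j)) k j"
        using u unfolding sj by (auto simp: fun_eq_iff)
      show "W m (grows c) (\<lambda>u. u 10 = j \<and> j \<le> l \<and> u = ?st (g + (l - j)) k j) (u(10 := j))"
      proof (rule wp_grows)
        show "(u(10 := j)) 1 + c \<le> B" using u b by simp
        show "((u(10 := j))(1 := (u(10 := j)) 1 + c)) 10 = j \<and> j \<le> l \<and>
          (u(10 := j))(1 := (u(10 := j)) 1 + c) = ?st (g + (l - j)) k j"
          unfolding e2 using u by simp
      qed
    next
      fix u assume "0 \<le> l \<and> u = ?st (g + (l - 0)) k 0"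
      then show "Q' u" using Q' by simp
    qed auto
  qed (use fits[OF k, of 0 g] in auto)
  have outer: "W m (Loop 9 (copy 8 10 ;; Loop 10 (grows c))) Q (?st 0 l 0)"
  proof (rule wp_loop[where I = "\<lambda>k u. k \<le> l \<and> u = ?st ((l - k) * l) k 0"])
    fix k u assume u: "Suc k \<le> l \<and> u = ?st ((l - Suc k) * l) (Suc k) 0"
    have e: "u(9 := k) = ?st ((l - Suc k) * l) k 0" using u by (auto simp: fun_eq_iff)
    have sk: "(l - Suc k) * l + l = (l - k) * l"
    proof -
      have "l - k = Suc (l - Suc k)" using u by auto
      then show ?thesis by simp
    qed
    have "(l - k) * l \<le> l * l" by (intro mult_le_mono1) simp
    then show "W m (copy 8 10 ;; Loop 10 (grows c)) (\<lambda>u. u 9 = k \<and> k \<le> l \<and> u = ?st ((l - k) * l) k 0) (u(9 := k))"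
      unfolding e using u sk by (intro inner) auto
  next
    fix u assume "0 \<le> l \<and> u = ?st ((l - 0) * l) 0 0"
    then have "u = base 0 (bits n + bits n * bits n * c) (Suc n) (bits n)"
      by (auto simp: fun_eq_iff l_def)
    then show "Q u" using Q by simp
  qed auto
  show ?thesis
    unfolding stretch_def l_def[symmetric]
  proof (rule wp_seq, rule wp_copy)
    have "(base 0 l (Suc n) l)(9 := (base 0 l (Suc n) l) 8) = ?st 0 l 0" by (auto simp: fun_eq_iff)
    then show "W m (Loop 9 (copy 8 10 ;; Loop 10 (grows c))) Q ((base 0 l (Suc n) l)(9 := (base 0 l (Suc n) l) 8))"
      using outer by (simp only:)
    show "fits (base 0 l (Suc n) l)" using nl ll by (auto simp: fits_def)
  qed auto
qed

lemma wp_parse: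
  assumes s: "std s" and z: "s 10 = 0" "s 11 = 0" "s 12 = 0" "s 13 = 0"
    and Q: "if m then \<forall>a b. n = (a * a + a + 1) + b * b + b + 1 \<longrightarrow> Q (s(10 := a, 11 := a * a + a + 1, 12 := b))
      else \<exists>a b. n = (a * a + a + 1) + b * b + b + 1 \<and> Q (s(10 := a, 11 := a * a + a + 1, 12 := b))"
  shows "W m parse Q s"
proof -
  note d = stdD[OF s]
  have n2: "Suc n < 2 ^ s 1" by (rule std_n[OF s])
  define P where "P a b \<longleftrightarrow> n = (a * a + a + 1) + b * b + b + 1 \<and> Q (s(10 := a, 11 := a * a + a + 1, 12 := b))" for a b
  let ?c9 = "clear 13" let ?c8 = "eq 13 7 ;; ?c9" let ?c7 = "Prim (IncR 13) ;; ?c8" let ?c6 = "Prim (IncR 13) ;; ?c7"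
  let ?c5 = "add 12 13 ;; ?c6" let ?c4 = "addmul 12 12 13 ;; ?c5" let ?c3 = "add 11 13 ;; ?c4"
  let ?c2 = "Prim (IncR 11) ;; ?c3" let ?c1 = "add 10 11 ;; ?c2" let ?c0 = "addmul 10 10 11 ;; ?c1"
  have calc: "W m ?c0 Q (s(10 := a, 12 := b))"
    if ab: "a \<le> Suc n" "b \<le> Suc n" "m \<or> P a b"
      and q: "n = (a * a + a + 1) + b * b + b + 1 \<Longrightarrow> Q (s(10 := a, 11 := a * a + a + 1, 12 := b))" for a b
  proof -
    let ?st = "\<lambda>x y. s(10 := a, 12 := b, 11 := x, 13 := y)"
    have fit: "fits (?st x y)" if "x < 2 ^ s 1" "y < 2 ^ s 1" for x y
      using d(1) that ab n2 by (auto intro!: fits_upd)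
    let ?F = "a * a + a + 1"
    have bound: "?F + b * b + b + 2 < 2 ^ s 1" if "\<not> m" using ab that n2 by (auto simp: P_def)
    have 8: "W m ?c8 Q (?st ?F (?F + b * b + b + 2))" if x: "?F < 2 ^ s 1" "?F + b * b + b + 2 < 2 ^ s 1"
    proof (rule wp_seq, rule wp_eq)
      assume "?st ?F (?F + b * b + b + 2) 13 = ?st ?F (?F + b * b + b + 2) 7"
      then have "n = (a * a + a + 1) + b * b + b + 1" using d by simp
      moreover have "(?st ?F (?F + b * b + b + 2))(13 := 0) = s(10 := a, 11 := ?F, 12 := b)"
        using z by (auto simp: fun_eq_iff)
      ultimately show "W m ?c9 Q (?st ?F (?F + b * b + b + 2))"
        using q by (intro wp_clear) (simp only:)
    next
      assume "?st ?F (?F + b * b + b + 2) 13 \<noteq> ?st ?F (?F + b * b + b + 2) 7"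
      then show m using ab d by (auto simp: P_def)
    qed (use fit[OF x] d in simp_all)
    have 7: "W m ?c7 Q (?st ?F (?F + b * b + b + 1))" if x: "?F < 2 ^ s 1"
      by (rule wp_seq, rule wp_inc) (use 8 x bound in \<open>simp_all add: fun_upd_twist\<close>)
    have 6: "W m ?c6 Q (?st ?F (?F + b * b + b))" if x: "?F < 2 ^ s 1"
      by (rule wp_seq, rule wp_inc) (use 7 x bound in simp_all)
    have 5: "W m ?c5 Q (?st ?F (?F + b * b))" if x: "?F < 2 ^ s 1" "?F + b * b < 2 ^ s 1"
      by (rule wp_seq, rule wp_add) (use 6 x bound fit[OF x] d in simp_all)
    have 4: "W m ?c4 Q (?st ?F ?F)" if x: "?F < 2 ^ s 1"
      by (rule wp_seq, rule wp_addmul) (use 5 x bound fit[OF x x] d in simp_all)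
    have 3: "W m ?c3 Q (?st ?F 0)" if x: "?F < 2 ^ s 1"
      by (rule wp_seq, rule wp_add) (use 4 x bound fit[OF x, of 0] d in simp_all)
    have 2: "W m ?c2 Q (?st (a * a + a) 0)"
      by (rule wp_seq, rule wp_inc) (use 3 bound in \<open>simp_all add: fun_upd_twist\<close>)
    have 1: "W m ?c1 Q (?st (a * a) 0)" if x: "a * a < 2 ^ s 1"
      by (rule wp_seq, rule wp_add) (use 2 bound fit[OF x, of 0] d in \<open>simp_all add: fun_upd_twist\<close>)
    have "W m ?c0 Q (?st 0 0)"
      by (rule wp_seq, rule wp_addmul) (use 1 bound fit[of 0 0] d in \<open>simp_all add: fun_upd_twist\<close>)
    moreover have "?st 0 0 = s(10 := a, 12 := b)" using z by (auto simp: fun_eq_iff)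
    ultimately show ?thesis by (simp only:)
  qed
  have g2: "W m (guess 12 7 ;; ?c0) Q (s(10 := a))" if a: "a \<le> Suc n" "m \<or> (\<exists>b. P a b)" for a
  proof (rule wp_seq, rule wp_guess)
    show "fits (s(10 := a))" using d(1) a n2 by (auto intro!: fits_upd)
    have r: "(s(10 := a)) 7 = Suc n" using d by simp
    show "if m then \<forall>b\<le>(s(10 := a)) 7. W m ?c0 Q (s(10 := a, 12 := b)) else \<exists>b\<le>(s(10 := a)) 7. W m ?c0 Q (s(10 := a, 12 := b))"
    proof (cases m)
      case True
      then have "\<forall>b\<le>Suc n. W m ?c0 Q (s(10 := a, 12 := b))" using calc[OF a(1)] Q by simp
      then show ?thesis unfolding r using True by (simp only: if_True)
    next
      case False
      then obtain b where b: "P a b" using a by blast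
      then have "b \<le> Suc n" by (simp add: P_def)
      moreover from this have "W m ?c0 Q (s(10 := a, 12 := b))"
        by (rule calc[OF a(1)]) (use b in \<open>simp_all add: P_def\<close>)
      ultimately have "\<exists>b\<le>Suc n. W m ?c0 Q (s(10 := a, 12 := b))" by blast
      then show ?thesis unfolding r using False by (simp only: if_False)
    qed
  qed (use d in simp_all)
  show ?thesis
    unfolding parse_def
  proof (rule wp_seq, rule wp_guess)
    let ?R = "W m (guess 12 7 ;; ?c0) Q"
    show "if m then \<forall>a\<le>s 7. ?R (s(10 := a)) else \<exists>a\<le>s 7. ?R (s(10 := a))"
    proof (cases m)
      case True
      then have "\<forall>a\<le>s 7. ?R (s(10 := a))" using g2 d by simp
      then show ?thesis using True by (simp only: if_True)
    next
      case False
      then obtain a b where b: "P a b" using Q by (auto simp: P_def)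
      then have "a \<le> s 7" using d by (simp add: P_def)
      moreover have "?R (s(10 := a))" using g2[of a] b calculation d by auto
      ultimately have "\<exists>a\<le>s 7. ?R (s(10 := a))" by blast
      then show ?thesis using False by (simp only: if_False)
    qed
  qed (use d in simp_all)
qed

lemma wp_decide:
  assumes B: "cells_used d n \<le> B"
    and Q: "if m then \<forall>a b F. F = a * a + a + 1 \<longrightarrow> n = F + b * b + b + 1 \<longrightarrow> graph_ok d 0 a \<longrightarrow> graph_ok d F b \<longrightarrow>
        W m tree_search Q ((base 0 (cells_used d n) (Suc n) (bits n))(23 := Suc d, 10 := a, 11 := F, 12 := b))
      else \<exists>a b F. F = a * a + a + 1 \<and> n = F + b * b + b + 1 \<and> graph_ok d 0 a \<and> graph_ok d F b \<and>
        W m tree_search Q ((base 0 (cells_used d n) (Suc n) (bits n))(23 := Suc d, 10 := a, 11 := F, 12 := b))"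
  shows "W m (decide d) Q ((\<lambda>_. 0)(0 := Suc n))"
proof -
  let ?L = "cells_used d n"
  note bl = cells_used_bounds(1)[of n d] and n2 = cells_used_bounds(2)[of n d]
    and b2 = cells_used_bounds(3)[of n d] and d2 = cells_used_bounds(4)[of d n]
  let ?s0 = "base 0 ?L (Suc n) (bits n)" let ?s1 = "?s0(23 := Suc d)"
  have std1: "std ?s1" using n2 b2 d2 by (auto simp: std_def fits_def)
  let ?c2 = "graph_check 11 12 ;; tree_search" let ?c1 = "graph_check 9 10 ;; ?c2" let ?c0 = "parse ;; ?c1"
  have checks: "W m ?c1 Q (?s1(10 := a, 11 := F, 12 := b))"
    if F: "F = a * a + a + 1" "n = F + b * b + b + 1"
      and g: "graph_ok d 0 a \<Longrightarrow> graph_ok d F b \<Longrightarrow> W m tree_search Q (?s1(10 := a, 11 := F, 12 := b))"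
        "\<not> (graph_ok d 0 a \<and> graph_ok d F b) \<Longrightarrow> m" for a b F
  proof -
    let ?s = "?s1(10 := a, 11 := F, 12 := b)"
    have lt: "a < 2 ^ ?L" "F < 2 ^ ?L" "b < 2 ^ ?L" using F n2 by linarith+
    have s: "std ?s" by (intro std_upd std1) (use lt in auto)
    have r: "?s 9 = 0" "?s 10 = a" "?s 11 = F" "?s 12 = b" by simp_all
    have 2: "W m ?c2 Q ?s" if "graph_ok d 0 a"
    proof (rule wp_seq, rule wp_graph_check[OF s, where d = d], unfold r)
      show "W m tree_search Q ?s" if "graph_ok d F b" using g(1) that \<open>graph_ok d 0 a\<close> by blast
      show m if "\<not> graph_ok d F b" using g(2) that by blast
    qed (use F in auto)
    show ?thesis
    proof (rule wp_seq, rule wp_graph_check[OF s, where d = d], unfold r)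
      show "W m ?c2 Q ?s" if "graph_ok d 0 a" using 2 that .
      show m if "\<not> graph_ok d 0 a" using g(2) that by blast
    qed (use F in auto)
  qed
  have p: "W m ?c0 Q ?s1"
  proof (rule wp_seq, rule wp_parse[OF std1])
    let ?S = "\<lambda>a b. ?s1(10 := a, 11 := a * a + a + 1, 12 := b)"
    show "if m then \<forall>a b. n = (a * a + a + 1) + b * b + b + 1 \<longrightarrow> W m ?c1 Q (?S a b)
      else \<exists>a b. n = (a * a + a + 1) + b * b + b + 1 \<and> W m ?c1 Q (?S a b)"
    proof (cases m)
      case True
      have "W m ?c1 Q (?S a b)" if "n = (a * a + a + 1) + b * b + b + 1" for a b
        by (rule checks) (use Q True that in simp_all)
      then show ?thesis unfolding if_P[OF True] by blast
    next
      case False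
      then obtain a b F where F: "F = a * a + a + 1" "n = F + b * b + b + 1" "graph_ok d 0 a" "graph_ok d F b"
        "W m tree_search Q (?s1(10 := a, 11 := F, 12 := b))" using Q by auto
      have "W m ?c1 Q (?s1(10 := a, 11 := F, 12 := b))" by (rule checks) (use F in blast)+
      then show ?thesis unfolding if_not_P[OF False] using F(1,2) by blast
    qed
  qed simp_all
  have i: "W m (incs (Suc d) 23 ;; ?c0) Q ?s0"
  proof (rule wp_seq, rule wp_incs)
    have "?s0(23 := ?s0 23 + Suc d) = ?s1" by simp
    then show "W m ?c0 Q (?s0(23 := ?s0 23 + Suc d))" using p by (simp only:)
  qed (use d2 in auto)
  have st: "W m (stretch (4 * d + 5) ;; incs (Suc d) 23 ;; ?c0) Q (base 0 (bits n) (Suc n) (bits n))"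
    by (rule wp_seq, rule wp_stretch) (use i B in \<open>simp_all only: cells_used_def\<close>)
  show ?thesis
    unfolding decide_def
    by (rule wp_seq, rule wp_measure) (use bl B st in simp_all)
qed

lemma search_env:
  assumes "search w A T a b F d" and "F = a * a + a + 1" "n = F + b * b + b + 1"
    and s: "s = (base 0 (cells_used d n) (Suc n) (bits n))(23 := Suc d, 10 := a, 11 := F, 12 := b)"
  shows "search.env w a b F d s"
proof -
  interpret search w B A T a b F d by (rule assms(1))
  note n2 = cells_used_bounds(2)[of n d] and b2 = cells_used_bounds(3)[of n d] and d2 = cells_used_bounds(4)[of d n]
  have lt: "a < 2 ^ cells_used d n" "F < 2 ^ cells_used d n" "b < 2 ^ cells_used d n" using assms(2,3) n2 by linarith+
  show ?thesis
    unfolding env_def s using n2 b2 d2 lt by (auto simp: std_def fits_def)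
qed

end

lemma (in search) stack_capacity:
  assumes "tasks l" "length l \<le> d * floor_log a + 1"
  shows "code l < 2 ^ cells_used d n"
proof -
  let ?b = "bits n"
  have "code l < Suc n ^ (length (flat l) + 1)"
    using tasks_flat[OF assms(1)] bounds(3) by (intro enc_less) auto
  also have "\<dots> \<le> (2 ^ ?b) ^ (length (flat l) + 1)"
    using bits_less[of n] by (intro power_mono) auto
  also have "\<dots> = 2 ^ (?b * (4 * length l + 1))" by (simp only: length_flat power_mult)
  also have "\<dots> \<le> 2 ^ cells_used d n"
  proof (intro power_increasing)
    have "floor_log a \<le> floor_log (Suc n)" using bounds(1) by (intro floor_log_le_iff) auto
    then have "d * floor_log a \<le> d * ?b" by (intro mult_le_mono2) (simp add: bits_def)
    then have "4 * length l + 1 \<le> 4 * (d * ?b) + 5" using assms(2) by linarith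
    then have "?b * (4 * length l + 1) \<le> ?b * (4 * (d * ?b) + 5)" by (rule mult_le_mono2)
    also have "\<dots> = 4 * d * ?b * ?b + 5 * ?b" by (simp add: algebra_simps)
    \<comment> \<open>Four digits of one extra task and the leading 1 of the stack make the 5; their
      linear share of the space is absorbed into the quadratic term.\<close>
    also have "5 * ?b \<le> ?b + 5 * (?b * ?b)" by (cases ?b) auto
    finally show "?b * (4 * length l + 1) \<le> cells_used d n"
      by (simp add: cells_used_def algebra_simps)
  qed simp
  finally show ?thesis .
qed

section \<open>The whole procedure and its space bound\<close>

lemma must_decide:
  "wp w (cells_used d (length w)) True (decide d) (\<lambda>_. w \<in> SUBTREE_ISO d) ((\<lambda>_. 0)(0 := length w + 1))"
proof -
  interpret input w "cells_used d (length w)" .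
  have "W True tree_search (\<lambda>_. w \<in> SUBTREE_ISO d)
      ((base 0 (cells_used d n) (Suc n) (bits n))(23 := Suc d, 10 := a, 11 := F, 12 := b))"
    if fab: "F = a * a + a + 1" "n = F + b * b + b + 1" and g: "graph_ok d 0 a" "graph_ok d F b" for a b F
  proof -
    let ?A = "graph_of 0 a" and ?T = "graph_of F b"
    have A: "tree_instance d ?A" "presents 0 a ?A" "encode_graph ?A = take (a * a + a + 1) (drop 0 w)"
      by (rule graph_ok_imp[OF g(1)], use fab in simp)+
    have T: "tree_instance d ?T" "presents F b ?T" "encode_graph ?T = take (b * b + b + 1) (drop F w)"
      by (rule graph_ok_imp[OF g(2)], use fab in simp)+
    interpret search w "cells_used d n" ?A ?T a b F d
      by unfold_locales (use A T fab in \<open>auto simp: tree_instance_def\<close>)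
    have w: "w = encode_graph ?A @ encode_graph ?T"
    proof -
      have "take (b * b + b + 1) (drop F w) = drop F w" using fab(2) by (intro take_all) simp
      then show ?thesis unfolding A(3) T(3) fab(1)[symmetric] by simp
    qed
    show ?thesis
    proof (rule must_search)
      show "env ((base 0 (cells_used d n) (Suc n) (bits n))(23 := Suc d, 10 := a, 11 := F, 12 := b))"
        by (rule search_env[OF search_axioms fab refl])
      fix x assume "x < b" "emb ?A ?T 0 0 x x"
      then have "\<exists>S. subtree S ?T \<and> isomorphic ?A S"
        using a_pos by (intro emb_imp_subtree[OF tA tT]) (auto simp: graph_of_def)
      then show "w \<in> SUBTREE_ISO d" using w A(1) T(1) unfolding SUBTREE_ISO_def by blast
    qed simp_all
  qed
  then show ?thesis
    using wp_decide[of d True "\<lambda>_. w \<in> SUBTREE_ISO d"] by simp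
qed

lemma may_decide:
  assumes "w \<in> SUBTREE_ISO d"
  shows "wp w (cells_used d (length w)) False (decide d) (\<lambda>_. True) ((\<lambda>_. 0)(0 := length w + 1))"
proof -
  interpret input w "cells_used d (length w)" .
  obtain A T S where w: "w = encode_graph A @ encode_graph T" and A: "tree_instance d A"
    and T: "tree_instance d T" and S: "subtree S T" "isomorphic A S"
    using assms unfolding SUBTREE_ISO_def by blast
  define a b F where "a = card (nodes A)" and "b = card (nodes T)" and "F = a * a + a + 1"
  have lenA: "length (encode_graph A) = F"
    by (simp add: length_encode_graph F_def a_def power2_eq_square)
  have w1: "w = [] @ encode_graph A @ encode_graph T" and w2: "w = encode_graph A @ encode_graph T @ []"
    using w by simp_all
  note gA = encode_imp_graph_ok[OF A w1 list.size(3) a_def]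
    and gT = encode_imp_graph_ok[OF T w2 lenA b_def]
  have nw: "n = F + b * b + b + 1"
    using w lenA by (simp add: length_encode_graph b_def power2_eq_square)
  interpret search w "cells_used d n" A T a b F d
    by unfold_locales (use A T gA gT F_def nw in \<open>auto simp: tree_instance_def\<close>)
  obtain f where f: "inj_on f (nodes A)" "f ` nodes A \<subseteq> nodes T"
    "\<forall>u\<in>nodes A. \<forall>v\<in>nodes A. {u, v} \<in> edges A \<longrightarrow> {f u, f v} \<in> edges T"
    using subtree_iso_map[OF S] by blast
  let ?s = "(base 0 (cells_used d n) (Suc n) (bits n))(23 := Suc d, 10 := a, 11 := F, 12 := b)"
  have "W False tree_search (\<lambda>_. True) ?s"
  proof (rule may_search[OF _ _ _ _ _ f(1,2)])
    show "env ?s" by (rule search_env[OF search_axioms F_def nw refl])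
    show "code l < 2 ^ ?s 1" if "tasks l" "length l \<le> d * floor_log a + 1" for l
      using stack_capacity[OF that] by simp
  qed (use f(3) in auto)
  then have "\<exists>a b F. F = a * a + a + 1 \<and> n = F + b * b + b + 1 \<and> graph_ok d 0 a \<and> graph_ok d F b \<and>
      W False tree_search (\<lambda>_. True) ((base 0 (cells_used d n) (Suc n) (bits n))(23 := Suc d, 10 := a, 11 := F, 12 := b))"
    using F_def nw gA(1) gT(1) by blast
  then show ?thesis
    using wp_decide[of d False "\<lambda>_. True"] by simp
qed

text \<open>The highest register in use is 40, and 39 tapes store registers 2 to 40.\<close>

lemma wf_decide: "wf_com 39 (decide d)"
proof -
  have "wf_com 39 (grows k)" for k by (induction k) auto
  moreover have "wf_com 39 (incs k 23)" for k by (induction k) auto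
  ultimately show ?thesis
    by (simp add: decide_def measure_input_def stretch_def parse_def graph_check_def header_def row_def
        to_root_def tree_search_def expand_def cover_def add_child_def fresh_def push4_def pop4_def push_def pop_def
        adj_def bitat_def foreach_def guess_def bit_def addmul_def neq_def eq_def lt_def copy_def add_def clear_def)
qed

text \<open>For \<open>n \<ge> 2\<close> one has \<open>n + 1 \<le> n * n\<close>, so
  \<open>bits n\<close> is at most twice the logarithm of \<open>n\<close> plus 1, hence at most
  three times that logarithm. Squaring gives the 9, and the 5 collects the linear term and the two
  extra cells.\<close>

lemma cells_used_bigo: "(\<lambda>n. real (cells_used d n + 2)) \<in> O(\<lambda>n. (log 2 (real n))\<^sup>2)"
proof (rule bigoI)
  define c where "c = real (4 * d + 5)"
  show "eventually (\<lambda>n. norm (real (cells_used d n + 2)) \<le> (5 + 9 * c) * norm ((log 2 (real n))\<^sup>2)) at_top"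
    using eventually_ge_at_top[of 2]
  proof eventually_elim
    case (elim n)
    define x where "x = log 2 (real n)"
    have x1: "1 \<le> x" using elim by (simp add: x_def)
    have "real (2 ^ floor_log (Suc n)) \<le> real (Suc n)"
      using floor_log_exp2_le[of "Suc n"] by (simp only: of_nat_le_iff)
    also have "Suc n \<le> n\<^sup>2" using elim by (cases n) (auto simp: power2_eq_square)
    then have "real (Suc n) \<le> (real n)\<^sup>2" by (metis of_nat_le_iff of_nat_power)
    finally have "(2::real) ^ floor_log (Suc n) \<le> (real n)\<^sup>2" by simp
    then have "log 2 (2 ^ floor_log (Suc n)) \<le> log 2 ((real n)\<^sup>2)" using elim by (subst log_le_cancel_iff) auto
    then have "real (floor_log (Suc n)) \<le> 2 * x" using elim by (simp add: log_nat_power x_def)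
    then have b: "real (bits n) \<le> 3 * x" using x1 by (simp add: bits_def)
    have xx: "x \<le> x * x" using x1 mult_left_mono[of 1 x x] by simp
    have "real (bits n) * real (bits n) \<le> (3 * x) * (3 * x)" using b x1 by (intro mult_mono) auto
    then have "real (bits n) * real (bits n) * c \<le> 9 * (x * x) * c"
      by (intro mult_right_mono) (auto simp: c_def)
    moreover have "real (cells_used d n + 2) = real (bits n) + real (bits n) * real (bits n) * c + 2"
      by (simp add: cells_used_def c_def)
    ultimately have "real (cells_used d n + 2) \<le> 3 * x + 9 * (x * x) * c + 2"
      using b by linarith
    also have "\<dots> \<le> 5 * (x * x) + 9 * (x * x) * c" using xx x1 by linarith
    also have "\<dots> = (5 + 9 * c) * (x * x)" by (simp add: algebra_simps)
    finally show ?case by (simp add: x_def power2_eq_square)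
  qed
qed

theorem theorem8p2:
  fixes d :: nat
  shows "SUBTREE_ISO d \<in> NSPACE (\<lambda>n. (log 2 (real n))\<^sup>2)"
  by (rule NSPACE_program[OF _ wf_decide cells_used_bigo must_decide may_decide]) simp

end
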